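(* Let $N \ge 3$ and $1 \le \eta \le \theta$ be integers, and let $f: \mathbb{N} \to [0,\infty )$ be a non-decreasing function. Assume that $\theta \le \min\{\sqrt{N}-2,(\log N)^C\}$ with some constant $C>0$. Let \[ A_{f,\eta, \theta} = \frac{12}{\pi^2} \sum_{m=\eta}^{\theta} f(m) \log \left( 1 +\frac{1}{m(m+2)} \right), \quad B_{f,\eta,\theta}= A_{f,\eta,\theta} + \frac{f(\theta)}{\theta}, \quad C_{f,\eta,\theta}= \frac{5 f(\theta)}{B_{f,\eta,\theta}}, \] and $D_{f,\eta,\theta}=B_{f,\eta,\theta} \sum_{m=\eta}^{\theta} f(m)/m^4$; define $B_{f^2,\eta,\theta}$ analogously with $f$ replaced by $f^2$. Then \[ \begin{split} \frac{1}{\varphi (N)} \sum_{a \in \mathbb{Z}_N^*} S_{f,\eta,\theta} \left( \frac{a}{N} \right)^2 - \bigg( \frac{1}{\varphi (N)} &\sum_{a \in \mathbb{Z}_N^*} S_{f,\eta,\theta} \left( \frac{a}{N} \right) \bigg)^2 \\ \ll &D_{f,\eta,\theta} (\log N)^2 + B_{f^2,\eta,\theta} \log N + B_{f,\eta,\theta}^2 \log N (\log \log N)^3 \\ &+ B_{f,\eta,\theta} \left( \sqrt{B_{f^2,\eta,\theta}}+ f(\lceil \sqrt{C_{f,\eta,\theta}} \rceil) \right) \log N \log \log N \end{split} \] with an implied constant depending only on $C$.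
   Context: For an integer $N\ge 2$, $\mathbb{Z}_N^*$ denotes the set of integers $1\le a\le N$ coprime to $N$, and $\varphi$ is Euler's totient function. For $a\in\mathbb{Z}_N^*$, $a/N=[0;a_1,\ldots,a_r]$ is the canonical continued fraction expansion (with $a_r>1$). For integers $1\le\eta\le\theta$ and a function $f:\mathbb{N}\to[0,\infty)$, the restricted sum is $S_{f,\eta,\theta}(a/N)=\sum_{i=1}^r \mathds{1}_{\{\eta\le a_i\le\theta\}}f(a_i)$. *)

theory Defs
  imports Complex_Main "HOL-Number_Theory.Totient"
begin

text \<open>\<open>cf_value [a\<^sub>1, \<dots>, a\<^sub>r]\<close> is the value of \<open>[0; a\<^sub>1, \<dots>, a\<^sub>r]\<close>.\<close>

fun cf_value :: "nat list \<Rightarrow> real" where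
  "cf_value [] = 0"
| "cf_value (a # as) = 1 / (real a + cf_value as)"

definition is_canonical_cf :: "nat list \<Rightarrow> real \<Rightarrow> bool" where
  "is_canonical_cf as x \<longleftrightarrow>
     as \<noteq> [] \<and> (\<forall>a\<in>set as. a \<ge> 1) \<and> last as > 1 \<and> x = cf_value as"

text \<open>Only meaningful for rational \<open>x\<close> with \<open>0 < x < 1\<close>; see \<open>canonical_cf_ex1\<close>.\<close>

definition canonical_cf :: "real \<Rightarrow> nat list" where
  "canonical_cf x = (THE as. is_canonical_cf as x)"

definition S_restr :: "(nat \<Rightarrow> real) \<Rightarrow> nat \<Rightarrow> nat \<Rightarrow> real \<Rightarrow> real" where
  "S_restr f \<eta> \<theta> x =
     (let as = canonical_cf x
      in \<Sum>i<length as. if \<eta> \<le> as ! i \<and> as ! i \<le> \<theta> then f (as ! i) else 0)"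

definition A_const :: "(nat \<Rightarrow> real) \<Rightarrow> nat \<Rightarrow> nat \<Rightarrow> real" where
  "A_const f \<eta> \<theta> =
     12 / pi\<^sup>2 * (\<Sum>m=\<eta>..\<theta>. f m * ln (1 + 1 / (real m * (real m + 2))))"

definition B_const :: "(nat \<Rightarrow> real) \<Rightarrow> nat \<Rightarrow> nat \<Rightarrow> real" where
  "B_const f \<eta> \<theta> = A_const f \<eta> \<theta> + f \<theta> / real \<theta>"

text \<open>If \<open>f \<theta> = 0\<close>, then \<open>B_const f \<eta> \<theta> = 0\<close> for the functions considered here,
  and the quotient below is \<open>0\<close> by the convention \<open>0 / 0 = 0\<close>.\<close>

definition C_const :: "(nat \<Rightarrow> real) \<Rightarrow> nat \<Rightarrow> nat \<Rightarrow> real" where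
  "C_const f \<eta> \<theta> = 5 * f \<theta> / B_const f \<eta> \<theta>"

definition D_const :: "(nat \<Rightarrow> real) \<Rightarrow> nat \<Rightarrow> nat \<Rightarrow> real" where
  "D_const f \<eta> \<theta> = B_const f \<eta> \<theta> * (\<Sum>m=\<eta>..\<theta>. f m / real m ^ 4)"

definition mean_totatives :: "nat \<Rightarrow> (real \<Rightarrow> real) \<Rightarrow> real" where
  "mean_totatives N g = 1 / real (totient N) * (\<Sum>a\<in>totatives N. g (real a / real N))"

lemma cf_value_nonneg: "cf_value as \<ge> 0"
  by (induction as) auto

lemma cf_value_bounds:
  assumes "as \<noteq> []" "\<forall>a\<in>set as. a \<ge> 1" "last as > 1"
  shows "0 < cf_value as \<and> cf_value as < 1"
  using assms
proof (induction as)
  case (Cons a as)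
  show ?case
  proof (cases "as = []")
    case False
    with Cons have "0 < cf_value as" by auto
    moreover from Cons have "real a \<ge> 1" by auto
    ultimately show ?thesis by (simp add: divide_simps)
  qed (use Cons in auto)
qed simp

lemma cf_value_tail_less_1:
  assumes "\<forall>b\<in>set (a # as). b \<ge> 1" "last (a # as) > 1"
  shows "cf_value as < 1"
  using assms cf_value_bounds[of as] by (cases "as = []") auto

lemma canonical_cf_unique:
  assumes "is_canonical_cf as x" "is_canonical_cf bs x"
  shows "as = bs"
  using assms
proof (induction as arbitrary: bs x)
  case (Cons a as)
  note prems = Cons.prems
  from prems(2) obtain b bs' where bs: "bs = b # bs'"
    by (cases bs) (auto simp: is_canonical_cf_def)
  have a: "\<forall>c\<in>set (a # as). c \<ge> 1" "last (a # as) > 1" "x = cf_value (a # as)"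
    and b: "\<forall>c\<in>set (b # bs'). c \<ge> 1" "last (b # bs') > 1" "x = cf_value (b # bs')"
    using prems unfolding bs is_canonical_cf_def by blast+
  have lt: "cf_value as < 1" "cf_value bs' < 1"
    using cf_value_tail_less_1 a b by blast+
  have ge: "cf_value as \<ge> 0" "cf_value bs' \<ge> 0"
    by (rule cf_value_nonneg)+
  have eq: "real a + cf_value as = real b + cf_value bs'"
    using a(3) b(3) by (metis cf_value.simps(2) div_by_1 divide_divide_eq_right mult_1)
  have "a = b" using eq lt ge by linarith
  with eq have v: "cf_value as = cf_value bs'" by simp
  have "as = bs'"
  proof (cases "as = [] \<or> bs' = []")
    case True
    have "as = []" if "bs' = []" using that v a cf_value_bounds[of as] by (cases "as = []") auto
    moreover have "bs' = []" if "as = []"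
      using that v b cf_value_bounds[of bs'] by (cases "bs' = []") auto
    ultimately show ?thesis using True by blast
  next
    case False
    then have "is_canonical_cf as (cf_value as)" "is_canonical_cf bs' (cf_value as)"
      using a b v by (auto simp: is_canonical_cf_def)
    then show ?thesis by (rule Cons.IH)
  qed
  with \<open>a = b\<close> bs show ?case by simp
qed (auto simp: is_canonical_cf_def)

lemma canonical_cf_exists:
  assumes "0 < a" "a < N"
  shows "\<exists>as. is_canonical_cf as (real a / real N)"
  using assms
proof (induction a arbitrary: N rule: less_induct)
  case (less a)
  define q where "q = N div a"
  define r where "r = N mod a"
  have N: "real N = real q * real a + real r"
    unfolding q_def r_def by (metis div_mult_mod_eq of_nat_add of_nat_mult)
  have r: "r < a" using less by (simp add: r_def)
  have q: "q \<ge> 1" using less by (simp add: q_def Suc_le_eq div_greater_zero_iff)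
  show ?case
  proof (cases "r = 0")
    case True
    have "q \<noteq> 1" using N True less by auto
    then have "is_canonical_cf [q] (real a / real N)"
      using N True q less by (auto simp: is_canonical_cf_def)
    then show ?thesis by blast
  next
    case False
    with less.IH[OF r, of a] r obtain as where "is_canonical_cf as (real r / real a)" by auto
    then have as: "as \<noteq> []" "\<forall>c\<in>set as. c \<ge> 1" "last as > 1" "cf_value as = real r / real a"
      by (auto simp: is_canonical_cf_def)
    have "real q + cf_value as = real N / real a"
      using less.prems N as(4) by (simp add: add_divide_distrib)
    then have "cf_value (q # as) = real a / real N"
      by simp
    then have "is_canonical_cf (q # as) (real a / real N)"
      using as q by (auto simp: is_canonical_cf_def)
    then show ?thesis by blast
  qed
qed

lemma canonical_cf_ex1:
  assumes "0 < a" "a < N"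
  shows "\<exists>!as. is_canonical_cf as (real a / real N)"
  using canonical_cf_exists[OF assms] canonical_cf_unique by blast

end

theory Submission
  imports Defs "HOL-Analysis.Analysis" "HOL-Real_Asymp.Real_Asymp"
begin

text \<open>
  The variance is in fact \<open>O(B\<^bsub>f\<^sup>2\<^esub> log N)\<close>; the other terms of the bound are only used through
  their nonnegativity. Split the digits of \<open>a/N\<close> into those where the prefix has denominator at most
  \<open>Q = N\<^bsup>1/2\<^esup> exp(- O((log log N)\<^sup>2))\<close>, those where the suffix has denominator at most \<open>Q\<close>, and the
  few digits in between. Reversing continued fractions exchanges the first two parts.

  A cylinder of denominator at most \<open>Q\<close> is so long that, by an upper bound sieve, it contains at most a
  constant times the expected number of reduced fractions \<open>a/N\<close>. A nonnegative functional of the first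
  part, such as its squared deviation from a constant, therefore has mean at most a constant times its
  Lebesgue mean, and for Lebesgue measure the ratios of consecutive denominators form a Markov chain
  with a spectral gap on Lipschitz functions. Solving the Poisson equation of this chain replaces the
  sum by a stopped martingale, up to bounded terms.

  The second moment of the middle part is estimated by Cauchy-Schwarz and by counting the solutions of
  \<open>N = m x z + x' z + x z'\<close>.
\<close>

section \<open>The Markov chain of denominator ratios\<close>

text \<open>The sieve yields upper bounds only, and loses a constant factor, so the mean of the
  digit sum cannot be computed through it. What survives such a loss is an upper bound for the mean
  of a nonnegative quantity. This is enough, because the variance is the least mean square deviation
  from a constant, and the constant may be taken as the value \<open>2 * (A * ln Q)\<close> that the
  Lebesgue model predicts. Two losses in the middle part shape the elementary estimates. First, the
  count of solutions is proportional to \<open>N\<close> and not to \<open>totient N\<close>.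
  Comparing the odd prime divisors with \<open>p div 2\<close> gives \<open>N / totient N\<close> =
  O((log N)^(1/2)); the other factors of the middle part are O((log log N)^4), so the product stays
  below \<open>ln N\<close>. Second, the error term of the count contains the number of divisors of
  \<open>N\<close>, which times \<open>\<theta>^2\<close> must not exceed \<open>Q\<close>, and
  \<open>Q\<close> is slightly smaller than N^(1/2). Hence a divisor bound with an exponent below
  1/2 is needed; 4/9 is the exponent that comes out of 2^9 <= 5^4.\<close>

text \<open>\<open>dprob t b\<close> is the conditional probability (Lebesgue measure) that the next digit is \<open>b\<close>, given
  a prefix whose last two denominators have ratio \<open>t\<close>; the ratio then becomes \<open>1 / (b + t)\<close>.\<close>

definition dprob :: "real \<Rightarrow> nat \<Rightarrow> real" where
  "dprob t b = (1 + t) / ((real b + t) * (real b + 1 + t))"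

section \<open>Conditional means of slowly growing functions\<close>

definition dmean :: "real \<Rightarrow> (nat \<Rightarrow> real) \<Rightarrow> real" where
  "dmean t h = (\<Sum>b. dprob t (Suc b) * h (Suc b))"

text \<open>Weights of order \<open>1 / b^2\<close> times \<open>sqrt b\<close> remain summable, so
  \<open>dmean\<close> is linear and monotone on this class. It contains the finitely supported
  functions and the square of the logarithm, which is all the growth that occurs below.\<close>

definition slow :: "(nat \<Rightarrow> real) \<Rightarrow> bool" where
  "slow h \<longleftrightarrow> (\<exists>C. \<forall>b\<ge>1. \<bar>h b\<bar> \<le> C * sqrt (real b))"

lemma slow_add:
  assumes "slow g" "slow h" shows "slow (\<lambda>b. g b + h b)"
proof -
  obtain C D where "\<And>b. b \<ge> 1 \<Longrightarrow> \<bar>g b\<bar> \<le> C * sqrt (real b)" "\<And>b. b \<ge> 1 \<Longrightarrow> \<bar>h b\<bar> \<le> D * sqrt (real b)"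
    using assms unfolding slow_def by blast
  then have "\<bar>g b + h b\<bar> \<le> (C + D) * sqrt (real b)" if "b \<ge> 1" for b
    using that abs_triangle_ineq[of "g b" "h b"] by (smt (verit) distrib_right)
  then show ?thesis unfolding slow_def by blast
qed

lemma slow_cmult:
  assumes "slow g" shows "slow (\<lambda>b. c * g b)"
proof -
  obtain C where C: "\<And>b. b \<ge> 1 \<Longrightarrow> \<bar>g b\<bar> \<le> C * sqrt (real b)"
    using assms unfolding slow_def by blast
  have "\<bar>c * g b\<bar> \<le> (\<bar>c\<bar> * C) * sqrt (real b)" if "b \<ge> 1" for b
    using mult_left_mono[OF C[OF that], of "\<bar>c\<bar>"] by (simp add: abs_mult mult.assoc)
  then show ?thesis unfolding slow_def by blast
qed

lemma slow_diff: "slow g \<Longrightarrow> slow h \<Longrightarrow> slow (\<lambda>b. g b - h b)"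
  using slow_add[of g "\<lambda>b. -1 * h b"] slow_cmult[of h "-1"] by simp

lemma slow_bounded:
  assumes "\<And>b. b \<ge> 1 \<Longrightarrow> \<bar>g b\<bar> \<le> C" shows "slow g"
proof -
  have "\<bar>g b\<bar> \<le> C * sqrt (real b)" if "b \<ge> 1" for b
  proof -
    have "C \<ge> 0" using assms[of 1] by simp
    then have "C * 1 \<le> C * sqrt (real b)" using that by (intro mult_left_mono) auto
    with assms[OF that] show ?thesis by simp
  qed
  then show ?thesis unfolding slow_def by blast
qed

lemma slow_const [simp]: "slow (\<lambda>_. c)" by (rule slow_bounded[of _ "\<bar>c\<bar>"]) auto

lemma slow_le:
  assumes "slow h" "\<And>b. b \<ge> 1 \<Longrightarrow> \<bar>g b\<bar> \<le> \<bar>h b\<bar>" shows "slow g"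
  using assms unfolding slow_def by (meson order.trans)

lemma slow_finite_support: "(\<And>b. b > n \<Longrightarrow> h b = 0) \<Longrightarrow> slow h"
proof (rule slow_bounded[of h "\<Sum>b\<le>n. \<bar>h b\<bar>"])
  fix b assume *: "\<And>b. b > n \<Longrightarrow> h b = 0"
  show "\<bar>h b\<bar> \<le> (\<Sum>b\<le>n. \<bar>h b\<bar>)"
  proof (cases "b \<le> n")
    case True
    then show ?thesis by (intro member_le_sum) auto
  next
    case False
    then show ?thesis using * by (simp add: sum_nonneg)
  qed
qed

text \<open>A fourth root, so that the square of the logarithm stays within the growth
  \<open>sqrt b\<close> allowed by \<open>slow\<close>.\<close>

lemma ln_le_root4: "ln (x::real) \<le> 4 * sqrt (sqrt x)" if "x \<ge> 1" for x
proof -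
  have "ln (sqrt (sqrt x)) \<le> sqrt (sqrt x) - 1" using that by (intro ln_le_minus_one) auto
  moreover have "ln (sqrt (sqrt x)) = ln x / 4" using that by (simp add: ln_sqrt)
  ultimately show ?thesis by simp
qed

lemma ln_sq_le: "(ln (real b + 1))\<^sup>2 \<le> 32 * sqrt (real b)" if "b \<ge> 1" for b
proof -
  have "(ln (real b + 1))\<^sup>2 \<le> (4 * sqrt (sqrt (real b + 1)))\<^sup>2"
    by (intro power_mono ln_le_root4) auto
  also have "\<dots> = 16 * sqrt (real b + 1)" by (simp add: power_mult_distrib)
  also have "sqrt (real b + 1) \<le> sqrt (4 * real b)" using that by (intro real_sqrt_le_mono) simp
  also have "sqrt (4 * real b) = 2 * sqrt (real b)" by (simp add: real_sqrt_mult)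
  finally show ?thesis by simp
qed

lemma slow_ln_sq: "slow (\<lambda>b. (ln (real b + 1))\<^sup>2)"
  unfolding slow_def using ln_sq_le by (intro exI[of _ 32]) auto

lemma slow_ln: assumes "0 \<le> t" "t \<le> 1" shows "slow (\<lambda>b. ln (real b + t))"
proof (rule slow_le[OF slow_add[OF slow_ln_sq slow_const[of 1]]])
  fix b :: nat assume b: "b \<ge> 1"
  have "0 \<le> ln (real b + t)" "ln (real b + t) \<le> ln (real b + 1)" using assms b by auto
  moreover have "ln (real b + 1) \<le> (ln (real b + 1))\<^sup>2 + 1"
    using sum_power2_ge_zero[of "ln (real b + 1) - 1" "ln (real b + 1)"]
      by (simp add: power2_eq_square algebra_simps)
  ultimately show "\<bar>ln (real b + t)\<bar> \<le> \<bar>(ln (real b + 1))\<^sup>2 + 1\<bar>" by linarith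
qed

lemma dprob_nonneg: "0 \<le> t \<Longrightarrow> dprob t b \<ge> 0"
  by (simp add: dprob_def)

lemma dprob_le: assumes "0 \<le> t" "t \<le> 1" "b \<ge> 1" shows "dprob t b \<le> 2 / (real b + 1)\<^sup>2"
proof -
  have b: "real b \<ge> 1" using assms by simp
  have *: "(1 + t) / (real b + t) \<le> 2 / (real b + 1)"
    using assms b mult_right_mono[of t 1 "real b - 1"] by (simp add: field_simps)
  have "dprob t b = (1 + t) / (real b + t) * (1 / (real b + 1 + t))" by (simp add: dprob_def)
  also have "\<dots> \<le> 2 / (real b + 1) * (1 / (real b + 1))"
    using assms b by (intro mult_mono * divide_left_mono) auto
  finally show ?thesis by (simp add: power2_eq_square)
qed

text \<open>The weights telescope: \<open>dprob t b\<close> is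
  \<open>(1 + t) / (b + t) - (1 + t) / (b + 1 + t)\<close>. For \<open>n = 0\<close> the total is
  \<open>1\<close>; for general \<open>n\<close> this is the probability that the next digit exceeds
  \<open>n\<close>, which is the weight of stopping in \<open>one_step_inequality\<close>.\<close>

lemma dprob_sums: assumes "0 \<le> t"
  shows "(\<lambda>i. dprob t (Suc (n + i))) sums ((1 + t) / (real n + 1 + t))"
proof -
  have "(\<lambda>i. (1+t) / (real n + 1 + t + real i) - (1+t) / (real n + 1 + t + real (Suc i)))
      sums ((1+t) / (real n + 1 + t + real 0) - 0)"
    by (rule telescope_sums') real_asymp
  moreover have "(1+t) / (real n + 1 + t + real i) - (1+t) / (real n + 1 + t + real (Suc i))
      = dprob t (Suc (n + i))" for i
    using assms by (simp add: dprob_def field_simps)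
  ultimately show ?thesis by simp
qed

lemma summable_dprob_slow: assumes "0 \<le> t" "t \<le> 1" "slow h"
  shows "summable (\<lambda>b. dprob t (Suc b) * h (Suc b))"
proof -
  obtain C where C: "\<And>b. b \<ge> 1 \<Longrightarrow> \<bar>h b\<bar> \<le> C * sqrt (real b)"
    using assms(3) unfolding slow_def by blast
  have "summable (\<lambda>b. real b powr (-3/2))" by (subst summable_real_powr_iff) simp
  then have s: "summable (\<lambda>b. 2 * C * real (Suc b) powr (-3/2))"
    by (subst (asm) summable_Suc_iff[symmetric]) (rule summable_mult)
  show ?thesis
  proof (rule summable_comparison_test'[OF s, of 0])
    fix b :: nat
    let ?b = "real (Suc b)"
    have "C \<ge> 0" using C[of 1] by simp
    have "\<bar>dprob t (Suc b) * h (Suc b)\<bar> \<le> 2 / (?b + 1)\<^sup>2 * (C * sqrt ?b)"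
      unfolding abs_mult using dprob_le[of t "Suc b"] dprob_nonneg[of t] assms C[of "Suc b"]
      by (intro mult_mono) auto
    also have "\<dots> \<le> 2 / ?b\<^sup>2 * (C * sqrt ?b)"
      using \<open>C \<ge> 0\<close> by (intro mult_right_mono divide_left_mono power_mono) auto
    also have "\<dots> = 2 * C * ?b powr (-3/2)"
    proof -
      have "?b powr (1/2) = ?b powr (2 + (-3/2))" by simp
      also have "\<dots> = ?b powr 2 * ?b powr (-3/2)" by (rule powr_add)
      also have "?b powr 2 = ?b\<^sup>2" by simp
      finally show ?thesis by (simp add: powr_half_sqrt field_simps)
    qed
    finally show "norm (dprob t (Suc b) * h (Suc b)) \<le> 2 * C * ?b powr (-3/2)" by simp
  qed
qed

lemma dmean_add: assumes "0 \<le> t" "t \<le> 1" "slow g" "slow h"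
  shows "dmean t (\<lambda>b. g b + h b) = dmean t g + dmean t h"
  unfolding dmean_def using assms
  by (subst suminf_add) (simp_all add: summable_dprob_slow distrib_left right_diff_distrib mult.left_commute mult.assoc)

lemma dmean_cmult: assumes "0 \<le> t" "t \<le> 1" "slow g"
  shows "dmean t (\<lambda>b. c * g b) = c * dmean t g"
  unfolding dmean_def using assms
  by (subst suminf_mult[symmetric]) (simp_all add: summable_dprob_slow distrib_left right_diff_distrib mult.left_commute mult.assoc)

lemma dmean_diff: assumes "0 \<le> t" "t \<le> 1" "slow g" "slow h"
  shows "dmean t (\<lambda>b. g b - h b) = dmean t g - dmean t h"
  unfolding dmean_def using assms
  by (subst suminf_diff) (simp_all add: summable_dprob_slow distrib_left right_diff_distrib mult.left_commute mult.assoc)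

lemma dmean_const: "0 \<le> t \<Longrightarrow> dmean t (\<lambda>_. c) = c"
proof -
  assume "0 \<le> t"
  from dprob_sums[OF this, of 0] this have "(\<lambda>i. dprob t (Suc i)) sums 1" by simp
  then have "(\<lambda>i. dprob t (Suc i) * c) sums (1 * c)" by (rule sums_mult2)
  then show ?thesis by (simp add: dmean_def sums_iff)
qed

lemma dmean_mono: assumes "0 \<le> t" "t \<le> 1" "slow g" "slow h" "\<And>b. b \<ge> 1 \<Longrightarrow> g b \<le> h b"
  shows "dmean t g \<le> dmean t h"
  unfolding dmean_def using assms
  by (intro suminf_le mult_left_mono dprob_nonneg summable_dprob_slow) auto

lemma dmean_split: assumes "0 \<le> t" "t \<le> 1" "slow g"
  shows "dmean t g = (\<Sum>b=1..n. dprob t b * g b) + (\<Sum>i. dprob t (Suc (n + i)) * g (Suc (n + i)))"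
proof -
  have "(\<Sum>b<n. dprob t (Suc b) * g (Suc b)) = (\<Sum>b=1..n. dprob t b * g b)"
    by (rule sum.reindex_bij_witness[of _ "\<lambda>b. b - 1" Suc]) auto
  then show ?thesis
    unfolding dmean_def using suminf_split_initial_segment[OF summable_dprob_slow[OF assms], of n]
    by (simp add: add.commute)
qed

lemma dmean_finite_le:
  assumes "0 \<le> t" "t \<le> 1" "\<And>b. b > n \<Longrightarrow> h b = 0" "\<And>b. b \<ge> 1 \<Longrightarrow> h b \<ge> 0"
  shows "dmean t h \<le> 2 * (\<Sum>b=1..n. h b / (real b)\<^sup>2)"
proof -
  have "dmean t h = (\<Sum>b=1..n. dprob t b * h b)"
    using dmean_split[OF assms(1,2) slow_finite_support[of n], of h n] assms(3) by simp
  also have "\<dots> \<le> (\<Sum>b=1..n. 2 * (h b / (real b)\<^sup>2))"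
  proof (rule sum_mono)
    fix b assume b: "b \<in> {1..n}"
    have "dprob t b \<le> 2 / (real b)\<^sup>2" 
    proof -
      have "dprob t b \<le> 2 / (real b + 1)\<^sup>2" using dprob_le[of t b] assms b by auto
      also have "\<dots> \<le> 2 / (real b)\<^sup>2" using b by (intro divide_left_mono power_mono) auto
      finally show ?thesis .
    qed
    then have "dprob t b * h b \<le> 2 / (real b)\<^sup>2 * h b" using assms(4) b by (intro mult_right_mono) auto
    then show "dprob t b * h b \<le> 2 * (h b / (real b)\<^sup>2)" by simp
  qed
  finally show ?thesis by (simp add: sum_distrib_left)
qed

text \<open>Over the common denominator the difference is \<open>(t - s) * B / (v t * v s)\<close>.
  From \<open>b = 3\<close> on, \<open>B\<close> lies between \<open>0\<close> and
  \<open>b * (b + 1)\<close>. The digits \<open>1\<close> and \<open>2\<close> are treated apart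
  because the general bound gives only \<open>1/2\<close> and \<open>1/6\<close> there, and with
  these values the estimate of \<open>dop_contracts\<close> would exceed \<open>1\<close>.\<close>

lemma dprob_lipschitz:
  assumes "0 \<le> t" "t \<le> 1" "0 \<le> s" "s \<le> 1" "b \<ge> 1"
  shows "\<bar>dprob t b - dprob s b\<bar> \<le> \<bar>t - s\<bar> / (real b * (real b + 1))"
    and "b = 1 \<Longrightarrow> \<bar>dprob t b - dprob s b\<bar> \<le> \<bar>t - s\<bar> / 4"
    and "b = 2 \<Longrightarrow> \<bar>dprob t b - dprob s b\<bar> \<le> \<bar>t - s\<bar> / 18"
proof -
  define B where "B = real b * (real b + 1) - (2 * real b + 1) - (t + s) - t * s"
  define v where "v = (\<lambda>t. (real b + t) * (real b + 1 + t))"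
  have b: "real b \<ge> 1" using assms by simp
  have v: "v t > 0" "v s > 0" using assms b by (auto simp: v_def)
  have vge: "v t \<ge> real b * (real b + 1)" "v s \<ge> real b * (real b + 1)"
    using assms b unfolding v_def by (intro mult_mono; simp)+
  have "dprob t b - dprob s b = ((1 + t) * v s - (1 + s) * v t) / (v t * v s)"
    proof -
    have "dprob t b = (1 + t) / v t" "dprob s b = (1 + s) / v s" by (simp_all add: dprob_def v_def)
    then show ?thesis using v by (simp add: diff_frac_eq)
  qed
  also have "(1 + t) * v s - (1 + s) * v t = (t - s) * B"
    unfolding v_def B_def by (simp add: algebra_simps)
  finally have eq0: "\<bar>dprob t b - dprob s b\<bar> = \<bar>t - s\<bar> * (\<bar>B\<bar> / (v t * v s))"
    using v by (simp add: abs_mult abs_divide)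
  have bound: "\<bar>dprob t b - dprob s b\<bar> \<le> \<bar>t - s\<bar> * c" if "\<bar>B\<bar> / (v t * v s) \<le> c" for c
    unfolding eq0 using that by (intro mult_left_mono) auto
  have st: "0 \<le> t * s" "t * s \<le> 1" using assms by (auto intro: mult_le_one)
  have vv: "v t * v s \<ge> (real b * (real b + 1)) * (real b * (real b + 1))"
    using vge b v by (intro mult_mono) auto
  show c1: "\<bar>dprob t b - dprob s b\<bar> \<le> \<bar>t - s\<bar> / 4" if "b = 1"
  proof -
    have "B = - ((1 + t) * (1 + s))" using that by (simp add: B_def algebra_simps)
    moreover have "v t * v s = ((1 + t) * (1 + s)) * ((2 + t) * (2 + s))" 
      using that by (simp add: v_def)
    ultimately have "\<bar>B\<bar> / (v t * v s) = 1 / ((2 + t) * (2 + s))"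
      using assms by (simp add: abs_mult)
    also have "\<dots> \<le> 1 / (2 * 2)" using assms by (intro divide_left_mono mult_mono) auto
    finally show ?thesis using bound by fastforce
  qed
  show c2: "\<bar>dprob t b - dprob s b\<bar> \<le> \<bar>t - s\<bar> / 18" if "b = 2"
  proof -
    have "B = 1 - (t + s) - t * s" using that by (simp add: B_def)
    then have "\<bar>B\<bar> \<le> 2" using st assms unfolding abs_le_iff by linarith
    then have "\<bar>B\<bar> / (v t * v s) \<le> 2 / 36" using vv v that by (intro frac_le) auto
    then show ?thesis using bound[of "1/18"] by simp
  qed
  show "\<bar>dprob t b - dprob s b\<bar> \<le> \<bar>t - s\<bar> / (real b * (real b + 1))"
  proof -
    consider "b = 1" | "b = 2" | "b \<ge> 3" using assms by linarith
    then show ?thesis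
    proof cases
      case 1
      with c1[OF 1] show ?thesis by simp
    next
      case 2
      with c2[OF 2] show ?thesis by simp
    next
      case 3
      then have b3: "real b \<ge> 3" by simp
      then have "real b * real b \<ge> 3 * real b" by (intro mult_right_mono) auto
      moreover have "real b * (real b + 1) = real b * real b + real b" by (simp add: algebra_simps)
      ultimately have "B \<ge> 0" "B \<le> real b * (real b + 1)"
        unfolding B_def using assms st b3 by linarith+
      then have "\<bar>B\<bar> / (v t * v s) \<le> (real b * (real b + 1)) / ((real b * (real b + 1)) * (real b * (real b + 1)))"
        using vv v b by (intro frac_le) auto
      also have "\<dots> = 1 / (real b * (real b + 1))" by simp
      finally show ?thesis using bound[of "1 / (real b * (real b + 1))"] by simp
    qed
  qed
qed

section \<open>The transition operator of the chain and its Poisson equation\<close>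

definition dop :: "(real \<Rightarrow> real) \<Rightarrow> real \<Rightarrow> real" where
  "dop g t = dmean t (\<lambda>b. g (1 / (real b + t)))"

definition lip01 :: "real \<Rightarrow> (real \<Rightarrow> real) \<Rightarrow> bool" where
  "lip01 L g \<longleftrightarrow> (\<forall>t\<in>{0..1}. \<forall>s\<in>{0..1}. \<bar>g t - g s\<bar> \<le> L * \<bar>t - s\<bar>)"

lemma lip01_nonneg: "lip01 L g \<Longrightarrow> L \<ge> 0"
proof -
  assume "lip01 L g"
  then have a: "\<forall>t\<in>{0..1}. \<forall>s\<in>{0..1}. \<bar>g t - g s\<bar> \<le> L * \<bar>t - s\<bar>" by (simp add: lip01_def)
  have "\<bar>g 0 - g 1\<bar> \<le> L * \<bar>0 - 1\<bar>" by (rule bspec[OF bspec[OF a]]) auto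
  then show ?thesis by simp
qed

lemma inv_mem01: "0 \<le> t \<Longrightarrow> b \<ge> 1 \<Longrightarrow> 1 / (real b + t) \<in> {0..1}"
  by (auto simp: divide_simps)

lemma lip01_near:
  assumes "lip01 L g" "s \<in> {0..1}" "t \<in> {0..1}" shows "\<bar>g t - g s\<bar> \<le> L"
proof -
  have "\<bar>g t - g s\<bar> \<le> L * \<bar>t - s\<bar>" using assms unfolding lip01_def by blast
  also have "\<dots> \<le> L * 1" using assms lip01_nonneg[OF assms(1)] by (intro mult_left_mono) auto
  finally show ?thesis by simp
qed

lemma slow_bounded01:
  assumes "\<And>t. t \<in> {0..1} \<Longrightarrow> \<bar>g t\<bar> \<le> C" "0 \<le> t"
  shows "slow (\<lambda>b. g (1 / (real b + t)))"
  using assms inv_mem01 by (intro slow_bounded[of _ C]) auto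

lemma slow_lip01: assumes "lip01 L g" "0 \<le> t"
  shows "slow (\<lambda>b. g (1 / (real b + t)))"
proof (rule slow_bounded01)
  fix s :: real assume "s \<in> {0..1}"
  then show "\<bar>g s\<bar> \<le> \<bar>g 0\<bar> + L" using lip01_near[OF assms(1), of 0 s] by auto
qed fact

text \<open>The summand bounds the contribution of the digit \<open>n = b + 1\<close> to the
  Lipschitz constant in \<open>dop_contracts\<close>: the weight \<open>2 / (n + 1)^2\<close> times
  the contraction \<open>1 / n^2\<close>, plus the variation of the weight times the bound
  \<open>1/2\<close> for the centred function. This is \<open>1/2 + 1/8\<close> for
  \<open>n = 1\<close>, \<open>1/18 + 1/36\<close> for \<open>n = 2\<close>, and at most
  \<open>(1/6 + 1/2) / (n * (n + 1))\<close> for \<open>n >= 3\<close>.\<close>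

lemma contraction_weights:
  "(\<lambda>b. if b = 0 then 5/8 else if b = 1 then 1/12 else 2/3 * (1 / (real (Suc b) * (real (Suc b) + 1))))
     sums (5/8 + 1/12 + 2/9)" (is "?e sums _")
proof -
  have "(\<lambda>i. 1 / (real i + 3) - 1 / (real (Suc i) + 3)) sums (1 / (real 0 + 3) - 0)"
    by (rule telescope_sums') real_asymp
  then have "(\<lambda>i. 2/3 * (1 / (real i + 3) - 1 / (real (Suc i) + 3))) sums (2/3 * (1/3))"
    by (intro sums_mult) simp
  moreover have "(\<lambda>i. ?e (i + 2)) = (\<lambda>i. 2/3 * (1 / (real i + 3) - 1 / (real (Suc i) + 3)))"
    by (rule ext) (simp add: divide_simps)
  ultimately have "(\<lambda>i. ?e (i + 2)) sums (2/9)" by simp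
  then have "?e sums (2/9 + (\<Sum>i<2. ?e i))" by (rule iffD1[OF sums_iff_shift])
  moreover have "2/9 + (\<Sum>i<2. ?e i) = 5/8 + 1/12 + 2/9" by (simp add: numeral_2_eq_2)
  ultimately show ?thesis by simp
qed

text \<open>Subtracting \<open>g (1/2)\<close> first halves the contribution of the variation of the weights; without
  it the crude estimates below would not give a factor smaller than \<open>1\<close>.\<close>

lemma dop_contracts:
  assumes g: "lip01 L g" shows "lip01 (15/16 * L) (dop g)"
  unfolding lip01_def
proof (intro ballI)
  fix t s :: real assume ts: "t \<in> {0..1}" "s \<in> {0..1}"
  then have ts': "0 \<le> t" "t \<le> 1" "0 \<le> s" "s \<le> 1" by auto
  have L: "L \<ge> 0" by (rule lip01_nonneg[OF g])
  define h where "h = (\<lambda>x. g x - g (1/2))"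
  define d where "d = \<bar>t - s\<bar>"
  have d: "d \<ge> 0" by (simp add: d_def)
  define e where "e = (\<lambda>b. if b = 0 then 5/8 else if b = 1 then 1/12 else 2/3 * (1 / (real (Suc b) * (real (Suc b) + 1))))"
  have h: "\<bar>h x - h y\<bar> \<le> L * \<bar>x - y\<bar>" if "x \<in> {0..1}" "y \<in> {0..1}" for x y
    using g that unfolding lip01_def h_def by simp
  have hb: "\<bar>h x\<bar> \<le> L / 2" if "x \<in> {0..1}" for x
  proof -
    have "\<bar>h x - h (1/2)\<bar> \<le> L * \<bar>x - 1/2\<bar>" using that by (intro h) auto
    also have "\<bar>x - 1/2\<bar> \<le> 1/2" using that by (auto simp: abs_if)
    then have "L * \<bar>x - 1/2\<bar> \<le> L * (1/2)" using L by (intro mult_left_mono)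
    finally show ?thesis by (simp add: h_def)
  qed
  have "lip01 L h" using g by (simp add: lip01_def h_def)
  note sl = slow_lip01[OF this]
  have op: "dop g u = dmean u (\<lambda>b. h (1 / (real b + u))) + g (1/2)" if "0 \<le> u" "u \<le> 1" for u
    unfolding dop_def h_def using that dmean_diff[OF that slow_lip01[OF g] slow_const] by (simp add: dmean_const)
  define T where "T = (\<lambda>b. dprob t (Suc b) * h (1 / (real (Suc b) + t)) - dprob s (Suc b) * h (1 / (real (Suc b) + s)))"
  have "dop g t - dop g s = suminf T"
    unfolding op[OF ts'(1,2)] op[OF ts'(3,4)] dmean_def T_def
    using summable_dprob_slow[OF ts'(1,2) sl[OF ts'(1)]] summable_dprob_slow[OF ts'(3,4) sl[OF ts'(3)]]
    by (subst suminf_diff[symmetric]) auto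
  also have "\<bar>\<dots>\<bar> \<le> suminf (\<lambda>b. L * d * e b)"
  proof -
    have es: "summable (\<lambda>b. L * d * e b)"
      using contraction_weights unfolding e_def by (intro summable_mult) (auto simp: sums_iff)
    have "norm (T b) \<le> L * d * e b" for b
    proof -
      define n where "n = real (Suc b)"
      have n: "n \<ge> 1" "Suc b \<ge> 1" by (auto simp: n_def)
      define w where "w = dprob t (Suc b)"
      define w' where "w' = dprob s (Suc b)"
      have xm: "1 / (n + t) \<in> {0..1}" "1 / (n + s) \<in> {0..1}" using ts' n by auto
      have "1 / (n + t) - 1 / (n + s) = (s - t) / ((n + t) * (n + s))"
        using ts' n by (simp add: divide_simps)
      then have "\<bar>1 / (n + t) - 1 / (n + s)\<bar> = d / ((n + t) * (n + s))"
        using ts' n by (simp add: d_def abs_mult abs_minus_commute)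
      also have "\<dots> \<le> d / (n * n)" using ts' n d by (intro divide_left_mono mult_mono) auto
      finally have "\<bar>h (1 / (n + t)) - h (1 / (n + s))\<bar> \<le> L * (d / (n * n))"
        using h[OF xm] L by (meson mult_left_mono order.trans)
      moreover have "0 \<le> w" "w \<le> 2 / (n + 1)\<^sup>2" unfolding w_def n_def using dprob_le[OF ts'(1,2) n(2)] dprob_nonneg ts' by auto
      ultimately have 1: "\<bar>w * (h (1 / (n + t)) - h (1 / (n + s)))\<bar> \<le> 2 / (n + 1)\<^sup>2 * (L * (d / (n * n)))"
        unfolding abs_mult by (intro mult_mono) auto
      have 2: "\<bar>(w - w') * h (1 / (n + s))\<bar> \<le> \<bar>w - w'\<bar> * (L / 2)"
        unfolding abs_mult using hb[OF xm(2)] by (intro mult_left_mono) auto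
      have "T b = w * (h (1 / (n + t)) - h (1 / (n + s))) + (w - w') * h (1 / (n + s))"
        by (simp add: T_def w_def w'_def n_def algebra_simps)
      then have 3: "\<bar>T b\<bar> \<le> 2 / (n + 1)\<^sup>2 * (L * (d / (n * n))) + \<bar>w - w'\<bar> * (L / 2)"
        using 1 2 abs_triangle_ineq[of "w * (h (1 / (n + t)) - h (1 / (n + s)))" "(w - w') * h (1 / (n + s))"]
        by linarith
      note gl = dprob_lipschitz[OF ts' n(2), folded w_def w'_def n_def d_def]
      have Ld: "0 \<le> L * d" using L d by simp
      consider "b = 0" | "b = 1" | "b \<ge> 2" by linarith
      then show ?thesis
      proof cases
        case 1
        then have "\<bar>w - w'\<bar> * (L / 2) \<le> d / 4 * (L / 2)" using gl(2) L by (intro mult_right_mono) auto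
        with 3 1 show ?thesis by (simp add: e_def n_def algebra_simps)
      next
        case 2
        then have "\<bar>w - w'\<bar> * (L / 2) \<le> d / 18 * (L / 2)" using gl(3) L by (intro mult_right_mono) auto
        with 3 2 show ?thesis by (simp add: e_def n_def algebra_simps)
      next
        case 3
        then have n3: "n \<ge> 3" by (simp add: n_def)
        have nn: "n * (n + 1) \<ge> 3 * 4" using n3 by (intro mult_mono) auto
        have "2 / (n + 1)\<^sup>2 * (L * (d / (n * n))) = L * d * (2 / (n * (n + 1)) * (1 / (n * (n + 1))))"
          by (simp add: power2_eq_square field_simps)
        also have "\<dots> \<le> L * d * (2 / (3 * 4) * (1 / (n * (n + 1))))"
          using Ld nn n3 by (intro mult_left_mono mult_right_mono divide_left_mono) auto
        finally have a: "2 / (n + 1)\<^sup>2 * (L * (d / (n * n))) \<le> L * d * (1 / 6 * (1 / (n * (n + 1))))" by simp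
        have "\<bar>w - w'\<bar> * (L / 2) \<le> d / (n * (n + 1)) * (L / 2)" using gl(1) L by (intro mult_right_mono) auto
        with \<open>\<bar>T b\<bar> \<le> _\<close> a have "\<bar>T b\<bar> \<le> L * d * (1 / 6 * (1 / (n * (n + 1)))) + d / (n * (n + 1)) * (L / 2)" by linarith
        also have "\<dots> = L * d * (2 / 3 * (1 / (n * (n + 1))))" by (simp add: add_divide_distrib[symmetric])
        also have "2 / 3 * (1 / (n * (n + 1))) = e b" using 3 unfolding e_def n_def by simp
        finally show ?thesis by simp
      qed
    qed
    then have "norm (suminf T) \<le> suminf (\<lambda>b. L * d * e b)"
      using es summable_comparison_test'[OF es, of 0 T] by (intro norm_suminf_le) auto
    then show ?thesis by simp
  qed
  also have "\<dots> = L * d * (5/8 + 1/12 + 2/9)"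
    using sums_mult[OF contraction_weights, of "L * d"] unfolding e_def by (simp add: sums_iff)
  \<comment> \<open>The sum is \<open>67/72\<close>. The slightly larger \<open>15/16\<close> makes
    the geometric series of the iterates sum to \<open>16\<close>.\<close>
  also have "\<dots> \<le> L * d * (15/16)" using L d by (intro mult_left_mono) auto
  finally show "\<bar>dop g t - dop g s\<bar> \<le> 15/16 * L * \<bar>t - s\<bar>" by (simp add: d_def mult_ac)
qed

lemma dop_bounds:
  assumes "lip01 L h" "\<And>t. t \<in> {0..1} \<Longrightarrow> l \<le> h t \<and> h t \<le> u" "t \<in> {0..1}"
  shows "l \<le> dop h t \<and> dop h t \<le> u"
proof -
  have t: "0 \<le> t" "t \<le> 1" using assms by auto
  have "dmean t (\<lambda>_. l) \<le> dop h t" unfolding dop_def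
    using assms(2) inv_mem01[OF t(1)] by (intro dmean_mono t slow_const slow_lip01[OF assms(1)]) auto
  moreover have "dop h t \<le> dmean t (\<lambda>_. u)" unfolding dop_def
    using assms(2) inv_mem01[OF t(1)] by (intro dmean_mono t slow_const slow_lip01[OF assms(1)]) auto
  ultimately show ?thesis using t by (simp add: dmean_const)
qed

text \<open>A Neumann series. The iterates \<open>H j\<close> of \<open>h\<close> under
  \<open>dop\<close> have Lipschitz constants \<open>(15/16)^j * L\<close>, so they flatten to a
  constant \<open>p\<close>, the stationary mean of \<open>h\<close>, and \<open>g\<close> is the
  sum of the deviations. The deviations are taken from the value at \<open>0\<close> instead of from
  \<open>p\<close>, so neither the invariant measure nor the existence of the limit is needed in
  advance.\<close>

lemma poisson_equation:
  assumes h: "lip01 L h" and lu: "\<And>t. t \<in> {0..1} \<Longrightarrow> l \<le> h t \<and> h t \<le> u"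
  obtains g p where "l \<le> p" "p \<le> u" "\<And>t. t \<in> {0..1} \<Longrightarrow> \<bar>g t\<bar> \<le> 16 * L"
    "\<And>t. t \<in> {0..1} \<Longrightarrow> g t = h t - p + dop g t"
proof -
  have L: "L \<ge> 0" by (rule lip01_nonneg[OF h])
  define H where "H = (\<lambda>j. (dop ^^ j) h)"
  have H0: "H 0 = h" and HS: "H (Suc j) = dop (H j)" for j by (simp_all add: H_def)
  have lipH: "lip01 ((15/16)^j * L) (H j)" for j
    by (induction j) (use h dop_contracts in \<open>auto simp: H0 HS mult.assoc\<close>)
  have Hlu: "l \<le> H j t \<and> H j t \<le> u" if "t \<in> {0..1}" for j t
    using that
  proof (induction j arbitrary: t)
    case 0
    then show ?case using lu by (simp add: H0)
  next
    case (Suc j)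
    then show ?case unfolding HS by (intro dop_bounds[OF lipH]) auto
  qed
  define D where "D = (\<lambda>j t. H j t - H j 0)"
  have Db: "\<bar>D j t\<bar> \<le> (15/16)^j * L" if "t \<in> {0..1}" for j t
    unfolding D_def using lip01_near[OF lipH, of 0 t] that by simp
  have geo: "summable (\<lambda>j. (15/16)^j * L :: real)" by (intro summable_mult2 summable_geometric) simp
  have ssum: "suminf (\<lambda>j. (15/16)^(j + J) * L :: real) = 16 * L * (15/16)^J" for J
  proof -
    have "(\<lambda>j. (15/16::real)^j) sums (1 / (1 - 15/16))" by (rule geometric_sums) simp
    then have "(\<lambda>j. (15/16)^j * (L * (15/16)^J)) sums (1 / (1 - 15/16) * (L * (15/16)^J))" by (rule sums_mult2)
    then show ?thesis by (simp add: sums_iff power_add mult_ac)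
  qed
  have Ds: "summable (\<lambda>j. D j t)" if "t \<in> {0..1}" for t
    by (rule summable_comparison_test'[OF geo, of 0]) (use Db that in auto)
  define g where "g = (\<lambda>t. \<Sum>j. D j t)"
  define G where "G = (\<lambda>J t. \<Sum>j<J. D j t)"
  have gG: "\<bar>g t - G J t\<bar> \<le> 16 * L * (15/16)^J" if "t \<in> {0..1}" for t J
  proof -
    have "g t - G J t = (\<Sum>j. D (j + J) t)"
      unfolding g_def G_def using suminf_split_initial_segment[OF Ds[OF that], of J] by simp
    also have "norm \<dots> \<le> suminf (\<lambda>j. (15/16)^(j + J) * L :: real)"
    proof (rule norm_suminf_le)
      show "norm (D (j + J) t) \<le> (15/16)^(j + J) * L" for j using Db[OF that] by simp
      show "summable (\<lambda>j. (15/16)^(j + J) * L :: real)" using geo by (subst summable_iff_shift)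
    qed
    finally show ?thesis by (simp add: ssum)
  qed
  have gb: "\<bar>g t\<bar> \<le> 16 * L" if "t \<in> {0..1}" for t
    using gG[OF that, of 0] by (simp add: G_def)
  have DS: "dop (D j) t = H (Suc j) t - H j 0" if "t \<in> {0..1}" for j t
    unfolding D_def dop_def HS using that dmean_diff[OF _ _ slow_lip01[OF lipH] slow_const]
    by (simp add: dmean_const)
  have lipD: "lip01 ((15/16)^j * L) (D j)" for j using lipH[of j] by (simp add: lip01_def D_def)
  have slG: "slow (\<lambda>b. G J (1 / (real b + t)))" if "0 \<le> t" for J t
    unfolding G_def
  proof (induction J)
    case (Suc J)
    then show ?case by (simp, intro slow_add slow_lip01[OF lipD] that)
  qed auto
  have opG: "dop (G J) t = (\<Sum>j<J. H (Suc j) t - H j 0)" if "t \<in> {0..1}" for J t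
  proof (induction J)
    case 0
    then show ?case using that dmean_const[of t 0] by (simp add: dop_def G_def)
  next
    case (Suc J)
    have "dop (G (Suc J)) t = dop (G J) t + dop (D J) t"
      unfolding dop_def using that slG[of t J] slow_lip01[OF lipD] dmean_add[of t, OF _ _ slG slow_lip01[OF lipD]]
      by (simp add: G_def)
    then show ?case using Suc DS[OF that] by simp
  qed
  have tele: "G J t - dop (G J) t = h t - H J t" if "t \<in> {0..1}" for J t
  proof -
    have "G J t = (\<Sum>j<J. H j t - H j 0)" by (simp add: G_def D_def)
    then have "G J t - dop (G J) t = (\<Sum>j<J. H j t - H (Suc j) t)"
      by (simp add: opG[OF that] sum_subtractf)
    also have "\<dots> = h t - H J t" by (subst sum_lessThan_telescope') (simp add: H0)
    finally show ?thesis .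
  qed
  have small: "(\<lambda>J. 16 * L * (15/16)^J) \<longlonglongrightarrow> 0"
    by (intro tendsto_mult_right_zero LIMSEQ_power_zero) simp
  have limG: "(\<lambda>J. G J t) \<longlonglongrightarrow> g t" if "t \<in> {0..1}" for t
  proof -
    have "(\<lambda>J. G J t - g t) \<longlonglongrightarrow> 0"
      by (rule Lim_null_comparison[OF _ small]) (use gG[OF that] in \<open>auto simp: abs_minus_commute\<close>)
    then show ?thesis by (simp add: LIM_zero_iff)
  qed
  have slg: "slow (\<lambda>b. g (1 / (real b + t)))" if "0 \<le> t" for t
    by (rule slow_bounded01[OF gb that])
  have limop: "(\<lambda>J. dop (G J) t) \<longlonglongrightarrow> dop g t" if t: "t \<in> {0..1}" for t
  proof -
    have "\<bar>dop (G J) t - dop g t\<bar> \<le> 16 * L * (15/16)^J" for J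
    proof -
      have t': "0 \<le> t" "t \<le> 1" using t by auto
      have sl: "slow (\<lambda>b. G J (1 / (real b + t)) - g (1 / (real b + t)))" by (intro slow_diff slG slg t')
      have eq: "dop (G J) t - dop g t = dmean t (\<lambda>b. G J (1 / (real b + t)) - g (1 / (real b + t)))"
        unfolding dop_def using dmean_diff[OF t' slG slg] t' by simp
      have b: "\<bar>G J (1 / (real b + t)) - g (1 / (real b + t))\<bar> \<le> 16 * L * (15/16)^J" if "b \<ge> 1" for b
        using gG[OF inv_mem01[OF t'(1) that]] by (simp add: abs_minus_commute)
      have "dmean t (\<lambda>b. G J (1 / (real b + t)) - g (1 / (real b + t))) \<le> dmean t (\<lambda>_. 16 * L * (15/16)^J)"
        using b by (intro dmean_mono t' sl slow_const) (simp add: abs_le_iff)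
      moreover have "dmean t (\<lambda>_. - (16 * L * (15/16)^J)) \<le> dmean t (\<lambda>b. G J (1 / (real b + t)) - g (1 / (real b + t)))"
        by (intro dmean_mono t' sl slow_const) (use b in \<open>fastforce simp: abs_le_iff\<close>)
      ultimately show ?thesis unfolding eq using t' by (simp add: dmean_const abs_le_iff)
    qed
    then have "(\<lambda>J. dop (G J) t - dop g t) \<longlonglongrightarrow> 0"
      by (intro Lim_null_comparison[OF _ small]) auto
    then show ?thesis by (simp add: LIM_zero_iff)
  qed
  \<comment> \<open>Convergence of \<open>H J t\<close> is read off from \<open>tele\<close>: both
    \<open>G J\<close> and \<open>dop (G J)\<close> converge. That the limit does not depend on
    \<open>t\<close> follows afterwards from the decay of the Lipschitz constants.\<close>
  have limH: "(\<lambda>J. H J t) \<longlonglongrightarrow> h t - (g t - dop g t)" if t: "t \<in> {0..1}" for t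
  proof -
    have "(\<lambda>J. h t - (G J t - dop (G J) t)) \<longlonglongrightarrow> h t - (g t - dop g t)"
      by (intro tendsto_intros limG limop t)
    then show ?thesis by (simp add: tele[OF t])
  qed
  define p where "p = h 0 - (g 0 - dop g 0)"
  have p: "h t - (g t - dop g t) = p" if t: "t \<in> {0..1}" for t
  proof -
    have "(\<lambda>j. (15/16)^j * L) \<longlonglongrightarrow> 0" by (intro tendsto_mult_left_zero LIMSEQ_power_zero) simp
    then have "(\<lambda>J. H J t - H J 0) \<longlonglongrightarrow> 0"
      by (rule Lim_null_comparison[rotated]) (use Db[OF t] in \<open>auto simp: D_def\<close>)
    moreover have "(\<lambda>J. H J t - H J 0) \<longlonglongrightarrow> (h t - (g t - dop g t)) - p"
      unfolding p_def by (intro tendsto_diff limH t) auto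
    ultimately show ?thesis using LIMSEQ_unique by fastforce
  qed
  show ?thesis
  proof (rule that)
    have lim: "(\<lambda>J. H J 0) \<longlonglongrightarrow> p" unfolding p_def using limH[of 0] by simp
    show "l \<le> p" by (rule LIMSEQ_le_const[OF lim]) (use Hlu[of 0] in auto)
    show "p \<le> u" by (rule LIMSEQ_le_const2[OF lim]) (use Hlu[of 0] in auto)
    show "\<bar>g t\<bar> \<le> 16 * L" if "t \<in> {0..1}" for t by (rule gb[OF that])
    show "g t = h t - p + dop g t" if "t \<in> {0..1}" for t using p[OF that] by simp
  qed
qed

section \<open>Dependence of the means on the state, and the martingale corrector\<close>

lemma dmean_lipschitz:
  assumes ts: "0 \<le> t" "t \<le> 1" "0 \<le> s" "s \<le> 1"
    and slow: "slow \<phi>" "slow \<psi>" "slow u" "slow w"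
    and u: "\<And>b. b \<ge> 1 \<Longrightarrow> \<bar>\<phi> b - \<psi> b\<bar> \<le> \<bar>t - s\<bar> * u b"
    and w: "\<And>b. b \<ge> 1 \<Longrightarrow> \<bar>\<psi> b\<bar> \<le> w b"
  shows "\<bar>dmean t \<phi> - dmean s \<psi>\<bar> \<le> \<bar>t - s\<bar> * (dmean t u + dmean 0 w)"
proof -
  define T where "T = (\<lambda>b. dprob t (Suc b) * \<phi> (Suc b) - dprob s (Suc b) * \<psi> (Suc b))"
  define E where "E = (\<lambda>b. \<bar>t - s\<bar> * (dprob t (Suc b) * u (Suc b) + dprob 0 (Suc b) * w (Suc b)))"
  have 0: "(0::real) \<le> 0" "(0::real) \<le> 1" by auto
  have Es: "summable E" unfolding E_def
    by (intro summable_mult summable_add summable_dprob_slow ts slow 0)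
  have bound: "norm (T b) \<le> E b" for b
  proof -
    have "\<bar>dprob t (Suc b) * (\<phi> (Suc b) - \<psi> (Suc b))\<bar> \<le> dprob t (Suc b) * (\<bar>t - s\<bar> * u (Suc b))"
      unfolding abs_mult using dprob_nonneg[OF ts(1)] u[of "Suc b"] by (intro mult_mono) auto
    \<comment> \<open>\<open>1 / (b * (b + 1))\<close> is \<open>dprob 0 b\<close>, so the variation
      of the weights is itself measured by the chain in the state \<open>0\<close>.\<close>
    moreover have "\<bar>(dprob t (Suc b) - dprob s (Suc b)) * \<psi> (Suc b)\<bar> \<le> (\<bar>t - s\<bar> * dprob 0 (Suc b)) * w (Suc b)"
      unfolding abs_mult using dprob_lipschitz(1)[OF ts, of "Suc b"] w[of "Suc b"]
      by (intro mult_mono) (auto simp: dprob_def)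
    moreover have "T b = dprob t (Suc b) * (\<phi> (Suc b) - \<psi> (Suc b)) + (dprob t (Suc b) - dprob s (Suc b)) * \<psi> (Suc b)"
      by (simp add: T_def algebra_simps)
    ultimately have "\<bar>T b\<bar> \<le> dprob t (Suc b) * (\<bar>t - s\<bar> * u (Suc b)) + (\<bar>t - s\<bar> * dprob 0 (Suc b)) * w (Suc b)"
      by linarith
    then show ?thesis by (simp add: E_def algebra_simps)
  qed
  have "dmean t \<phi> - dmean s \<psi> = suminf T"
    unfolding dmean_def T_def by (intro suminf_diff summable_dprob_slow ts slow)
  also have "norm (suminf T) \<le> suminf E" by (rule norm_suminf_le[OF bound Es])
  also have "suminf E = \<bar>t - s\<bar> * (dmean t u + dmean 0 w)"
    unfolding E_def dmean_def
    by (subst suminf_mult, intro summable_add summable_dprob_slow ts slow 0)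
       (subst suminf_add, auto intro!: summable_dprob_slow ts slow 0)
  finally show ?thesis by simp
qed

text \<open>The integrand does not depend on the state, so only the weights vary. The constant is of
  the same order as the bound for the mean itself; hence the corrector built from it is of the order
  of the sum of \<open>f b / b^2\<close>.\<close>

lemma lip01_dmean_finite:
  assumes "\<And>b. b \<ge> 1 \<Longrightarrow> f b \<ge> 0" "\<And>b. b > n \<Longrightarrow> f b = 0"
  shows "lip01 (2 * (\<Sum>b=1..n. f b / (real b)\<^sup>2)) (\<lambda>t. dmean t f)"
  unfolding lip01_def
proof (intro ballI)
  fix t s :: real assume ts: "t \<in> {0..1}" "s \<in> {0..1}"
  have sf: "slow f" using assms(2) by (rule slow_finite_support)
  have "\<bar>dmean t f - dmean s f\<bar> \<le> \<bar>t - s\<bar> * (dmean t (\<lambda>_. 0) + dmean 0 f)"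
    using ts assms(1) by (intro dmean_lipschitz sf slow_const) auto
  also have "\<dots> \<le> \<bar>t - s\<bar> * (0 + 2 * (\<Sum>b=1..n. f b / (real b)\<^sup>2))"
    using ts assms by (intro mult_left_mono add_mono dmean_finite_le) (auto simp: dmean_const)
  finally show "\<bar>dmean t f - dmean s f\<bar> \<le> 2 * (\<Sum>b=1..n. f b / (real b)\<^sup>2) * \<bar>t - s\<bar>"
    by (simp add: mult.commute)
qed

lemma abs_ln_diff_le: "\<bar>ln (real b + t) - ln (real b + s)\<bar> \<le> \<bar>t - s\<bar>"
  if "b \<ge> 1" "0 \<le> t" "0 \<le> s" for t s :: real
proof -
  have *: "ln (real b + t) - ln (real b + s) \<le> t - s" if "s \<le> t" "0 \<le> s" "b \<ge> 1" for t s
  proof -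
    have "ln (real b + t) - ln (real b + s) = ln ((real b + t) / (real b + s))"
      using that by (simp add: ln_div)
    also have "\<dots> \<le> (real b + t) / (real b + s) - 1" using that by (intro ln_le_minus_one) auto
    also have "\<dots> = (t - s) / (real b + s)" using that by (simp add: field_simps)
    also have "\<dots> \<le> (t - s) / 1" using that by (intro divide_left_mono) auto
    finally show ?thesis by simp
  qed
  have m: "ln (real b + s) \<le> ln (real b + t)" if "s \<le> t" "0 \<le> s" "b \<ge> 1" for t s :: real using that by simp
  show ?thesis using *[of s t] *[of t s] m[of s t] m[of t s] that by linarith
qed

lemma lip01_dmean_ln: "lip01 (1 + dmean 0 (\<lambda>b. ln (real b + 1))) (\<lambda>t. dmean t (\<lambda>b. ln (real b + t)))"
  unfolding lip01_def
proof (intro ballI)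
  fix t s :: real assume ts: "t \<in> {0..1}" "s \<in> {0..1}"
  have "\<bar>dmean t (\<lambda>b. ln (real b + t)) - dmean s (\<lambda>b. ln (real b + s))\<bar>
      \<le> \<bar>t - s\<bar> * (dmean t (\<lambda>_. 1) + dmean 0 (\<lambda>b. ln (real b + 1)))"
    using ts abs_ln_diff_le by (intro dmean_lipschitz slow_ln slow_const) auto
  then show "\<bar>dmean t (\<lambda>b. ln (real b + t)) - dmean s (\<lambda>b. ln (real b + s))\<bar>
      \<le> (1 + dmean 0 (\<lambda>b. ln (real b + 1))) * \<bar>t - s\<bar>"
    using ts by (simp add: dmean_const mult.commute)
qed

text \<open>The digit \<open>2\<close> alone suffices: its weight is at least \<open>1/12\<close>
  and its logarithm at least \<open>1/2\<close>. The digit \<open>1\<close> cannot serve, as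
  \<open>ln (1 + t)\<close> vanishes at \<open>t = 0\<close>. The bound passes to the mean growth
  \<open>pl\<close>, by which \<open>renewal_corrector\<close> divides.\<close>

lemma dmean_ln_ge: assumes "0 \<le> t" "t \<le> 1" shows "1/24 \<le> dmean t (\<lambda>b. ln (real b + t))"
proof -
  have sl: "slow (\<lambda>b. if b = 2 then 1/2 else 0)" by (rule slow_finite_support[of 2]) auto
  have ln2: "ln (2 + t) \<ge> 1/2" using assms ln2_ge_two_thirds ln_mono[of 2 "2 + t"] by linarith
  have "12 \<ge> (2 + t) * (3 + t)" using assms mult_mono[of "2 + t" 3 "3 + t" 4] by simp
  then have "1/12 \<le> dprob t 2" using assms unfolding dprob_def by (auto simp: frac_le)
  then have "1/24 \<le> dprob t 2 * (1/2)" by simp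
  also have "\<dots> = dmean t (\<lambda>b. if b = 2 then 1/2 else 0)"
  proof -
    have "dmean t (\<lambda>b. if b = 2 then 1/2 else 0) = (\<Sum>b=1..2. dprob t b * (if b = 2 then 1/2 else 0))"
      by (subst dmean_split[OF assms sl, of 2]) simp
    then show ?thesis by (simp add: numeral_2_eq_2)
  qed
  also have "\<dots> \<le> dmean t (\<lambda>b. ln (real b + t))"
    using assms ln2 by (intro dmean_mono sl slow_ln) auto
  finally show ?thesis .
qed

abbreviation (input) sqsum :: "(nat \<Rightarrow> real) \<Rightarrow> nat \<Rightarrow> real" where
  "sqsum f n \<equiv> (\<Sum>b=1..n. (f b)\<^sup>2 / (real b)\<^sup>2)"

text \<open>The corrector \<open>g\<close> turns \<open>f b - A * ln (b + t)\<close> into a martingale difference. Since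
  \<open>ln (b + t)\<close> is the increment of the logarithm of the denominator, this controls sums stopped by the
  size of the denominator rather than by the number of digits.\<close>

lemma renewal_corrector:
  "\<exists>c\<ge>0. \<forall>f n. (\<forall>b\<ge>1. f b \<ge> 0) \<longrightarrow> (\<forall>b>n. f b = 0) \<longrightarrow>
      (\<exists>A g. 0 \<le> A \<and> A \<le> c * (\<Sum>b=1..n. f b / (real b)\<^sup>2) \<and>
        (\<forall>t\<in>{0..1}. \<bar>g t\<bar> \<le> c * (\<Sum>b=1..n. f b / (real b)\<^sup>2)) \<and>
        (\<forall>t\<in>{0..1}. g t = dmean t (\<lambda>b. f b - A * ln (real b + t) + g (1 / (real b + t)))))"
proof -
  define \<Lambda> where "\<Lambda> = 1 + dmean 0 (\<lambda>b. ln (real b + 1))"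
  have \<Lambda>: "\<Lambda> \<ge> 0" using lip01_nonneg[OF lip01_dmean_ln] by (simp add: \<Lambda>_def)
  define hl where "hl = (\<lambda>t. dmean t (\<lambda>b. ln (real b + t)))"
  have lipl: "lip01 \<Lambda> hl" using lip01_dmean_ln by (simp add: \<Lambda>_def hl_def)
  have "1/24 \<le> hl t \<and> hl t \<le> hl 0 + \<Lambda>" if "t \<in> {0..1}" for t
    using dmean_ln_ge[of t] that lip01_near[OF lipl, of 0 t] by (auto simp: hl_def)
  from poisson_equation[OF lipl this] obtain gl pl where
    gl: "1/24 \<le> pl" "\<And>t. t \<in> {0..1} \<Longrightarrow> \<bar>gl t\<bar> \<le> 16 * \<Lambda>"
        "\<And>t. t \<in> {0..1} \<Longrightarrow> gl t = hl t - pl + dop gl t" by metis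
  define c where "c = 48 + 32 + 48 * (16 * \<Lambda>)"
  have claim: "\<exists>A g. 0 \<le> A \<and> A \<le> c * F \<and> (\<forall>t\<in>{0..1}. \<bar>g t\<bar> \<le> c * F) \<and>
        (\<forall>t\<in>{0..1}. g t = dmean t (\<lambda>b. f b - A * ln (real b + t) + g (1 / (real b + t))))"
    if f: "\<And>b. b \<ge> 1 \<Longrightarrow> f b \<ge> 0" "\<And>b. b > n \<Longrightarrow> f b = 0"
      and F: "F = (\<Sum>b=1..n. f b / (real b)\<^sup>2)" for f n F
  proof -
    have sf: "slow f" using f(2) by (rule slow_finite_support)
    have F0: "F \<ge> 0" unfolding F using f by (intro sum_nonneg) auto
    define hf where "hf = (\<lambda>t. dmean t f)"
    have lipf: "lip01 (2 * F) hf" unfolding F hf_def using f by (rule lip01_dmean_finite)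
    have "0 \<le> hf t \<and> hf t \<le> 2 * F" if "t \<in> {0..1}" for t
    proof -
      have t: "0 \<le> t" "t \<le> 1" using that by auto
      have "dmean t (\<lambda>_. 0) \<le> dmean t f" using f by (intro dmean_mono t slow_const sf) auto
      moreover have "dmean t f \<le> 2 * F" unfolding F using f by (intro dmean_finite_le t) auto
      ultimately show ?thesis using t by (simp add: dmean_const hf_def)
    qed
    from poisson_equation[OF lipf this] obtain gf pf where
      gf: "0 \<le> pf" "pf \<le> 2 * F" "\<And>t. t \<in> {0..1} \<Longrightarrow> \<bar>gf t\<bar> \<le> 16 * (2 * F)"
        "\<And>t. t \<in> {0..1} \<Longrightarrow> gf t = hf t - pf + dop gf t" by metis
    \<comment> \<open>\<open>pf\<close> and \<open>pl\<close> are the stationary means of the gain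
      and of the logarithmic growth per digit. With this quotient the constants of the two Poisson
      equations cancel in \<open>g\<close>. It is at most \<open>48 * F\<close>, because
      \<open>pf <= 2 * F\<close> and \<open>pl >= 1/24\<close>.\<close>
    define A where "A = pf / pl"
    define g where "g = (\<lambda>t. gf t - A * gl t)"
    have A0: "A \<ge> 0" using gf gl by (simp add: A_def)
    have "A \<le> 2 * F / (1/24)" unfolding A_def using gf gl F0 by (intro frac_le) auto
    then have A: "A \<le> 48 * F" by simp
    have cF: "48 * F \<le> c * F" "32 * F + 48 * F * (16 * \<Lambda>) \<le> c * F"
      using F0 \<Lambda> by (simp_all add: c_def algebra_simps)
    have gb: "\<bar>g t\<bar> \<le> c * F" if t: "t \<in> {0..1}" for t
    proof -
      have "\<bar>A * gl t\<bar> \<le> 48 * F * (16 * \<Lambda>)" unfolding abs_mult using A A0 gl(2)[OF t] F0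
        by (intro mult_mono) auto
      with gf(3)[OF t] cF show ?thesis unfolding g_def by linarith
    qed
    have eq: "g t = dmean t (\<lambda>b. f b - A * ln (real b + t) + g (1 / (real b + t)))" if t: "t \<in> {0..1}" for t
    proof -
      have t': "0 \<le> t" "t \<le> 1" using t by auto
      have s1: "slow (\<lambda>b. gf (1 / (real b + t)))" by (rule slow_bounded01[OF gf(3) t'(1)])
      have s2: "slow (\<lambda>b. gl (1 / (real b + t)))" by (rule slow_bounded01[OF gl(2) t'(1)])
      have s3: "slow (\<lambda>b. ln (real b + t))" by (rule slow_ln[OF t'])
      have "dmean t (\<lambda>b. f b - A * ln (real b + t) + g (1 / (real b + t)))
        = dmean t (\<lambda>b. f b - A * ln (real b + t)) + dmean t (\<lambda>b. g (1 / (real b + t)))"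
        unfolding g_def by (intro dmean_add t' slow_diff slow_cmult sf s1 s2 s3)
      also have "dmean t (\<lambda>b. f b - A * ln (real b + t)) = hf t - A * hl t"
        unfolding hf_def hl_def using t' by (simp add: dmean_diff dmean_cmult slow_cmult sf s3)
      also have "dmean t (\<lambda>b. g (1 / (real b + t))) = dop gf t - A * dop gl t"
        unfolding g_def dop_def using t' by (simp add: dmean_diff dmean_cmult slow_cmult s1 s2)
      also have "hf t - A * hl t + (dop gf t - A * dop gl t) = g t"
      proof -
        have "A * pl = pf" using gl(1) by (simp add: A_def)
        then show ?thesis unfolding g_def using gf(4)[OF t] arg_cong[OF gl(3)[OF t], of "\<lambda>x. A * x"]
            by (simp add: algebra_simps)
      qed
      finally show ?thesis by simp
    qed
    show ?thesis using A0 A cF(1) gb eq by (intro exI[of _ A] exI[of _ g]) auto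
  qed
  have c0: "c \<ge> 0" using \<Lambda> by (simp add: c_def)
  show ?thesis
    by (rule exI[of _ c], intro conjI allI impI c0, rule claim[OF _ _ refl]) simp_all
qed

lemma dmean_ln_sq_le: assumes "0 \<le> t" "t \<le> 1"
  shows "dmean t (\<lambda>b. (ln (real b + 1))\<^sup>2) \<le> 2 * dmean 0 (\<lambda>b. (ln (real b + 1))\<^sup>2)"
proof -
  have 0: "(0::real) \<le> 0" "(0::real) \<le> 1" by auto
  have w: "dprob t (Suc b) \<le> 2 * dprob 0 (Suc b)" for b
  proof -
    have "dprob t (Suc b) \<le> 2 / (real (Suc b) + 1)\<^sup>2" using assms by (intro dprob_le) auto
    also have "\<dots> \<le> 2 / (real (Suc b) * (real (Suc b) + 1))"
      unfolding power2_eq_square by (intro divide_left_mono mult_mono) auto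
    finally show ?thesis by (simp add: dprob_def)
  qed
  have "dprob t (Suc b) * (ln (real (Suc b) + 1))\<^sup>2 \<le> 2 * (dprob 0 (Suc b) * (ln (real (Suc b) + 1))\<^sup>2)" for b
    using mult_right_mono[OF w, of "(ln (real (Suc b) + 1))\<^sup>2"] by (simp add: mult.assoc)
  then show ?thesis unfolding dmean_def
    by (subst suminf_mult[symmetric]) (intro suminf_le summable_mult summable_dprob_slow 0 assms slow_ln_sq; assumption?)+
qed

lemma sum_inverse_squares_le: "(\<Sum>b=1..n. 1 / (real b)\<^sup>2) \<le> 2"
proof -
  have "(\<Sum>b=1..n. 1 / (real b)\<^sup>2) \<le> 2 - 1 / real n" if "n \<ge> 1" for n
    using that
  proof (induction n rule: dec_induct)
    case (step n)
    have "1 / (real (Suc n))\<^sup>2 \<le> 1 / (real n * real (Suc n))"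
      unfolding power2_eq_square using step by (intro divide_left_mono mult_mono) auto
    also have "\<dots> = 1 / real n - 1 / real (Suc n)" using step by (simp add: field_simps)
    finally show ?case using step by simp
  qed simp
  from this[of n] show ?thesis by (cases "n = 0") (auto intro: order.trans)
qed

lemma sum_three_squared_le: "(x + y + z)\<^sup>2 \<le> 3 * x\<^sup>2 + 3 * y\<^sup>2 + 3 * z\<^sup>2" for x y z :: real
proof -
  have "3 * x\<^sup>2 + 3 * y\<^sup>2 + 3 * z\<^sup>2 - (x + y + z)\<^sup>2 = (x - y)\<^sup>2 + (y - z)\<^sup>2 + (x - z)\<^sup>2"
    by (simp add: power2_eq_square algebra_simps)
  also have "\<dots> \<ge> 0" by simp
  finally show ?thesis by simp
qed

text \<open>One digit of the stopped process. \<open>\<sigma>\<close> is the sum so far plus the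
  predicted rest; digits up to \<open>b0\<close> continue, larger ones stop; \<open>r\<close> is the
  logarithmic room left, so \<open>\<sigma> - A * r\<close> is the sum at the stop. The factor
  \<open>2\<close> pays for the overshoot: at a stop the square is compared with twice the square
  after a fictitious further digit. The continuing terms carry the same factor on both sides, so it
  does not accumulate along the tree.\<close>

lemma one_step_inequality:
  "\<exists>c\<ge>0. \<forall>f n. (\<forall>b\<ge>1. f b \<ge> 0) \<longrightarrow> (\<forall>b>n. f b = 0) \<longrightarrow>
      (\<exists>A g. (\<forall>t\<in>{0..1}. (g t)\<^sup>2 \<le> c * sqsum f n) \<and>
        (\<forall>t\<in>{0..1}. \<forall>\<sigma> b0 r. 0 \<le> r \<longrightarrow> r \<le> ln (real b0 + 1 + t) \<longrightarrow>
           (\<Sum>b=1..b0. dprob t b * (2 * (\<sigma> + (f b - A * ln (real b + t)) + g (1 / (real b + t)))\<^sup>2))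
             + (1 + t) / (real b0 + 1 + t) * (\<sigma> - A * r)\<^sup>2
           \<le> 2 * (\<sigma> + g t)\<^sup>2 + c * sqsum f n))"
proof -
  obtain c where c: "c \<ge> 0" and
    R: "\<forall>f n. (\<forall>b\<ge>1. f b \<ge> 0) \<longrightarrow> (\<forall>b>n. f b = 0) \<longrightarrow>
      (\<exists>A g. 0 \<le> A \<and> A \<le> c * (\<Sum>b=1..n. f b / (real b)\<^sup>2) \<and>
        (\<forall>t\<in>{0..1}. \<bar>g t\<bar> \<le> c * (\<Sum>b=1..n. f b / (real b)\<^sup>2)) \<and>
        (\<forall>t\<in>{0..1}. g t = dmean t (\<lambda>b. f b - A * ln (real b + t) + g (1 / (real b + t)))))"
    using renewal_corrector by blast
  define \<kappa> where "\<kappa> = 2 * dmean 0 (\<lambda>b. (ln (real b + 1))\<^sup>2)"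
  have \<kappa>: "dmean t (\<lambda>b. (ln (real b + 1))\<^sup>2) \<le> \<kappa>" if "0 \<le> t" "t \<le> 1" for t
    using dmean_ln_sq_le[OF that] by (simp add: \<kappa>_def)
  have "\<kappa> \<ge> 0"
  proof -
    have "dmean 0 (\<lambda>_. 0) \<le> dmean 0 (\<lambda>b. (ln (real b + 1))\<^sup>2)" by (intro dmean_mono slow_ln_sq slow_const) auto
    then show ?thesis by (simp add: \<kappa>_def dmean_const)
  qed
  \<comment> \<open>\<open>M * F2\<close> bounds the mean of \<open>Z\<close> term by term. In
    \<open>c'\<close> the summand \<open>2 * c^2\<close> serves the bound for the square of
    \<open>g\<close>, and \<open>4 * M\<close> comes from the means of \<open>X^2\<close> and of
    \<open>Z\<close>, each taken twice.\<close>
  define M where "M = 3 * 2 + 12 * (2 * c\<^sup>2) * \<kappa> + 3 * (2 * c\<^sup>2)"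
  define c' where "c' = 2 * c\<^sup>2 + 4 * M"
  have "M \<ge> 0" using \<open>\<kappa> \<ge> 0\<close> by (simp add: M_def)
  then have c': "c' \<ge> 0" by (simp add: c'_def)
  have claim: "\<exists>A g. (\<forall>t\<in>{0..1}. (g t)\<^sup>2 \<le> c' * F2) \<and>
        (\<forall>t\<in>{0..1}. \<forall>\<sigma> b0 r. 0 \<le> r \<longrightarrow> r \<le> ln (real b0 + 1 + t) \<longrightarrow>
           (\<Sum>b=1..b0. dprob t b * (2 * (\<sigma> + (f b - A * ln (real b + t)) + g (1 / (real b + t)))\<^sup>2))
             + (1 + t) / (real b0 + 1 + t) * (\<sigma> - A * r)\<^sup>2
           \<le> 2 * (\<sigma> + g t)\<^sup>2 + c' * F2)"
    if f: "\<And>b. b \<ge> 1 \<Longrightarrow> f b \<ge> 0" "\<And>b. b > n \<Longrightarrow> f b = 0"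
      and F2: "F2 = sqsum f n" for f n F2
  proof -
    define F where "F = (\<Sum>b=1..n. f b / (real b)\<^sup>2)"
    have F0: "F \<ge> 0" unfolding F_def using f by (intro sum_nonneg) auto
    have F20: "F2 \<ge> 0" unfolding F2 by (intro sum_nonneg) auto
    \<comment> \<open>Cauchy-Schwarz against \<open>1 / b\<close>, whose squares sum to at most
      \<open>2\<close>. It allows the squares of \<open>A\<close> and of the corrector, both of
      first order in \<open>f\<close>, to be measured by \<open>F2\<close>.\<close>
    have FF: "F\<^sup>2 \<le> 2 * F2"
    proof -
      have "F = (\<Sum>b=1..n. (f b / real b) * (1 / real b))" by (simp add: F_def power2_eq_square)
      then have "F\<^sup>2 \<le> (\<Sum>b=1..n. (f b / real b)\<^sup>2) * (\<Sum>b=1..n. (1 / real b)\<^sup>2)"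
        using Cauchy_Schwarz_ineq_sum[of "\<lambda>b. f b / real b" "\<lambda>b. 1 / real b" "{1..n}"] by simp
      also have "\<dots> = F2 * (\<Sum>b=1..n. 1 / (real b)\<^sup>2)" by (simp add: F2 power_divide)
      also have "\<dots> \<le> F2 * 2" using sum_inverse_squares_le[of n] F20 by (intro mult_left_mono) auto
      finally show ?thesis by simp
    qed
    have f': "\<forall>b\<ge>1. f b \<ge> 0" "\<forall>b>n. f b = 0" using f by auto
    have "\<exists>A g. 0 \<le> A \<and> A \<le> c * F \<and> (\<forall>t\<in>{0..1}. \<bar>g t\<bar> \<le> c * F) \<and>
        (\<forall>t\<in>{0..1}. g t = dmean t (\<lambda>b. f b - A * ln (real b + t) + g (1 / (real b + t))))"
      unfolding F_def by (rule R[THEN spec[of _ f], THEN spec[of _ n], THEN mp, THEN mp, OF f'])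
    then obtain A g where A: "0 \<le> A" "A \<le> c * F" and gb: "\<And>t. t \<in> {0..1} \<Longrightarrow> \<bar>g t\<bar> \<le> c * F"
      and geq: "\<And>t. t \<in> {0..1} \<Longrightarrow> g t = dmean t (\<lambda>b. f b - A * ln (real b + t) + g (1 / (real b + t)))"
      by blast
    have cF: "(c * F)\<^sup>2 \<le> 2 * c\<^sup>2 * F2"
      using mult_left_mono[OF FF, of "c\<^sup>2"] by (simp add: power_mult_distrib mult_ac)
    have A2: "A\<^sup>2 \<le> 2 * c\<^sup>2 * F2" using power_mono[OF A(2,1), of 2] cF by simp
    have gt: "(g t)\<^sup>2 \<le> c' * F2" if "t \<in> {0..1}" for t
    proof -
      have "(g t)\<^sup>2 \<le> (c * F)\<^sup>2" using gb[OF that] by (simp add: abs_le_square_iff[symmetric])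
      also note cF
      also have "2 * c\<^sup>2 * F2 \<le> c' * F2" using F20 \<open>M \<ge> 0\<close> by (intro mult_right_mono) (auto simp: c'_def)
      finally show ?thesis .
    qed
    have step: "(\<Sum>b=1..b0. dprob t b * (2 * (\<sigma> + (f b - A * ln (real b + t)) + g (1 / (real b + t)))\<^sup>2))
             + (1 + t) / (real b0 + 1 + t) * (\<sigma> - A * r)\<^sup>2 \<le> 2 * (\<sigma> + g t)\<^sup>2 + c' * F2"
      if t01: "t \<in> {0..1}" and r: "0 \<le> r" "r \<le> ln (real b0 + 1 + t)" for t \<sigma> b0 r
    proof -
      have t: "0 \<le> t" "t \<le> 1" using t01 by auto
      define X where "X = (\<lambda>b. f b - A * ln (real b + t) + g (1 / (real b + t)))"
      \<comment> \<open>\<open>12\<close> is \<open>3 * 2^2\<close>: at a stop the logarithm enters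
        twice, once in \<open>X b\<close> and once through \<open>A * r\<close>.\<close>
      define Z where "Z = (\<lambda>b. 3 * (f b)\<^sup>2 + 12 * A\<^sup>2 * (ln (real b + 1))\<^sup>2 + 3 * (c * F)\<^sup>2)"
      have sf: "slow f" and sf2: "slow (\<lambda>b. (f b)\<^sup>2)" 
        using slow_finite_support[of n f] slow_finite_support[of n "\<lambda>b. (f b)\<^sup>2"] f(2) by simp_all
      have sZ: "slow Z" unfolding Z_def by (intro slow_add slow_cmult sf2 slow_ln_sq slow_const)
      have sg: "slow (\<lambda>b. g (1 / (real b + t)))" by (rule slow_bounded01[OF gb t(1)])
      have sl: "slow (\<lambda>b. ln (real b + t))" by (rule slow_ln[OF t])
      have sX: "slow X" unfolding X_def
        by (rule slow_add[OF slow_diff[OF sf slow_cmult[OF sl]] sg])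
      have YZ: "(\<bar>f b\<bar> + 2 * A * ln (real b + 1) + c * F)\<^sup>2 \<le> Z b" for b
        using sum_three_squared_le[of "\<bar>f b\<bar>" "2 * A * ln (real b + 1)" "c * F"] by (simp add: Z_def power_mult_distrib)
      have X: "\<bar>X b\<bar> \<le> \<bar>f b\<bar> + A * ln (real b + 1) + c * F" "A * ln (real b + t) \<ge> 0"
        "A * ln (real b + t) \<le> A * ln (real b + 1)" if "b \<ge> 1" for b
      proof -
        show 1: "A * ln (real b + t) \<ge> 0" using A t that by auto
        show 2: "A * ln (real b + t) \<le> A * ln (real b + 1)" using A t that by (intro mult_left_mono) auto
        show "\<bar>X b\<bar> \<le> \<bar>f b\<bar> + A * ln (real b + 1) + c * F"
          using gb[OF inv_mem01[OF t(1) that]] 1 2 unfolding X_def by linarith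
      qed
      have X2: "(X b)\<^sup>2 \<le> Z b" if "b \<ge> 1" for b
      proof -
        have "\<bar>X b\<bar> \<le> \<bar>f b\<bar> + 2 * A * ln (real b + 1) + c * F"
          using X[OF that] by linarith
        then have "(X b)\<^sup>2 \<le> (\<bar>f b\<bar> + 2 * A * ln (real b + 1) + c * F)\<^sup>2"
          by (subst abs_le_square_iff[symmetric]) linarith
        with YZ[of b] show ?thesis by linarith
      qed
      have sX2: "slow (\<lambda>b. (X b)\<^sup>2)"
      proof (rule slow_le[OF sZ])
        fix b :: nat assume "b \<ge> 1"
        from X2[OF this] show "\<bar>(X b)\<^sup>2\<bar> \<le> \<bar>Z b\<bar>" by simp
      qed
      have sS: "slow (\<lambda>b. (\<sigma> + X b)\<^sup>2)"
      proof -
        have "slow (\<lambda>b. \<sigma>\<^sup>2 + 2 * \<sigma> * X b + (X b)\<^sup>2)" by (intro slow_add slow_cmult slow_const sX sX2)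
        then show ?thesis by (simp add: power2_sum algebra_simps)
      qed
      \<comment> \<open>A digit beyond \<open>b0\<close> satisfies \<open>r <= ln (b + t)\<close>.
        Therefore the overshoot \<open>X b + A * r\<close> is no larger than the bound for an
        ordinary step, and the sum at the stop differs from the continued one only by this
        overshoot.\<close>
      have late: "(\<sigma> - A * r)\<^sup>2 \<le> 2 * (\<sigma> + X b)\<^sup>2 + 2 * Z b" if "b > b0" for b
      proof -
        have b: "b \<ge> 1" using that by simp
        have "r \<le> ln (real b + t)" 
          by (rule order.trans[OF r(2)]) (use t that in auto)
        then have "A * r \<le> A * ln (real b + t)" "0 \<le> A * r" using A r by (auto intro: mult_left_mono)
        then have "\<bar>X b + A * r\<bar> \<le> \<bar>f b\<bar> + 2 * A * ln (real b + 1) + c * F"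
          using X[OF b] by linarith
        then have "(X b + A * r)\<^sup>2 \<le> (\<bar>f b\<bar> + 2 * A * ln (real b + 1) + c * F)\<^sup>2"
          by (subst abs_le_square_iff[symmetric]) linarith
        with YZ[of b] have "(X b + A * r)\<^sup>2 \<le> Z b" by linarith
        moreover have "(\<sigma> - A * r)\<^sup>2 \<le> 2 * (\<sigma> + X b)\<^sup>2 + 2 * (X b + A * r)\<^sup>2"
          using zero_le_power2[of "(\<sigma> + X b) + (X b + A * r)"] by (simp add: power2_eq_square algebra_simps)
        ultimately show ?thesis by linarith
      qed
      have Z0: "Z b \<ge> 0" for b by (simp add: Z_def)
      define U where "U = (\<lambda>b. 2 * (\<sigma> + X b)\<^sup>2 + 2 * Z b)"
      have sU: "slow U" unfolding U_def by (intro slow_add slow_cmult sS sZ)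
      have main: "(\<Sum>b=1..b0. dprob t b * (2 * (\<sigma> + X b)\<^sup>2)) + (1 + t) / (real b0 + 1 + t) * (\<sigma> - A * r)\<^sup>2 \<le> dmean t U"
        unfolding dmean_split[OF t sU, of b0]
      proof (rule add_mono)
        show "(\<Sum>b=1..b0. dprob t b * (2 * (\<sigma> + X b)\<^sup>2)) \<le> (\<Sum>b=1..b0. dprob t b * U b)"
          using Z0 by (intro sum_mono mult_left_mono dprob_nonneg t) (auto simp: U_def)
        have s1: "(\<lambda>i. dprob t (Suc (b0 + i)) * (\<sigma> - A * r)\<^sup>2) sums ((1 + t) / (real b0 + 1 + t) * (\<sigma> - A * r)\<^sup>2)"
          by (intro sums_mult2 dprob_sums t)
        have s2: "summable (\<lambda>i. dprob t (Suc (b0 + i)) * U (Suc (b0 + i)))"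
          using summable_ignore_initial_segment[OF summable_dprob_slow[OF t sU], of b0] by (simp add: add.commute)
        show "(1 + t) / (real b0 + 1 + t) * (\<sigma> - A * r)\<^sup>2 \<le> (\<Sum>i. dprob t (Suc (b0 + i)) * U (Suc (b0 + i)))"
          using late by (intro sums_le[OF _ s1 summable_sums[OF s2]] mult_left_mono dprob_nonneg t) (auto simp: U_def)
      qed
      have U: "dmean t U = 2 * dmean t (\<lambda>b. (\<sigma> + X b)\<^sup>2) + 2 * dmean t Z"
        unfolding U_def by (simp only: dmean_add[OF t slow_cmult[OF sS] slow_cmult[OF sZ]] dmean_cmult[OF t sS] dmean_cmult[OF t sZ])
      \<comment> \<open>The martingale property: the mean of \<open>X\<close> is \<open>g t\<close>,
        so the term linear in \<open>\<sigma>\<close> agrees with that of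
        \<open>(\<sigma> + g t)^2\<close>, and the remainder is independent of
        \<open>\<sigma>\<close>.\<close>
      have sq: "dmean t (\<lambda>b. (\<sigma> + X b)\<^sup>2) = \<sigma>\<^sup>2 + 2 * \<sigma> * g t + dmean t (\<lambda>b. (X b)\<^sup>2)"
      proof -
        have "dmean t (\<lambda>b. (\<sigma> + X b)\<^sup>2) = dmean t (\<lambda>b. \<sigma>\<^sup>2 + 2 * \<sigma> * X b + (X b)\<^sup>2)"
          by (simp add: power2_sum algebra_simps)
        also have "\<dots> = \<sigma>\<^sup>2 + 2 * \<sigma> * dmean t X + dmean t (\<lambda>b. (X b)\<^sup>2)"
          by (simp only: dmean_add[OF t slow_add[OF slow_const slow_cmult[OF sX]] sX2]
              dmean_add[OF t slow_const slow_cmult[OF sX]] dmean_cmult[OF t sX] dmean_const[OF t(1)])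
        also have "dmean t X = g t" using geq[OF t01] by (simp add: X_def)
        finally show ?thesis .
      qed
      have XZ: "dmean t (\<lambda>b. (X b)\<^sup>2) \<le> dmean t Z" by (intro dmean_mono t sX2 sZ X2)
      have sg2: "(\<sigma> + g t)\<^sup>2 = \<sigma>\<^sup>2 + 2 * \<sigma> * g t + (g t)\<^sup>2" by (simp add: power2_sum)
      have Zb: "dmean t Z \<le> M * F2"
      proof -
        have "dmean t Z = 3 * dmean t (\<lambda>b. (f b)\<^sup>2) + 12 * A\<^sup>2 * dmean t (\<lambda>b. (ln (real b + 1))\<^sup>2) + 3 * (c * F)\<^sup>2"
        proof -
          note s1 = slow_cmult[OF sf2, of 3] and s2 = slow_cmult[OF slow_ln_sq, of "12 * A\<^sup>2"]
          show ?thesis unfolding Z_def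
            by (simp only: dmean_add[OF t slow_add[OF s1 s2] slow_const] dmean_add[OF t s1 s2]
                dmean_cmult[OF t sf2] dmean_cmult[OF t slow_ln_sq] dmean_const[OF t(1)])
        qed
        also have "\<dots> \<le> 3 * (2 * F2) + 12 * (2 * c\<^sup>2 * F2) * \<kappa> + 3 * (2 * c\<^sup>2 * F2)"
        proof (intro add_mono mult_left_mono mult_mono A2 cF \<kappa> t)
          show "dmean t (\<lambda>b. (f b)\<^sup>2) \<le> 2 * F2" unfolding F2 using f by (intro dmean_finite_le t) auto
          have "dmean t (\<lambda>_. 0) \<le> dmean t (\<lambda>b. (ln (real b + 1))\<^sup>2)" by (intro dmean_mono slow_ln_sq slow_const t) auto
          then show "0 \<le> dmean t (\<lambda>b. (ln (real b + 1))\<^sup>2)" using t by (simp add: dmean_const)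
        qed (use F20 in auto)
        finally show ?thesis by (simp add: M_def algebra_simps)
      qed
      have "(\<Sum>b=1..b0. dprob t b * (2 * (\<sigma> + X b)\<^sup>2)) + (1 + t) / (real b0 + 1 + t) * (\<sigma> - A * r)\<^sup>2
        \<le> 2 * (\<sigma> + g t)\<^sup>2 + 4 * (M * F2)"
      proof -
        have arith: "m \<le> 2 * (s1 + s2 + g2) + 4 * w"
          if "m \<le> 2 * (s1 + s2 + x) + 2 * z" "x \<le> z" "z \<le> w" "0 \<le> g2" for m s1 s2 x z w g2 :: real
          using that by argo
        show ?thesis unfolding sg2 by (rule arith[OF main[unfolded U sq] XZ Zb zero_le_power2])
      qed
      moreover have "4 * (M * F2) \<le> c' * F2"
        using F20 unfolding c'_def by (simp add: distrib_right)
      ultimately have "(\<Sum>b=1..b0. dprob t b * (2 * (\<sigma> + X b)\<^sup>2)) + (1 + t) / (real b0 + 1 + t) * (\<sigma> - A * r)\<^sup>2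
        \<le> 2 * (\<sigma> + g t)\<^sup>2 + c' * F2" by argo
      moreover have "\<sigma> + (f b - A * ln (real b + t)) + g (1 / (real b + t)) = \<sigma> + X b" for b
        by (simp add: X_def)
      ultimately show ?thesis by (simp only:)
    qed
    show ?thesis
    proof (rule exI[of _ A], rule exI[of _ g], intro conjI ballI allI impI)
      fix t :: real assume t: "t \<in> {0..1}"
      show "(g t)\<^sup>2 \<le> c' * F2" by (rule gt[OF t])
      fix \<sigma> r :: real and b0 :: nat assume r: "0 \<le> r" "r \<le> ln (real b0 + 1 + t)"
      show "(\<Sum>b=1..b0. dprob t b * (2 * (\<sigma> + (f b - A * ln (real b + t)) + g (1 / (real b + t)))\<^sup>2))
             + (1 + t) / (real b0 + 1 + t) * (\<sigma> - A * r)\<^sup>2 \<le> 2 * (\<sigma> + g t)\<^sup>2 + c' * F2"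
        by (rule step[OF t r])
    qed
  qed
  show ?thesis
    by (rule exI[of _ c'], intro conjI allI impI c', rule claim[OF _ _ refl]) simp_all
qed

section \<open>Words and their denominators\<close>

text \<open>\<open>cf_pair (rev v)\<close> consists of the last two convergent denominators of \<open>v\<close>.\<close>

fun cf_pair :: "nat list \<Rightarrow> nat \<times> nat" where
  "cf_pair [] = (1, 0)"
| "cf_pair (a # u) = (a * fst (cf_pair u) + snd (cf_pair u), fst (cf_pair u))"

abbreviation den :: "nat list \<Rightarrow> nat" where "den w \<equiv> fst (cf_pair w)"
abbreviation num :: "nat list \<Rightarrow> nat" where "num w \<equiv> snd (cf_pair w)"

definition valid :: "nat list \<Rightarrow> bool" where "valid w \<longleftrightarrow> (\<forall>b\<in>set w. b \<ge> 1)"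

lemma valid_simps [simp]: "valid []" "valid (a # u) \<longleftrightarrow> a \<ge> 1 \<and> valid u"
  "valid (u @ v) \<longleftrightarrow> valid u \<and> valid v" "valid (rev u) \<longleftrightarrow> valid u"
  by (auto simp: valid_def)

lemma valid_take: "valid w \<Longrightarrow> valid (take k w)" and valid_drop: "valid w \<Longrightarrow> valid (drop k w)"
  by (auto simp: valid_def dest: in_set_takeD in_set_dropD)

text \<open>Euler's identity for continuants: for nonempty words, \<open>num (rev v)\<close> is the
  continuant of \<open>v\<close> without its last digit and \<open>num u\<close> that of
  \<open>u\<close> without its first. The induction moves the last digit of \<open>v\<close> to the
  front of \<open>u\<close>.\<close>

lemma den_append: "den (v @ u) = den (rev v) * den u + num (rev v) * num u"
proof (induction v arbitrary: u rule: rev_induct)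
  case (snoc b v)
  show ?case using snoc[of "b # u"] by (simp add: algebra_simps)
qed simp

lemma den_rev: "den (rev w) = den w"
  using den_append[of w "[]"] by simp

lemma den_pos: "valid w \<Longrightarrow> den w \<ge> 1"
  by (induction w) (auto simp: Suc_le_eq)

lemma num_le_den: "valid w \<Longrightarrow> num w \<le> den w"
  by (cases w) (auto intro: trans_le_add1)

lemma num_pos: "valid w \<Longrightarrow> w \<noteq> [] \<Longrightarrow> num w \<ge> 1"
  using den_pos by (cases w) auto

lemma coprime_cf_pair: "coprime (den w) (num w)"
proof (induction w)
  case (Cons a u)
  have "gcd (a * den u + num u) (den u) = gcd (num u) (den u)"
    by (metis add.commute gcd_add_mult gcd.commute)
  with Cons show ?case by (simp add: coprime_iff_gcd_eq_1 gcd.commute)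
qed simp

lemma cf_value_cf_pair: "valid w \<Longrightarrow> cf_value w = real (num w) / real (den w)"
proof (induction w)
  case (Cons a u)
  then have "real (den u) > 0" using den_pos[of u] by simp
  moreover from this have "real a + real (num u) / real (den u) = real (a * den u + num u) / real (den u)"
    by (simp add: field_simps)
  ultimately show ?case using Cons by simp
qed simp

text \<open>A rational has just two expansions, one ending in \<open>a\<close> and one in
  \<open>a - 1, 1\<close>, and their lengths differ by one. In the induction, unequal first digits
  force the tails \<open>[1]\<close> and \<open>[]\<close>, which the parity excludes.\<close>

lemma cf_pair_inj_parity:
  assumes "valid u" "valid v" "cf_pair u = cf_pair v" "even (length u) = even (length v)"
  shows "u = v"
  using assms
proof (induction u arbitrary: v)
  case Nil
  then show ?case using num_pos[of v] by (cases v) auto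
next
  case (Cons a u)
  have "v \<noteq> []" using Cons.prems num_pos[of "a # u"] by fastforce
  then obtain b v' where v: "v = b # v'" by (cases v) auto
  have z: "den u = den v'" and e: "a * den u + num u = b * den u + num v'"
    using Cons.prems by (auto simp: v)
  have val: "valid u" "valid v'" using Cons.prems by (auto simp: v)
  have par: "even (length u) = even (length v')" using Cons.prems by (simp add: v)
  have key: False
    if "a' < b'" "a' * den s + num s = b' * den s + num s'" "den s = den s'" "valid s" "valid s'"
       "even (length s) = even (length s')" for a' b' s s'
  proof -
    have "b' * den s \<ge> (a' + 1) * den s" using that(1) by (intro mult_right_mono) auto
    then have "num s \<ge> den s + num s'" using that(2) by simp
    with num_le_den[OF that(4)] have ns: "num s = den s" "num s' = 0" by auto
    with coprime_cf_pair[of s] have d1: "den s = 1" by simp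
    have "s' = []" using num_pos[OF that(5)] ns(2) by (cases "s' = []") auto
    moreover have "s = [1]"
    proof (cases s)
      case Nil
      then show ?thesis using ns d1 by simp
    next
      case (Cons c r)
      then have "den r = 1" "c + num r = 1" "c \<ge> 1" "valid r" using ns d1 that(4) by auto
      then have "num r = 0" "c = 1" by auto
      with num_pos[OF \<open>valid r\<close>] Cons show ?thesis by (cases "r = []") auto
    qed
    ultimately show False using that(6) by simp
  qed
  have "a = b"
    using key[OF _ e z val par] key[OF _ _ z[symmetric] val(2,1) par[symmetric], of b a] e z
    by (metis linorder_neqE_nat)
  moreover from this e have "num u = num v'" by simp
  ultimately show ?case using Cons.IH[OF val(1,2) _ par] z v by (simp add: prod_eq_iff)
qed

text \<open>\<open>cf_pair\<close> is injective on the words of each parity of length, hence the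
  factor \<open>2\<close>.\<close>

lemma card_words_le:
  assumes "\<And>w. w \<in> S \<Longrightarrow> valid w" "finite T" "cf_pair ` S \<subseteq> T"
  shows "finite S" "card S \<le> 2 * card T"
proof -
  define E where "E = {w \<in> S. even (length w)}"
  define D where "D = {w \<in> S. odd (length w)}"
  have S: "S = E \<union> D" by (auto simp: E_def D_def)
  have i: "inj_on cf_pair E" "inj_on cf_pair D"
    using assms(1) cf_pair_inj_parity by (auto simp: inj_on_def E_def D_def)
  have sub: "cf_pair ` E \<subseteq> T" "cf_pair ` D \<subseteq> T" using assms(3) by (auto simp: E_def D_def)
  have fin: "finite E" "finite D" using i sub assms(2) by (meson finite_imageD finite_subset)+
  then show "finite S" by (simp add: S)
  have "card E \<le> card T" "card D \<le> card T" using i sub assms(2) by (auto intro: card_inj_on_le)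
  moreover have "card S \<le> card E + card D" unfolding S by (rule card_Un_le)
  ultimately show "card S \<le> 2 * card T" by simp
qed

text \<open>Expansions ending in \<open>1\<close> are included: reversal preserves this set, but it
  would not preserve the condition on the last digit.\<close>

definition words :: "nat \<Rightarrow> nat list set" where
  "words N = {w. valid w \<and> den w = N}"

lemma finite_words [simp]: "finite (words N)"
proof (rule card_words_le)
  show "cf_pair ` words N \<subseteq> {N} \<times> {..N}"
    using num_le_den by (auto simp: words_def prod_eq_iff image_iff mem_Times_iff)
qed (auto simp: words_def)

lemma length_le_den: "valid w \<Longrightarrow> length w \<le> den w"
proof (induction w)
  case (Cons a u)
  show ?case
  proof (cases "u = []")
    case True
    then show ?thesis using Cons by simp
  next
    case False
    then have "num u \<ge> 1" "den u \<ge> length u" "a * den u \<ge> 1 * den u"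
      using Cons num_pos[of u] by (auto intro: mult_right_mono)
    then show ?thesis unfolding cf_pair.simps fst_conv list.size by linarith
  qed
qed simp

lemma rev_words: "rev ` words N = words N"
  by (auto simp: words_def den_rev intro!: image_eqI[of _ rev "rev _"])

text \<open>The determinant identity for consecutive convergents: \<open>p\<close> is the numerator
  belonging to \<open>v\<close> and \<open>e\<close> the sign of the determinant. After division by
  both denominators it places the fraction of \<open>v @ u\<close> at signed distance
  \<open>e * num u / (den v * den (v @ u))\<close> from \<open>p / den v\<close>.\<close>

lemma num_append_approx:
  obtains p e :: int where "e = 1 \<or> e = -1"
    "\<And>u. int (num (v @ u)) * int (den v) = p * int (den (v @ u)) + e * int (num u)"
proof -
  have "\<exists>(p::int) (p'::int). (p' * den (rev v) - p * num (rev v) = 1 \<or> p' * den (rev v) - p * num (rev v) = -1) \<and>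
     (\<forall>u. int (num (v @ u)) = p * den u + p' * num u)"
  proof (induction v rule: rev_induct)
    case Nil
    show ?case by (rule exI[of _ 0], rule exI[of _ 1]) simp
  next
    case (snoc b v)
    then obtain p p' :: int where p: "p' * den (rev v) - p * num (rev v) = 1 \<or> p' * den (rev v) - p * num (rev v) = -1"
      "\<And>u. int (num (v @ u)) = p * den u + p' * num u" by blast
    show ?case
    proof (rule exI[of _ "p * b + p'"], rule exI[of _ p], intro conjI allI)
      show "p * den (rev (v @ [b])) - (p * b + p') * num (rev (v @ [b])) = 1 \<or>
            p * den (rev (v @ [b])) - (p * b + p') * num (rev (v @ [b])) = -1"
        using p(1) by (auto simp: algebra_simps)
      show "int (num ((v @ [b]) @ u)) = (p * b + p') * den u + p * num u" for u
        using p(2)[of "b # u"] by (simp add: algebra_simps)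
    qed
  qed
  then obtain p p' :: int where p: "p' * den (rev v) - p * num (rev v) = 1 \<or> p' * den (rev v) - p * num (rev v) = -1"
      "\<And>u. int (num (v @ u)) = p * den u + p' * num u" by blast
  show ?thesis
  proof (rule that[OF p(1), of p])
    fix u
    show "int (num (v @ u)) * int (den v) = p * int (den (v @ u)) + (p' * den (rev v) - p * num (rev v)) * int (num u)"
      unfolding p(2) den_append den_rev by (simp add: algebra_simps)
  qed
qed

lemma den_append_ge: "valid v \<Longrightarrow> valid u \<Longrightarrow> den v \<le> den (v @ u)"
  using den_pos[of u] by (auto simp: den_append den_rev intro: trans_le_add1)

text \<open>The sum of \<open>f\<close> over the digits of \<open>u\<close> read after a prefix whose last two denominators are
  \<open>q\<close> and \<open>q'\<close>, stopped as soon as the denominator exceeds \<open>Q\<close>.\<close>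

fun initial_sum :: "real \<Rightarrow> (nat \<Rightarrow> real) \<Rightarrow> nat \<Rightarrow> nat \<Rightarrow> nat list \<Rightarrow> real" where
  "initial_sum Q f q q' [] = 0"
| "initial_sum Q f q q' (b # u) = (if real (b * q + q') \<le> Q then f b + initial_sum Q f (b * q + q') q u else 0)"

text \<open>Denominators do not decrease along \<open>u\<close>, so after a stop no later prefix
  meets the condition again. The form with prefixes can be matched, position by position, with the
  suffix conditions that arise from the reversed word.\<close>

lemma initial_sum_eq:
  assumes "valid v" "valid u"
  shows "initial_sum Q f (den v) (num (rev v)) u
    = (\<Sum>k<length u. if real (den (v @ take (Suc k) u)) \<le> Q then f (u ! k) else 0)"
  using assms
proof (induction u arbitrary: v)
  case (Cons b u)
  have d: "den (v @ [b]) = b * den v + num (rev v)" using den_rev[of "v @ [b]"] by (simp add: den_rev)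
  have n: "num (rev (v @ [b])) = den v" by (simp add: den_rev)
  have IH: "initial_sum Q f (b * den v + num (rev v)) (den v) u
      = (\<Sum>k<length u. if real (den (v @ b # take (Suc k) u)) \<le> Q then f (u ! k) else 0)"
    using Cons.IH[of "v @ [b]"] Cons.prems unfolding d n by simp
  have late: "\<not> real (den (v @ b # take (Suc k) u)) \<le> Q" if "\<not> real (b * den v + num (rev v)) \<le> Q" for k
  proof -
    have "b * den v + num (rev v) \<le> den (v @ b # take (Suc k) u)"
      using den_append_ge[of "v @ [b]" "take (Suc k) u"] Cons.prems valid_take unfolding d by simp
    then have "real (b * den v + num (rev v)) \<le> real (den (v @ b # take (Suc k) u))"
      by (simp only: of_nat_le_iff)
    with that show ?thesis by linarith
  qed
  show ?case
    unfolding length_Cons sum.lessThan_Suc_shift using IH late d by (auto intro!: sum.neutral cong: if_cong)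
qed simp

text \<open>Backward induction over the tree of prefixes with denominator at most \<open>Q\<close>. The squared term of the
  bound is the potential provided by the corrector \<open>g\<close>; the logarithm counts the remaining steps, since
  the length \<open>1 / (q * (q + q'))\<close> of a cylinder at least halves with each digit.\<close>

lemma tree_second_moment:
  fixes Q \<kappa> c F2 A :: real and g f
  assumes N: "Q < real N" "\<kappa> \<ge> 0" "c \<ge> 0" "F2 \<ge> 0"
    and leaf: "\<And>v b0. valid v \<Longrightarrow> real (den v) \<le> Q \<Longrightarrow> real (b0 * den v + num (rev v)) \<le> Q \<Longrightarrow>
       Q < real ((b0 + 1) * den v + num (rev v)) \<Longrightarrow>
       real (card {u. v @ u \<in> words N \<and> (u = [] \<or> hd u > b0)})
         \<le> \<kappa> / (real (den v) * real ((b0 + 1) * den v + num (rev v)))"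
    and step: "\<And>t \<sigma> b0 r. t \<in> {0..1} \<Longrightarrow> 0 \<le> r \<Longrightarrow> r \<le> ln (real b0 + 1 + t) \<Longrightarrow>
        (\<Sum>b=1..b0. dprob t b * (2 * (\<sigma> + (f b - A * ln (real b + t)) + g (1 / (real b + t)))\<^sup>2))
             + (1 + t) / (real b0 + 1 + t) * (\<sigma> - A * r)\<^sup>2
           \<le> 2 * (\<sigma> + g t)\<^sup>2 + c * F2"
    and v: "valid v" "real (den v) \<le> Q" "2 * Q < real (den v + num (rev v) + m)"
  shows "(\<Sum>u | v @ u \<in> words N. (s + initial_sum Q f (den v) (num (rev v)) u)\<^sup>2)
     \<le> \<kappa> / (real (den v) * real (den v + num (rev v))) *
       (2 * (s + A * ln (Q / real (den v)) + g (real (num (rev v)) / real (den v)))\<^sup>2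
         + c * F2 * (1 + log 2 (2 * Q\<^sup>2 / (real (den v) * real (den v + num (rev v))))))"
  using v
proof (induction m arbitrary: v s)
  \<comment> \<open>\<open>m\<close> only bounds the depth: \<open>q + q'\<close> grows with every
    digit and is at most \<open>2 * Q\<close> as long as \<open>q <= Q\<close>, so this case is
    contradictory.\<close>
  case 0
  then show ?case using num_le_den[of "rev v"] by (auto simp: den_rev)
next
  case (Suc m)
  define q where "q = den v"
  define q' where "q' = num (rev v)"
  have q: "q \<ge> 1" "q' \<le> q" using den_pos[of v] num_le_den[of "rev v"] Suc.prems
    by (auto simp: q_def q'_def den_rev)
  have qQ: "real q \<le> Q" using Suc.prems by (simp add: q_def)
  \<comment> \<open>The largest digit that keeps the next denominator at most \<open>Q\<close>, or
    \<open>0\<close> if there is none.\<close>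
  define b0 where "b0 = nat \<lfloor>(Q - real q') / real q\<rfloor>"
  have xge: "(Q - real q') / real q \<ge> 0" using q qQ by simp
  then have "real b0 = of_int \<lfloor>(Q - real q') / real q\<rfloor>" by (simp add: b0_def)
  then have "real b0 \<le> (Q - real q') / real q" "(Q - real q') / real q < real b0 + 1" by linarith+
  then have b0: "real (b0 * q + q') \<le> Q" "Q < real ((b0 + 1) * q + q')"
    using q by (simp_all add: field_simps)
  define t where "t = real q' / real q"
  have t: "0 \<le> t" "t \<le> 1" using q by (auto simp: t_def)
  define L where "L = {u. v @ u \<in> words N \<and> (u = [] \<or> hd u > b0)}"
  define Wv where "Wv = (\<lambda>v. {u. v @ u \<in> words N})"
  have fin: "finite (Wv v)" for v
  proof (rule finite_imageD)
    show "finite ((@) v ` Wv v)" by (rule finite_subset[OF _ finite_words[of N]]) (auto simp: Wv_def)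
  qed (auto simp: inj_on_def)
  have decomp: "Wv v = L \<union> (\<Union>b\<in>{1..b0}. (#) b ` Wv (v @ [b]))"
  proof (intro equalityI subsetI)
    fix u assume u: "u \<in> Wv v"
    show "u \<in> L \<union> (\<Union>b\<in>{1..b0}. (#) b ` Wv (v @ [b]))"
    proof (cases u)
      case Nil
      then show ?thesis using u by (simp add: L_def Wv_def)
    next
      case (Cons b u')
      then have "b \<ge> 1" using u by (auto simp: Wv_def words_def)
      then show ?thesis using u Cons by (cases "b \<le> b0") (auto simp: L_def Wv_def)
    qed
  qed (auto simp: L_def Wv_def)
  have finL: "finite L" using fin[of v] decomp by simp
  let ?h = "\<lambda>u. (s + initial_sum Q f q q' u)\<^sup>2"
  have sumL: "(\<Sum>u\<in>L. ?h u) = real (card L) * s\<^sup>2"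
  proof -
    have "?h u = s\<^sup>2" if "u \<in> L" for u
    proof (cases u)
      case (Cons b u')
      with that have "b \<ge> b0 + 1" by (auto simp: L_def)
      then have "(b0 + 1) * q + q' \<le> b * q + q'" by (intro add_right_mono mult_right_mono) auto
      then have "Q < real (b * q + q')" using b0(2) by linarith
      then show ?thesis by (simp add: Cons)
    qed simp
    then show ?thesis by simp
  qed
  have sumb: "(\<Sum>u\<in>(#) b ` Wv (v @ [b]). ?h u) = (\<Sum>u\<in>Wv (v @ [b]). ((s + f b) + initial_sum Q f (b * q + q') q u)\<^sup>2)"
    if "b \<in> {1..b0}" for b
  proof -
    have "b * q + q' \<le> b0 * q + q'" using that by (intro add_right_mono mult_right_mono) auto
    then have "real (b * q + q') \<le> Q" using b0(1) by linarith
    then show ?thesis by (subst sum.reindex) (auto simp: inj_on_def add.assoc)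
  qed
  have "(\<Sum>u\<in>Wv v. ?h u) = (\<Sum>u\<in>L. ?h u) + (\<Sum>u\<in>(\<Union>b\<in>{1..b0}. (#) b ` Wv (v @ [b])). ?h u)"
    unfolding decomp
  proof (rule sum.union_disjoint)
    show "L \<inter> (\<Union>b\<in>{1..b0}. (#) b ` Wv (v @ [b])) = {}" by (auto simp: L_def)
  qed (use finL fin in auto)
  also have "(\<Sum>u\<in>(\<Union>b\<in>{1..b0}. (#) b ` Wv (v @ [b])). ?h u)
    = (\<Sum>b=1..b0. \<Sum>u\<in>(#) b ` Wv (v @ [b]). ?h u)"
    by (rule sum.UNION_disjoint) (use fin in auto)
  also have "\<dots> = (\<Sum>b=1..b0. \<Sum>u\<in>Wv (v @ [b]). ((s + f b) + initial_sum Q f (b * q + q') q u)\<^sup>2)"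
    by (rule sum.cong) (use sumb in auto)
  finally have total: "(\<Sum>u\<in>Wv v. ?h u) = real (card L) * s\<^sup>2
     + (\<Sum>b=1..b0. \<Sum>u\<in>Wv (v @ [b]). ((s + f b) + initial_sum Q f (b * q + q') q u)\<^sup>2)"
    by (simp add: sumL)
  define I where "I = \<kappa> / (real q * real (q + q'))"
  have I0: "I \<ge> 0" using N by (simp add: I_def)
  define n' where "n' = log 2 (2 * Q\<^sup>2 / (real q * real (q + q')))"
  \<comment> \<open>The sum so far plus the predicted rest. A digit \<open>b\<close> multiplies the
    denominator by \<open>b + t\<close>, so it changes \<open>\<sigma>\<close> by
    \<open>f b - A * ln (b + t)\<close>. At a stop, subtracting \<open>A * ln (Q / q)\<close> gives
    back \<open>s\<close>.\<close>
  define \<sigma> where "\<sigma> = s + A * ln (Q / real q)"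
  have qr: "real q > 0" using q by simp
  have Q0: "Q > 0" using qr qQ by linarith
  have n'0: "n' \<ge> 0"
  proof -
    have "real q * real (q + q') \<le> Q * (2 * Q)" using q qQ by (intro mult_mono) auto
    also have "\<dots> = 2 * Q\<^sup>2" by (simp add: power2_eq_square)
    finally have "1 \<le> 2 * Q\<^sup>2 / (real q * real (q + q'))" using qr by simp
    then show ?thesis by (simp add: n'_def)
  qed
  have child: "(\<Sum>u\<in>Wv (v @ [b]). ((s + f b) + initial_sum Q f (b * q + q') q u)\<^sup>2)
     \<le> I * dprob t b * (2 * (\<sigma> + (f b - A * ln (real b + t)) + g (1 / (real b + t)))\<^sup>2 + c * F2 * n')"
    if b: "b \<in> {1..b0}" for b
  proof -
    define qb where "qb = b * q + q'"
    have vb: "den (v @ [b]) = qb" "num (rev (v @ [b])) = q"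
      using den_rev[of "v @ [b]"] by (simp_all add: qb_def q_def q'_def den_rev)
    have "b * q + q' \<le> b0 * q + q'" using b by (intro add_right_mono mult_right_mono) auto
    then have qbQ: "real qb \<le> Q" using b0(1) unfolding qb_def by linarith
    have "b * q \<ge> 1 * q" using b by (intro mult_right_mono) auto
    then have "qb \<ge> q + q'" by (simp add: qb_def)
    then have qbge: "qb \<ge> q + q'" "qb \<ge> 1" using q by linarith+
    have IH: "(\<Sum>u\<in>Wv (v @ [b]). ((s + f b) + initial_sum Q f qb q u)\<^sup>2)
      \<le> \<kappa> / (real qb * real (qb + q)) * (2 * ((s + f b) + A * ln (Q / real qb) + g (real q / real qb))\<^sup>2
         + c * F2 * (1 + log 2 (2 * Q\<^sup>2 / (real qb * real (qb + q)))))"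
      unfolding Wv_def using Suc.IH[of "v @ [b]" "s + f b"] Suc.prems b qbQ qbge q unfolding vb
      by (simp add: q_def[symmetric] q'_def[symmetric])
    have bt: "real qb = real q * (real b + t)" using qr by (simp add: qb_def t_def field_simps)
    have btpos: "real b + t > 0" using b t by simp
    have w: "\<kappa> / (real qb * real (qb + q)) = I * dprob t b"
    proof -
      have "real (qb + q) = real q * (real b + 1 + t)" using bt by (simp add: algebra_simps)
      moreover have "real (q + q') = real q * (1 + t)" using qr by (simp add: t_def field_simps)
      moreover have "\<kappa> / ((real q * x) * (real q * y)) = \<kappa> / (real q * (real q * z)) * (z / (x * y))"
        if "z > 0" for x y z using that by simp
      ultimately show ?thesis unfolding I_def dprob_def using bt t by simp
    qed
    have l1: "ln (Q / real qb) = ln (Q / real q) - ln (real b + t)"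
      unfolding bt using qr btpos Q0 by (simp add: ln_div ln_mult)
    have l2: "real q / real qb = 1 / (real b + t)" unfolding bt using qr by simp
    \<comment> \<open>\<open>qb >= q + q'\<close> and \<open>qb + q >= 2 * q\<close>, so the
      argument of the logarithm at least halves. This releases the one summand \<open>c * F2\<close>
      that \<open>step\<close> costs.\<close>
    have l3: "1 + log 2 (2 * Q\<^sup>2 / (real qb * real (qb + q))) \<le> n'"
    proof -
      have "2 * (real q * real (q + q')) = real (2 * q) * real (q + q')" by simp
      also have "\<dots> \<le> real (qb + q) * real qb"
        using qbge q by (intro mult_mono) (auto simp del: of_nat_add)
      finally have le: "2 * (real q * real (q + q')) \<le> real qb * real (qb + q)" by (simp add: mult.commute)
      have "1 + log 2 (2 * Q\<^sup>2 / (real qb * real (qb + q))) = log 2 (2 * (2 * Q\<^sup>2 / (real qb * real (qb + q))))"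
        using Q0 qbge by (subst log_mult) auto
      also have "\<dots> \<le> n'" unfolding n'_def
      proof (rule log_mono)
        have "2 * (2 * Q\<^sup>2 / (real qb * real (qb + q))) \<le> 2 * (2 * Q\<^sup>2 / (2 * (real q * real (q + q'))))"
          using le qr Q0 qbge by (intro mult_left_mono divide_left_mono) auto
        then show "2 * (2 * Q\<^sup>2 / (real qb * real (qb + q))) \<le> 2 * Q\<^sup>2 / (real q * real (q + q'))" by simp
      qed (use Q0 qbge in auto)
      finally show ?thesis .
    qed
    have "(\<Sum>u\<in>Wv (v @ [b]). ((s + f b) + initial_sum Q f qb q u)\<^sup>2)
      \<le> I * dprob t b * (2 * ((s + f b) + A * ln (Q / real qb) + g (real q / real qb))\<^sup>2
         + c * F2 * (1 + log 2 (2 * Q\<^sup>2 / (real qb * real (qb + q)))))"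
      using IH unfolding w .
    also have "\<dots> \<le> I * dprob t b * (2 * ((s + f b) + A * ln (Q / real qb) + g (real q / real qb))\<^sup>2 + c * F2 * n')"
      using l3 I0 dprob_nonneg[OF t(1)] N by (intro mult_left_mono add_left_mono) auto
    also have "(s + f b) + A * ln (Q / real qb) + g (real q / real qb)
       = \<sigma> + (f b - A * ln (real b + t)) + g (1 / (real b + t))"
      unfolding l1 l2 \<sigma>_def by (simp add: algebra_simps)
    finally show ?thesis unfolding qb_def .
  qed
  have leafb: "real (card L) * s\<^sup>2 \<le> I * ((1 + t) / (real b0 + 1 + t) * (\<sigma> - A * ln (Q / real q))\<^sup>2)"
  proof -
    have "real (card L) \<le> \<kappa> / (real q * real ((b0 + 1) * q + q'))"
      unfolding L_def using leaf[of v b0] Suc.prems b0 unfolding q_def q'_def by simp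
    also have "real ((b0 + 1) * q + q') = real q * (real b0 + 1 + t)" using qr by (simp add: t_def field_simps)
    also have "\<kappa> / (real q * (real q * (real b0 + 1 + t))) = I * ((1 + t) / (real b0 + 1 + t))"
    proof -
      have "real (q + q') = real q * (1 + t)" using qr by (simp add: t_def field_simps)
      moreover have "\<kappa> / (real q * (real q * y)) = \<kappa> / (real q * (real q * z)) * (z / y)"
        if "z > 0" for y z using that by simp
      ultimately show ?thesis unfolding I_def using t by simp
    qed
    finally have "real (card L) * s\<^sup>2 \<le> I * ((1 + t) / (real b0 + 1 + t)) * s\<^sup>2" by (rule mult_right_mono) simp
    then show ?thesis by (simp add: \<sigma>_def mult.assoc)
  qed
  have r: "0 \<le> ln (Q / real q)" "ln (Q / real q) \<le> ln (real b0 + 1 + t)"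
  proof -
    show "0 \<le> ln (Q / real q)" using qr qQ by simp
    have "Q / real q \<le> real b0 + 1 + t" using b0(2) qr by (simp add: t_def field_simps)
    then show "ln (Q / real q) \<le> ln (real b0 + 1 + t)" using Q0 qr t by (subst ln_le_cancel_iff) auto
  qed
  have gsum: "(\<Sum>b=1..b0. dprob t b) \<le> 1"
  proof -
    have "dmean t (\<lambda>_. 1) = (\<Sum>b=1..b0. dprob t b * 1) + (\<Sum>i. dprob t (Suc (b0 + i)) * 1)"
      by (rule dmean_split[OF t slow_const])
    moreover have "(\<Sum>i. dprob t (Suc (b0 + i)) * 1) \<ge> 0"
      using sums_summable[OF dprob_sums[OF t(1), of b0]] dprob_nonneg[OF t(1)] by (intro suminf_nonneg) auto
    ultimately show ?thesis using dmean_const[OF t(1), of 1] by simp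
  qed
  let ?D = "\<lambda>b. (\<sigma> + (f b - A * ln (real b + t)) + g (1 / (real b + t)))\<^sup>2"
  have "(\<Sum>u\<in>Wv v. ?h u) \<le> I * ((1 + t) / (real b0 + 1 + t) * (\<sigma> - A * ln (Q / real q))\<^sup>2)
     + (\<Sum>b=1..b0. I * dprob t b * (2 * ?D b + c * F2 * n'))"
    unfolding total by (intro add_mono leafb sum_mono child)
  also have "\<dots> = I * (((\<Sum>b=1..b0. dprob t b * (2 * ?D b)) + (1 + t) / (real b0 + 1 + t) * (\<sigma> - A * ln (Q / real q))\<^sup>2)
     + c * F2 * n' * (\<Sum>b=1..b0. dprob t b))"
    by (simp add: sum.distrib sum_distrib_left distrib_left mult_ac)
  also have "\<dots> \<le> I * ((2 * (\<sigma> + g t)\<^sup>2 + c * F2) + c * F2 * n' * 1)"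
  proof (rule mult_left_mono[OF add_mono I0])
    show "(\<Sum>b=1..b0. dprob t b * (2 * ?D b)) + (1 + t) / (real b0 + 1 + t) * (\<sigma> - A * ln (Q / real q))\<^sup>2
      \<le> 2 * (\<sigma> + g t)\<^sup>2 + c * F2" by (rule step) (use t r in auto)
    show "c * F2 * n' * (\<Sum>b=1..b0. dprob t b) \<le> c * F2 * n' * 1"
      using gsum n'0 N by (intro mult_left_mono) auto
  qed
  also have "\<dots> = I * (2 * (\<sigma> + g t)\<^sup>2 + c * F2 * (1 + n'))" by (simp add: algebra_simps)
  finally show ?case unfolding Wv_def I_def \<sigma>_def n'_def t_def q_def q'_def .
qed

section \<open>An upper bound sieve for short intervals\<close>

text \<open>The alternating sum of \<open>card S choose j\<close> over \<open>j <= 2 * k\<close> is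
  the generalised binomial coefficient of \<open>card S - 1\<close> over \<open>2 * k\<close>. It is
  an ordinary, hence nonnegative, coefficient for nonempty \<open>S\<close>, and it equals
  \<open>1\<close> for empty \<open>S\<close>.\<close>

lemma bonferroni_even:
  assumes "finite S"
  shows "(if S = {} then 1 else 0 :: real) \<le> (\<Sum>D | D \<subseteq> S \<and> card D \<le> 2 * k. (-1) ^ card D)"
proof -
  have "(\<Sum>D | D \<subseteq> S \<and> card D \<le> 2 * k. (-1) ^ card D :: real)
      = (\<Sum>j\<le>2*k. \<Sum>D | D \<in> {D. D \<subseteq> S \<and> card D \<le> 2 * k} \<and> card D = j. (-1) ^ card D)"
    by (rule sum.group[symmetric]) (use assms in auto)
  also have "\<dots> = (\<Sum>j\<le>2*k. real (card S choose j) * (-1) ^ j)"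
  proof (rule sum.cong[OF refl])
    fix j assume "j \<in> {..2*k}"
    then have "{D. D \<in> {D. D \<subseteq> S \<and> card D \<le> 2 * k} \<and> card D = j} = {D. D \<subseteq> S \<and> card D = j}" by auto
    then show "(\<Sum>D | D \<in> {D. D \<subseteq> S \<and> card D \<le> 2 * k} \<and> card D = j. (-1) ^ card D)
        = real (card S choose j) * (-1) ^ j"
      using n_subsets[OF assms, of j] by simp
  qed
  also have "\<dots> = (real (card S) - 1 gchoose (2 * k))"
    using gbinomial_sum_lower_neg[of "real (card S)" "2 * k"] by (simp add: binomial_gbinomial)
  finally have eq: "(\<Sum>D | D \<subseteq> S \<and> card D \<le> 2 * k. (-1) ^ card D) = (real (card S) - 1 gchoose (2 * k))" .
  show ?thesis
  proof (cases "S = {}")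
    case True
    then have "{D. D \<subseteq> S \<and> card D \<le> 2 * k} = {{}}" by auto
    then show ?thesis using True by simp
  next
    case False
    then have c: "real (card S) - 1 = real (card S - 1)" using assms by (simp add: Suc_le_eq card_gt_0_iff of_nat_diff)
    have "(real (card S) - 1 gchoose (2 * k)) = real ((card S - 1) choose (2 * k))"
      unfolding c by (rule binomial_gbinomial[symmetric])
    then show ?thesis using False eq by simp
  qed
qed

lemma prod_one_plus_eq_sum_subsets:
  fixes x :: "'a \<Rightarrow> real"
  assumes "finite P"
  shows "(\<Prod>p\<in>P. 1 + x p) = (\<Sum>D | D \<subseteq> P. \<Prod>p\<in>D. x p)"
  using assms
proof (induction P)
  case (insert q P)
  have "{D. D \<subseteq> insert q P} = Pow P \<union> insert q ` Pow P" using Pow_insert[of q P] by (simp add: Pow_def)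
  also have "(\<Sum>D\<in>\<dots>. \<Prod>p\<in>D. x p) = (\<Sum>D\<in>Pow P. \<Prod>p\<in>D. x p) + (\<Sum>D\<in>insert q ` Pow P. \<Prod>p\<in>D. x p)"
    by (rule sum.union_disjoint) (use insert in auto)
  also have "(\<Sum>D\<in>insert q ` Pow P. \<Prod>p\<in>D. x p) = (\<Sum>D\<in>Pow P. \<Prod>p\<in>insert q D. x p)"
    by (rule sum.reindex[unfolded o_def]) (use insert in \<open>auto simp: inj_on_def\<close>)
  also have "\<dots> = (\<Sum>D\<in>Pow P. x q * (\<Prod>p\<in>D. x p))"
    by (rule sum.cong[OF refl], subst prod.insert) (use insert finite_subset in auto)
  finally show ?case using insert by (simp add: Pow_def sum_distrib_left[symmetric] algebra_simps)
qed simp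

lemma card_subsets_le:
  assumes "finite P" shows "card {D. D \<subseteq> P \<and> card D \<le> m} \<le> (1 + card P) ^ m"
proof -
  have "{D. D \<subseteq> P \<and> card D \<le> m} = (\<Union>j\<in>{..m}. {D. D \<subseteq> P \<and> card D = j})" by auto
  then have "card {D. D \<subseteq> P \<and> card D \<le> m} \<le> (\<Sum>j\<le>m. card {D. D \<subseteq> P \<and> card D = j})"
    using card_UN_le[of "{..m}" "\<lambda>j. {D. D \<subseteq> P \<and> card D = j}"] by simp
  also have "\<dots> = (\<Sum>j\<le>m. card P choose j)" by (simp add: n_subsets[OF assms])
  also have "\<dots> \<le> (\<Sum>j\<le>m. (m choose j) * card P ^ j * 1 ^ (m - j))"
  proof (rule sum_mono)
    fix j assume j: "j \<in> {..m}"
    have "card P choose j \<le> 1 * card P ^ j" 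
      by (cases "j \<le> card P") (auto simp: binomial_le_pow binomial_eq_0 not_le)
    also have "\<dots> \<le> (m choose j) * card P ^ j"
      using j by (intro mult_right_mono) (auto simp: Suc_le_eq)
    finally show "card P choose j \<le> (m choose j) * card P ^ j * 1 ^ (m - j)" by simp
  qed
  also have "\<dots> = (card P + 1) ^ m" by (subst binomial) simp
  finally show ?thesis by (simp add: add.commute)
qed

lemma prod_primes_dvd_iff:
  fixes a :: int
  assumes "finite D" "\<And>p. p \<in> D \<Longrightarrow> prime (p::nat)"
  shows "int (\<Prod>D) dvd a \<longleftrightarrow> (\<forall>p\<in>D. int p dvd a)"
  using assms
proof (induction D)
  case (insert q D)
  have "coprime q (\<Prod>D)"
    using insert by (intro prod_coprime_right) (auto intro: primes_coprime)
  then have "coprime (int q) (int (\<Prod>D))" by (simp only: coprime_int_iff)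
  then have "int q * int (\<Prod>D) dvd a \<longleftrightarrow> int q dvd a \<and> int (\<Prod>D) dvd a"
    using divides_mult by (metis dvd_mult_left dvd_mult_right)
  then show ?case using insert by simp
qed simp

lemma card_multiples_interval:
  fixes \<alpha> H :: real and d :: nat
  assumes "H \<ge> 0" "d \<ge> 1"
  shows "\<bar>real (card {a::int. \<alpha> \<le> a \<and> a \<le> \<alpha> + H \<and> int d dvd a}) - H / d\<bar> \<le> 1"
proof -
  have d: "real d > 0" using assms by simp
  have "{a::int. \<alpha> \<le> a \<and> a \<le> \<alpha> + H \<and> int d dvd a} = (\<lambda>j. int d * j) ` {\<lceil>\<alpha> / d\<rceil>..\<lfloor>(\<alpha> + H) / d\<rfloor>}"
    using d by (auto simp: image_iff dvd_def ceiling_le_iff le_floor_iff field_simps)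
  moreover have "inj_on (\<lambda>j. int d * j) {\<lceil>\<alpha> / d\<rceil>..\<lfloor>(\<alpha> + H) / d\<rfloor>}" using assms by (auto simp: inj_on_def)
  ultimately have c: "card {a::int. \<alpha> \<le> a \<and> a \<le> \<alpha> + H \<and> int d dvd a} = nat (\<lfloor>(\<alpha> + H) / d\<rfloor> - \<lceil>\<alpha> / d\<rceil> + 1)"
    by (simp add: card_image)
  have le: "\<alpha> / d \<le> (\<alpha> + H) / d" using assms d by (intro divide_right_mono) auto
  have "\<lceil>\<alpha> / d\<rceil> \<le> \<lfloor>(\<alpha> + H) / d\<rfloor> + 1" using le by linarith
  then have "real (card {a::int. \<alpha> \<le> a \<and> a \<le> \<alpha> + H \<and> int d dvd a}) = of_int \<lfloor>(\<alpha> + H) / d\<rfloor> - of_int \<lceil>\<alpha> / d\<rceil> + 1"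
    unfolding c by simp
  moreover have "(\<alpha> + H) / d = \<alpha> / d + H / d" by (rule add_divide_distrib)
  ultimately show ?thesis by linarith
qed

section \<open>Sums over the prime divisors of \<open>N\<close>\<close>

lemma sum_inverse_le_harm:
  assumes "finite J" "0 \<notin> J"
  shows "(\<Sum>j\<in>J. 1 / real j) \<le> (\<Sum>i=1..card J. 1 / real i)"
  using assms
proof (induction "card J" arbitrary: J)
  case (Suc n)
  define m where "m = Max J"
  have ne: "J \<noteq> {}" using Suc.hyps(2) by auto
  have m: "m \<in> J" using Suc ne by (simp add: m_def)
  have "J \<subseteq> {1..m}" using Suc.prems by (auto simp: m_def Suc_le_eq intro: gr0I)
  then have "card J \<le> m" using card_mono[of "{1..m}" J] by simp
  then have mn: "real m \<ge> real (Suc n)" using Suc.hyps(2) by simp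
  have "(\<Sum>j\<in>J. 1 / real j) = 1 / real m + (\<Sum>j\<in>J - {m}. 1 / real j)"
    using Suc.prems m by (simp add: sum.remove)
  also have "(\<Sum>j\<in>J - {m}. 1 / real j) \<le> (\<Sum>i=1..n. 1 / real i)"
  proof -
    have c: "n = card (J - {m})" using Suc.hyps(2) Suc.prems m by simp
    show ?thesis using Suc.hyps(1)[OF c] Suc.prems unfolding c[symmetric] by simp
  qed
  also have "1 / real m \<le> 1 / real (Suc n)" using mn by (intro divide_left_mono) auto
  finally show ?case using Suc.hyps(2)[symmetric] by simp
qed simp

lemma harmonic_le_ln: "n \<ge> 1 \<Longrightarrow> (\<Sum>i=1..n. 1 / real i) \<le> 1 + ln (real n)"
proof (induction n rule: dec_induct)
  case (step n)
  have "ln (real n / real (Suc n)) \<le> real n / real (Suc n) - 1"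
    using step by (intro ln_le_minus_one) auto
  also have "\<dots> = - 1 / real (Suc n)" by (simp add: field_simps)
  finally have "1 / real (Suc n) \<le> ln (real (Suc n)) - ln (real n)" using step by (simp add: ln_div)
  then show ?case using step by simp
qed simp

definition recip_sum :: "nat \<Rightarrow> real" where
  "recip_sum N = (\<Sum>p\<in>prime_factors N. 1 / real p)"

text \<open>Odd primes go injectively to \<open>p div 2\<close>, and \<open>1 / p\<close> is at most
  half of \<open>1 / (p div 2)\<close>; distinct positive integers have a reciprocal sum of at most
  a harmonic number. The resulting \<open>1/2\<close> before the logarithm is what keeps
  \<open>N / totient N\<close> down to the order of the square root of \<open>ln N\<close>.\<close>

lemma recip_sum_le:
  assumes "card (prime_factors N) \<ge> 1"
  shows "recip_sum N \<le> 1 + ln (card (prime_factors N)) / 2"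
proof -
  define P where "P = prime_factors N"
  define O' where "O' = P - {2}"
  have P: "finite P" "\<And>p. p \<in> P \<Longrightarrow> prime p" by (auto simp: P_def)
  have odd: "odd p" if "p \<in> O'" for p using that P(2) primes_dvd_imp_eq two_is_prime_nat unfolding O'_def by blast
  have "recip_sum N \<le> 1/2 + (\<Sum>p\<in>O'. 1 / real p)"
  proof (cases "2 \<in> P")
    case True
    then show ?thesis using P(1) by (simp add: recip_sum_def P_def[symmetric] O'_def sum.remove)
  next
    case False
    then show ?thesis by (simp add: recip_sum_def P_def[symmetric] O'_def)
  qed
  also have "(\<Sum>p\<in>O'. 1 / real p) \<le> (\<Sum>p\<in>O'. 1/2 * (1 / real (p div 2)))"
  proof (rule sum_mono)
    fix p assume p: "p \<in> O'"
    have "2 * (p div 2) \<le> p" "p div 2 \<ge> 1" using prime_ge_2_nat[of p] P(2)[of p] p by (auto simp: O'_def)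
    then have "1 / real p \<le> 1 / real (2 * (p div 2))" by (intro divide_left_mono) (auto simp del: of_nat_mult)
    then show "1 / real p \<le> 1/2 * (1 / real (p div 2))" by simp
  qed
  also have "\<dots> = 1/2 * (\<Sum>j\<in>(\<lambda>p. p div 2) ` O'. 1 / real j)"
  proof -
    have "inj_on (\<lambda>p. p div 2) O'"
    proof (rule inj_onI)
      fix x y assume "x \<in> O'" "y \<in> O'" "x div 2 = y div 2"
      then show "x = y"
        using odd_two_times_div_two_succ[OF odd[of x]] odd_two_times_div_two_succ[OF odd[of y]] by simp
    qed
    then show ?thesis by (simp add: sum.reindex sum_distrib_left)
  qed
  also have "(\<Sum>j\<in>(\<lambda>p. p div 2) ` O'. 1 / real j) \<le> (\<Sum>i=1..card ((\<lambda>p. p div 2) ` O'). 1 / real i)"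
  proof (rule sum_inverse_le_harm)
    have "p div 2 \<noteq> 0" if "p \<in> O'" for p
      using prime_ge_2_nat[OF P(2), of p] that by (simp add: O'_def)
    then show "0 \<notin> (\<lambda>p. p div 2) ` O'" by (metis imageE)
  qed (use P in \<open>auto simp: O'_def\<close>)
  also have "\<dots> \<le> (\<Sum>i=1..card P. 1 / real i)"
  proof (rule sum_mono2)
    have "card ((\<lambda>p. p div 2) ` O') \<le> card P"
      using P(1) card_image_le[of O' "\<lambda>p. p div 2"] card_mono[of P O'] by (auto simp: O'_def)
    then show "{1..card ((\<lambda>p. p div 2) ` O')} \<subseteq> {1..card P}" by auto
  qed auto
  also have "\<dots> \<le> 1 + ln (real (card P))" using assms by (intro harmonic_le_ln) (simp add: P_def)
  finally show ?thesis by (simp add: P_def add_divide_distrib)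
qed

lemma card_prime_factors_le:
  fixes N :: nat
  assumes "N \<ge> 1" shows "2 ^ card (prime_factors N) \<le> N"
proof -
  have "2 ^ card (prime_factors N) = (\<Prod>p\<in>prime_factors N. (2::nat))" by simp
  also have "\<dots> \<le> \<Prod>(prime_factors N)" by (intro prod_mono) (auto dest: in_prime_factors_imp_prime intro: prime_ge_2_nat)
  also have "\<dots> \<le> N"
  proof (rule dvd_imp_le)
    have "int (\<Prod>(prime_factors N)) dvd int N" by (subst prod_primes_dvd_iff) auto
    then show "\<Prod>(prime_factors N) dvd N" by (simp only: int_dvd_int_iff)
  qed (use assms in auto)
  finally show ?thesis .
qed

text \<open>Euler product together with \<open>1 - x >= exp (- x - 2 * x^2)\<close> for
  \<open>x <= 1/2\<close>. The squares of the \<open>1 / p\<close> sum to at most \<open>1\<close>,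
  whence the \<open>2\<close> in the exponent.\<close>

lemma totient_ratio_ge:
  assumes "N \<ge> 1" shows "exp (- recip_sum N - 2) \<le> real (totient N) / real N"
proof -
  define P where "P = prime_factors N"
  have P: "finite P" "\<And>p. p \<in> P \<Longrightarrow> p \<ge> 2" by (auto simp: P_def dest: in_prime_factors_imp_prime intro: prime_ge_2_nat)
  have sq: "(\<Sum>p\<in>P. 1 / (real p)\<^sup>2) \<le> 1"
  proof -
    define M where "M = Max (insert 1 P)"
    have "P \<subseteq> {2..M}" using P by (auto simp: M_def)
    then have "(\<Sum>p\<in>P. 1 / (real p)\<^sup>2) \<le> (\<Sum>p=2..M. 1 / (real p)\<^sup>2)" by (intro sum_mono2) auto
    moreover have "M \<ge> 1" using P by (simp add: M_def)
    then have "(\<Sum>p=1..M. 1 / (real p)\<^sup>2) = 1 + (\<Sum>p=2..M. 1 / (real p)\<^sup>2)"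
      by (subst sum.atLeast_Suc_atMost) (auto simp: numeral_2_eq_2)
    ultimately show ?thesis using sum_inverse_squares_le[of M] by linarith
  qed
  have "exp (- recip_sum N - 2) \<le> exp (\<Sum>p\<in>P. - (1 / real p) - 2 * (1 / real p)\<^sup>2)"
    using sq by (simp add: recip_sum_def P_def[symmetric] sum_subtractf sum_negf power_divide
        sum_distrib_left[symmetric] del: times_divide_eq_right)
  also have "\<dots> = (\<Prod>p\<in>P. exp (- (1 / real p) - 2 * (1 / real p)\<^sup>2))" by (rule exp_sum[OF P(1)])
  also have "\<dots> \<le> (\<Prod>p\<in>P. 1 - 1 / real p)"
  proof (rule prod_mono, intro conjI)
    fix p assume "p \<in> P"
    then have p: "real p \<ge> 2" using P by fastforce
    then have x: "1 / real p \<ge> 0" "1 / real p \<le> 1/2" by auto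
    then have "exp (- (1 / real p) - 2 * (1 / real p)\<^sup>2) \<le> exp (ln (1 - 1 / real p))"
      unfolding exp_le_cancel_iff by (intro ln_one_minus_pos_lower_bound)
    then show "exp (- (1 / real p) - 2 * (1 / real p)\<^sup>2) \<le> 1 - 1 / real p" using x by simp
  qed auto
  also have "\<dots> = real (totient N) / real N" using assms by (simp add: totient_formula2 P_def)
  finally show ?thesis .
qed

text \<open>Bonferroni truncated at level \<open>2 * k\<close>; the terms with more prime factors are bounded by
  Rankin's trick, weighting each of them by \<open>exp 1\<close> per prime factor.\<close>

lemma sieve_interval:
  fixes \<alpha> H :: real
  assumes N: "N \<ge> 1" and k: "2 * recip_sum N \<le> real k"
    and H: "H \<ge> exp (recip_sum N + 2) * (1 + real (card (prime_factors N))) ^ (2 * k)"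
  shows "real (card {a::int. \<alpha> \<le> a \<and> a \<le> \<alpha> + H \<and> coprime a (int N)}) \<le> 11 * (real (totient N) / real N) * H"
proof -
  define P where "P = prime_factors N"
  have P: "finite P" "\<And>p. p \<in> P \<Longrightarrow> prime p" "\<And>p. p \<in> P \<Longrightarrow> real p > 0"
    by (auto simp: P_def dest: in_prime_factors_imp_prime intro: prime_gt_0_nat)
  define s where "s = recip_sum N"
  have s: "s = (\<Sum>p\<in>P. 1 / real p)" by (simp add: s_def recip_sum_def P_def)
  have s0: "s \<ge> 0" unfolding s by (intro sum_nonneg) auto
  define \<rho> where "\<rho> = real (totient N) / real N"
  have \<rho>: "exp (- s - 2) \<le> \<rho>" using totient_ratio_ge[OF N] by (simp add: s_def \<rho>_def)
  have H0: "H > 0" by (rule less_le_trans[OF _ H]) (auto intro!: mult_pos_pos zero_less_power)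
  define I where "I = {a::int. \<alpha> \<le> a \<and> a \<le> \<alpha> + H}"
  have "I \<subseteq> {\<lceil>\<alpha>\<rceil>..\<lfloor>\<alpha> + H\<rfloor>}" by (auto simp: I_def ceiling_le_iff le_floor_iff)
  then have finI: "finite I" by (rule finite_subset) simp
  define \<D> where "\<D> = {D. D \<subseteq> P \<and> card D \<le> 2 * k}"
  have fin\<D>: "finite \<D>" using P by (simp add: \<D>_def)
  define S where "S = (\<lambda>a::int. {p\<in>P. int p dvd a})"
  have cop: "coprime a (int N) \<longleftrightarrow> S a = {}" for a
  proof
    assume "coprime a (int N)"
    then show "S a = {}"
      using P(2) by (auto simp: S_def P_def) (metis coprime_common_divisor int_dvd_int_iff
        in_prime_factors_imp_dvd not_prime_unit prime_nat_int_transfer)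
  next
    assume S: "S a = {}"
    show "coprime a (int N)"
    proof (rule ccontr)
      assume "\<not> coprime a (int N)"
      then have "\<not> is_unit (gcd a (int N))" using coprime_iff_gcd_eq_1 by auto
      moreover have "gcd a (int N) \<noteq> 0" using N by simp
      ultimately obtain p where p: "prime p" "p dvd gcd a (int N)"
        using prime_divisor_exists by blast
      define p' where "p' = nat p"
      have p': "p = int p'" using p(1) prime_ge_0_int by (simp add: p'_def)
      have "p' \<in> S a" using p N unfolding p' S_def P_def by (auto simp: prime_factors_dvd)
      with S show False by simp
    qed
  qed
  have "real (card {a::int. \<alpha> \<le> a \<and> a \<le> \<alpha> + H \<and> coprime a (int N)}) = (\<Sum>a\<in>I. if S a = {} then 1 else 0)"
  proof -
    have "{a::int. \<alpha> \<le> a \<and> a \<le> \<alpha> + H \<and> coprime a (int N)} = {a\<in>I. S a = {}}"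
      using cop by (auto simp: I_def)
    then show ?thesis using finI by (simp add: sum.If_cases Int_def)
  qed
  also have "\<dots> \<le> (\<Sum>a\<in>I. \<Sum>D | D \<subseteq> S a \<and> card D \<le> 2 * k. (-1) ^ card D)"
    using P(1) by (intro sum_mono bonferroni_even) (simp add: S_def)
  also have "\<dots> = (\<Sum>a\<in>I. \<Sum>D\<in>\<D>. if D \<subseteq> S a then (-1) ^ card D else 0)"
  proof (rule sum.cong[OF refl])
    fix a
    have "{D. D \<subseteq> S a \<and> card D \<le> 2 * k} = {D\<in>\<D>. D \<subseteq> S a}" by (auto simp: \<D>_def S_def)
    then show "(\<Sum>D | D \<subseteq> S a \<and> card D \<le> 2 * k. (-1) ^ card D) = (\<Sum>D\<in>\<D>. if D \<subseteq> S a then (-1) ^ card D else 0 :: real)"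
      using fin\<D> by (simp add: sum.If_cases Int_def)
  qed
  also have "\<dots> = (\<Sum>D\<in>\<D>. \<Sum>a\<in>I. if D \<subseteq> S a then (-1) ^ card D else 0)" by (rule sum.swap)
  also have "\<dots> = (\<Sum>D\<in>\<D>. (-1) ^ card D * real (card {a::int. \<alpha> \<le> a \<and> a \<le> \<alpha> + H \<and> int (\<Prod>D) dvd a}))"
  proof (rule sum.cong[OF refl])
    fix D assume D: "D \<in> \<D>"
    have "finite D" using D P(1) finite_subset by (auto simp: \<D>_def)
    then have "int (\<Prod>D) dvd a \<longleftrightarrow> D \<subseteq> S a" for a
      using D P(2) by (subst prod_primes_dvd_iff) (auto simp: \<D>_def S_def)
    then have "{a::int. \<alpha> \<le> a \<and> a \<le> \<alpha> + H \<and> int (\<Prod>D) dvd a} = {a\<in>I. D \<subseteq> S a}" by (auto simp: I_def)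
    then show "(\<Sum>a\<in>I. if D \<subseteq> S a then (-1) ^ card D else 0) = (-1) ^ card D *
        real (card {a::int. \<alpha> \<le> a \<and> a \<le> \<alpha> + H \<and> int (\<Prod>D) dvd a})"
      using finI by (simp add: sum.If_cases Int_def)
  qed
  also have "\<dots> \<le> (\<Sum>D\<in>\<D>. (-1) ^ card D * (H / real (\<Prod>D)) + 1)"
  proof (rule sum_mono)
    fix D assume D: "D \<in> \<D>"
    have "\<Prod>D \<ge> 1" using D P(2) by (intro prod_ge_1) (auto simp: \<D>_def Suc_le_eq prime_gt_0_nat)
    from card_multiples_interval[OF less_imp_le[OF H0] this, of \<alpha>]
    show "(-1) ^ card D * real (card {a::int. \<alpha> \<le> a \<and> a \<le> \<alpha> + H \<and> int (\<Prod>D) dvd a})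
        \<le> (-1) ^ card D * (H / real (\<Prod>D)) + 1"
      by (cases "even (card D)") (auto simp: abs_le_iff)
  qed
  also have "\<dots> = H * (\<Sum>D\<in>\<D>. (-1) ^ card D / real (\<Prod>D)) + real (card \<D>)"
    by (simp add: sum.distrib sum_distrib_left mult.commute)
  also have "\<dots> \<le> H * (\<rho> + exp (- s)) + (1 + real (card P)) ^ (2 * k)"
  proof (intro add_mono mult_left_mono)
    have "card \<D> \<le> (1 + card P) ^ (2 * k)" unfolding \<D>_def by (rule card_subsets_le[OF P(1)])
    then have "real (card \<D>) \<le> real ((1 + card P) ^ (2 * k))" by (simp only: of_nat_le_iff)
    then show "real (card \<D>) \<le> (1 + real (card P)) ^ (2 * k)" by simp
    define \<T> where "\<T> = {D. D \<subseteq> P \<and> card D > 2 * k}"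
    have fin\<T>: "finite \<T>" using P by (simp add: \<T>_def)
    have all: "{D. D \<subseteq> P} = \<D> \<union> \<T>" "\<D> \<inter> \<T> = {}" by (auto simp: \<D>_def \<T>_def)
    have prodD: "(\<Prod>p\<in>D. c * (1 / real p)) = c ^ card D / real (\<Prod>D)" for D and c :: real
      by (simp add: prod_dividef)
    have "\<rho> = (\<Prod>p\<in>P. 1 + (-1) * (1 / real p))" using N by (simp add: \<rho>_def totient_formula2 P_def)
    also have "\<dots> = (\<Sum>D | D \<subseteq> P. (-1) ^ card D / real (\<Prod>D))"
      by (simp only: prod_one_plus_eq_sum_subsets[OF P(1)] prodD)
    also have "\<dots> = (\<Sum>D\<in>\<D>. (-1) ^ card D / real (\<Prod>D)) + (\<Sum>D\<in>\<T>. (-1) ^ card D / real (\<Prod>D))"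
      unfolding all(1) by (rule sum.union_disjoint[OF fin\<D> fin\<T> all(2)])
    finally have "(\<Sum>D\<in>\<D>. (-1) ^ card D / real (\<Prod>D)) = \<rho> - (\<Sum>D\<in>\<T>. (-1) ^ card D / real (\<Prod>D))" by simp
    also have "\<dots> \<le> \<rho> + exp (- s)"
    proof -
      have "\<bar>\<Sum>D\<in>\<T>. (-1) ^ card D / real (\<Prod>D)\<bar> \<le> (\<Sum>D\<in>\<T>. \<bar>(-1) ^ card D / real (\<Prod>D)\<bar>)" by (rule sum_abs)
      also have "\<dots> = (\<Sum>D\<in>\<T>. 1 / real (\<Prod>D))" by (simp add: abs_divide power_abs del: of_nat_prod)
      also have "\<dots> \<le> (\<Sum>D\<in>\<T>. exp (- real (2 * k)) * (exp 1 ^ card D / real (\<Prod>D)))"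
      proof (rule sum_mono)
        fix D assume "D \<in> \<T>"
        then have "1 \<le> exp (real (card D) - real (2 * k))" by (simp add: \<T>_def)
        also have "\<dots> = exp (- real (2 * k)) * exp 1 ^ card D"
          by (simp add: exp_of_nat_mult[symmetric] exp_add[symmetric])
        finally have "1 / real (\<Prod>D) \<le> (exp (- real (2 * k)) * exp 1 ^ card D) / real (\<Prod>D)"
          by (rule divide_right_mono) (simp add: prod_nonneg)
        then show "1 / real (\<Prod>D) \<le> exp (- real (2 * k)) * (exp 1 ^ card D / real (\<Prod>D))" by simp
      qed
      also have "\<dots> \<le> (\<Sum>D | D \<subseteq> P. exp (- real (2 * k)) * (exp 1 ^ card D / real (\<Prod>D)))"
        by (rule sum_mono2) (use P in \<open>auto simp: \<T>_def intro!: mult_nonneg_nonneg divide_nonneg_nonneg prod_nonneg\<close>)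
      also have "\<dots> = exp (- real (2 * k)) * (\<Prod>p\<in>P. 1 + exp 1 * (1 / real p))"
        by (simp only: prod_one_plus_eq_sum_subsets[OF P(1)] prodD sum_distrib_left)
      also have "\<dots> \<le> exp (- real (2 * k)) * (\<Prod>p\<in>P. exp (exp 1 * (1 / real p)))"
        by (intro mult_left_mono prod_mono) (auto intro!: exp_ge_add_one_self add_nonneg_nonneg)
      also have "(\<Prod>p\<in>P. exp (exp 1 * (1 / real p))) = exp (exp 1 * s)"
        unfolding s by (simp add: exp_sum[OF P(1), symmetric] sum_distrib_left)
      \<comment> \<open>Here \<open>k >= 2 * s\<close> enters: with \<open>exp 1 <= 3\<close> the
        exponent is at most \<open>- 4 * s + 3 * s\<close>.\<close>
      also have "exp (- real (2 * k)) * exp (exp 1 * s) \<le> exp (- s)"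
      proof -
        have "exp 1 * s \<le> 3 * s" using s0 e_less_272 by (intro mult_right_mono) auto
        then have "- real (2 * k) + exp 1 * s \<le> - s" using k by (simp add: s_def[symmetric])
        then show ?thesis by (simp add: exp_add[symmetric])
      qed
      finally show ?thesis by linarith
    qed
    finally show "(\<Sum>D\<in>\<D>. (-1) ^ card D / real (\<Prod>D)) \<le> \<rho> + exp (- s)" .
  qed (use H0 in auto)
  \<comment> \<open>\<open>11 = 1 + 9 + 1\<close>: the main term, the truncation error with
    \<open>exp 2 <= 9\<close>, and the rounding errors, which the lower bound on \<open>H\<close>
    makes at most \<open>\<rho> * H\<close>.\<close>
  also have "\<dots> \<le> H * (\<rho> + 9 * \<rho>) + H * \<rho>"
  proof (intro add_mono mult_left_mono)
    have "exp (- s) = (exp 1 * exp 1) * exp (- s - 2)" by (simp add: exp_add[symmetric])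
    also have "exp 1 * exp 1 \<le> (3 * 3 :: real)" using e_less_272 by (intro mult_mono) auto
    then have "(exp 1 * exp 1) * exp (- s - 2) \<le> 9 * \<rho>" using \<rho> by (intro mult_mono) auto
    finally show "exp (- s) \<le> 9 * \<rho>" .
    have "(1 + real (card P)) ^ (2 * k) = exp (- s - 2) * (exp (s + 2) * (1 + real (card P)) ^ (2 * k))"
      by (simp add: mult.assoc[symmetric] exp_add[symmetric])
    also have "\<dots> \<le> \<rho> * H" using \<rho> H by (intro mult_mono) (auto simp: s_def P_def \<rho>_def)
    finally show "(1 + real (card P)) ^ (2 * k) \<le> H * \<rho>" by (simp add: mult.commute)
  qed (use H0 in auto)
  finally show ?thesis by (simp add: \<rho>_def algebra_simps)
qed

section \<open>Counting words\<close>

text \<open>By \<open>num_append_approx\<close> the numerators of these words are integers coprime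
  to \<open>N\<close> on one fixed side of \<open>p * N / q\<close>, at distance
  \<open>num u / q\<close>. A first digit of \<open>u\<close> beyond \<open>b0\<close> makes this
  distance at most \<open>h = N / (q * r)\<close>. The sieve counts such integers with the factor
  \<open>11\<close>, and each belongs to at most two words.\<close>

lemma leaf_card:
  assumes v: "valid v" "den v < N"
    and N: "N \<ge> 1" and k: "2 * recip_sum N \<le> real k"
    and H: "real N / (real (den v) * real ((b0 + 1) * den v + num (rev v)))
      \<ge> exp (recip_sum N + 2) * (1 + real (card (prime_factors N))) ^ (2 * k)"
  shows "real (card {u. v @ u \<in> words N \<and> (u = [] \<or> hd u > b0)})
     \<le> 22 * real (totient N) / (real (den v) * real ((b0 + 1) * den v + num (rev v)))"
proof -
  define q where "q = den v"
  define r where "r = (b0 + 1) * den v + num (rev v)"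
  define h where "h = real N / (real q * real r)"
  have q: "q \<ge> 1" using den_pos[OF v(1)] by (simp add: q_def)
  have r: "r \<ge> 1" using q by (simp add: r_def q_def)
  obtain p e :: int where e: "e = 1 \<or> e = -1"
    and pe0: "\<And>u. int (num (v @ u)) * int (den v) = p * int (den (v @ u)) + e * int (num u)"
    by (rule num_append_approx[of v], rule that)
  note pe = pe0[folded q_def]
  \<comment> \<open>The sign \<open>e\<close> decides whether the interval of length
    \<open>h\<close> starts or ends at \<open>p * N / q\<close>.\<close>
  define \<alpha> where "\<alpha> = (if e = 1 then p * N / q else p * N / q - h)"
  define J where "J = {a::int. \<alpha> \<le> a \<and> a \<le> \<alpha> + h \<and> coprime a (int N)}"
  define U where "U = {u. v @ u \<in> words N \<and> (u = [] \<or> hd u > b0)}"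
  have "J \<subseteq> {\<lceil>\<alpha>\<rceil>..\<lfloor>\<alpha> + h\<rfloor>}" by (auto simp: J_def ceiling_le_iff le_floor_iff)
  then have finJ: "finite J" by (rule finite_subset) simp
  have key: "cf_pair (v @ u) \<in> {N} \<times> nat ` J" if "u \<in> U" for u
  proof -
    have u: "valid u" "den (v @ u) = N" "u = [] \<or> hd u > b0" using that by (auto simp: U_def words_def)
    have "(b0 + 1) * num u \<le> den u"
    proof (cases u)
      case (Cons b u')
      then have "(b0 + 1) * den u' \<le> b * den u'" using u(3) by (intro mult_right_mono) auto
      then show ?thesis using Cons by simp
    qed simp
    then have "q * ((b0 + 1) * num u) \<le> q * den u" by (rule mult_left_mono) simp
    then have "num u * r \<le> N"
      using u(2) by (simp add: den_append den_rev q_def r_def algebra_simps)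
    then have "real (num u) * real r \<le> real N" by (metis of_nat_le_iff of_nat_mult)
    then have "real (num u) \<le> real N / real r" using r by (simp add: field_simps)
    then have zh: "real (num u) / real q \<le> h" using q unfolding h_def
      by (metis (no_types, opaque_lifting) divide_divide_eq_left divide_right_mono mult.commute of_nat_0_le_iff)
    have "real_of_int (int (num (v @ u)) * int q) = real_of_int (p * int N + e * int (num u))"
      using pe[of u] u(2) by simp
    then have "real (num (v @ u)) * q = p * N + e * real (num u)" by simp
    then have eq: "real (num (v @ u)) = p * N / q + e * (real (num u) / real q)"
      using q by (simp add: field_simps)
    have "int (num (v @ u)) \<in> J"
    proof -
      have "coprime (int (num (v @ u))) (int N)"
        using coprime_cf_pair[of "v @ u"] u(2) by (simp add: coprime_commute)
      moreover have "0 \<le> real (num u) / real q" by simp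
      ultimately show ?thesis unfolding J_def \<alpha>_def using eq zh e by auto
    qed
    then have "num (v @ u) \<in> nat ` J" by (metis image_eqI nat_int)
    then show ?thesis using u(2) by (simp add: mem_Times_iff)
  qed
  have "card U = card ((@) v ` U)" by (intro card_image[symmetric]) (auto simp: inj_on_def)
  also have "\<dots> \<le> 2 * card ({N} \<times> nat ` J)"
  proof (rule card_words_le)
    show "valid w" if "w \<in> (@) v ` U" for w using that by (auto simp: U_def words_def)
    show "finite ({N} \<times> nat ` J)" using finJ by simp
    show "cf_pair ` (@) v ` U \<subseteq> {N} \<times> nat ` J" unfolding image_image using key by (intro image_subsetI)
  qed
  also have "card ({N} \<times> nat ` J) \<le> card J" using finJ by (simp add: card_cartesian_product card_image_le)
  finally have "real (card U) \<le> 2 * real (card J)" by simp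
  also have "real (card J) \<le> 11 * (real (totient N) / real N) * h"
    unfolding J_def by (rule sieve_interval[OF N k]) (use H in \<open>simp add: h_def q_def r_def\<close>)
  also have "2 * (11 * (real (totient N) / real N) * h) = 22 * real (totient N) / (real q * real r)"
    using N by (simp add: h_def)
  finally show ?thesis by (simp add: U_def q_def r_def)
qed

text \<open>Two digits at least double the denominator, since
  \<open>a * (b * q + q') + q >= 2 * q\<close>.\<close>

lemma pow2_le_den: "valid u \<Longrightarrow> 2 ^ (length u div 2) \<le> den u"
proof (induction u rule: induct_list012)
  case (3 a b u)
  have "a * (b * den u) \<ge> 1 * (1 * den u)" using 3 by (intro mult_mono) auto
  then have "den (a # b # u) \<ge> 2 * den u" unfolding cf_pair.simps fst_conv snd_conv distrib_left by linarith
  then show ?case using 3 by (simp add: algebra_simps)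
qed auto

section \<open>Digits far from both ends of a word\<close>

lemma den_split:
  assumes "k < length w"
  defines "x \<equiv> den (take k w)" and "x' \<equiv> num (rev (take k w))"
    and "z \<equiv> den (drop (Suc k) w)" and "z' \<equiv> num (drop (Suc k) w)"
  shows "den (take (Suc k) w) = w ! k * x + x'" "den (drop k w) = w ! k * z + z'"
    "den w = x * (w ! k * z + z') + x' * z"
proof -
  have d: "drop k w = w ! k # drop (Suc k) w" using assms by (simp add: Cons_nth_drop_Suc)
  show 1: "den (drop k w) = w ! k * z + z'" by (simp add: d z_def z'_def)
  have "num (drop k w) = z" by (simp add: d z_def)
  with 1 show "den w = x * (w ! k * z + z') + x' * z"
    using den_append[of "take k w" "drop k w"] by (simp add: den_rev x_def x'_def)
  show "den (take (Suc k) w) = w ! k * x + x'"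
    using assms den_append[of "take k w" "[w ! k]"]
    by (simp add: take_Suc_conv_app_nth den_rev x_def x'_def algebra_simps)
qed

text \<open>Both denominators include the digit at position \<open>k\<close> itself, so for valid
  words these are exactly the positions reached neither by \<open>initial_sum\<close> on
  \<open>w\<close> nor by \<open>initial_sum\<close> on \<open>rev w\<close>.\<close>

definition middle :: "real \<Rightarrow> nat list \<Rightarrow> nat set" where
  "middle Q w = {k. k < length w \<and> Q < real (den (take (Suc k) w)) \<and> Q < real (den (drop k w))}"

lemma log2_nonneg: "1 \<le> x \<Longrightarrow> 0 \<le> log 2 x"
  by (subst zero_le_log_cancel_iff) auto

text \<open>Between the first and the last middle position lies a block \<open>u\<close> with
  \<open>Q * den u * Q <= N\<close>, while \<open>den u\<close> is at least
  \<open>2 ^ (length u div 2)\<close>. The two end positions and the rounding in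
  \<open>length u div 2\<close> account for the \<open>3\<close>.\<close>

lemma card_middle:
  assumes w: "w \<in> words N" and Q: "Q > 0" "Q\<^sup>2 \<le> real N"
  shows "real (card (middle Q w)) \<le> 2 * log 2 (real N / Q\<^sup>2) + 3"
proof (cases "middle Q w = {}")
  case True
  have "log 2 (real N / Q\<^sup>2) \<ge> 0" using Q by (intro log2_nonneg) simp
  then show ?thesis using True by simp
next
  case False
  have val: "valid w" and N: "den w = N" using w by (auto simp: words_def)
  have fin: "finite (middle Q w)" by (simp add: middle_def)
  define i where "i = Min (middle Q w)"
  define l where "l = Max (middle Q w)"
  have il: "i \<in> middle Q w" "l \<in> middle Q w" "i \<le> l" using fin False by (auto simp: i_def l_def)
  have "middle Q w \<subseteq> {i..l}" using fin by (auto simp: i_def l_def)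
  then have "card (middle Q w) \<le> Suc l - i" using card_mono[of "{i..l}" "middle Q w"] by simp
  moreover have log0: "log 2 (real N / Q\<^sup>2) \<ge> 0" using Q by (intro log2_nonneg) simp
  moreover have "real (l - (i + 1)) \<le> 2 * log 2 (real N / Q\<^sup>2) + 1" if "i < l"
  proof -
    define u where "u = take (l - (i + 1)) (drop (i + 1) w)"
    have len: "length u = l - (i + 1)" using il that by (auto simp: u_def middle_def)
    have tk: "take l w = take (Suc i) w @ u" using that take_add[of "Suc i" "l - (i + 1)" w] by (simp add: u_def)
    have "den (take (Suc i) w) * 2 ^ (length u div 2) \<le> den (take (Suc i) w) * den u"
      by (intro mult_left_mono pow2_le_den) (auto simp: u_def val valid_take valid_drop)
    also have "\<dots> \<le> den (take l w)" unfolding tk by (simp add: den_append den_rev)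
    finally have a: "den (take (Suc i) w) * 2 ^ (length u div 2) \<le> den (take l w)" .
    have "den (take l w) * den (drop l w) \<le> den w"
      using den_append[of "take l w" "drop l w"] by (simp add: den_rev)
    then have "den (take (Suc i) w) * 2 ^ (length u div 2) * den (drop l w) \<le> N"
      using mult_right_mono[OF a, of "den (drop l w)"] N by linarith
    then have "real (den (take (Suc i) w) * 2 ^ (length u div 2) * den (drop l w)) \<le> real N"
      by (simp only: of_nat_le_iff)
    then have b: "real (den (take (Suc i) w)) * 2 ^ (length u div 2) * real (den (drop l w)) \<le> real N" by simp
    have "Q * 2 ^ (length u div 2) * Q \<le> real (den (take (Suc i) w)) * 2 ^ (length u div 2) * real (den (drop l w))"
      using il Q by (intro mult_mono) (auto simp: middle_def)
    with b have "Q * 2 ^ (length u div 2) * Q \<le> real N" by linarith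
    then have "2 ^ (length u div 2) * Q\<^sup>2 \<le> real N" by (simp add: power2_eq_square mult_ac)
    then have "2 ^ (length u div 2) \<le> real N / Q\<^sup>2" using Q by (simp add: pos_le_divide_eq)
    then have "log 2 (2 ^ (length u div 2)) \<le> log 2 (real N / Q\<^sup>2)" by (intro log_mono) auto
    then have "real (length u div 2) \<le> log 2 (real N / Q\<^sup>2)" by (simp add: log_nat_power)
    moreover have "length u \<le> 2 * (length u div 2) + 1" by linarith
    ultimately show ?thesis using len by linarith
  qed
  ultimately show ?thesis by (cases "i < l") (use il in auto)
qed

lemma card_residue_class:
  fixes A :: "nat set" and d g :: nat
  assumes "d \<ge> 1" "A \<subseteq> {..d * g}" "\<And>a b. a \<in> A \<Longrightarrow> b \<in> A \<Longrightarrow> int d dvd int a - int b"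
  shows "card A \<le> g + 1"
proof -
  have "inj_on (\<lambda>a. a div d) A"
  proof (rule inj_onI)
    fix a b assume ab: "a \<in> A" "b \<in> A" "a div d = b div d"
    have "int a mod int d = int b mod int d" using assms(3)[OF ab(1,2)] by (simp add: mod_eq_dvd_iff)
    then have "a mod d = b mod d" by (metis nat_int zmod_int)
    with ab(3) show "a = b" by (metis div_mult_mod_eq)
  qed
  moreover have "(\<lambda>a. a div d) ` A \<subseteq> {..g}"
  proof (rule image_subsetI)
    fix a assume "a \<in> A"
    then have "a div d \<le> d * g div d" using assms(2) by (intro div_le_mono) auto
    then show "a div d \<in> {..g}" using assms(1) by simp
  qed
  ultimately have "card A \<le> card {..g}" by (intro card_inj_on_le) auto
  then show ?thesis by simp
qed

lemma sum_recip_interval: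
  assumes "1 \<le> n" "n \<le> m" shows "(\<Sum>x=n..m. 1 / real x) \<le> 1 + ln (real m / real n)"
  using assms(2)
proof (induction m rule: dec_induct)
  case (step m)
  have m: "real m > 0" "real n > 0" using step assms by auto
  have "ln (real m / real (Suc m)) \<le> real m / real (Suc m) - 1"
    using m by (intro ln_le_minus_one) auto
  also have "\<dots> = - 1 / real (Suc m)" by (simp add: field_simps)
  finally have "1 / real (Suc m) \<le> ln (real (Suc m)) - ln (real m)" using m by (simp add: ln_div)
  then show ?case using step m by (simp add: ln_div)
qed (use assms in simp)

text \<open>\<open>gcd x N\<close> is one of the common divisors \<open>g\<close> of
  \<open>x\<close> and \<open>N\<close>. After the sums are exchanged, each divisor \<open>g\<close>
  of \<open>N\<close> contributes at most \<open>g * (B div g) <= B\<close>.\<close>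

lemma sum_gcd_le:
  assumes "N \<ge> 1"
  shows "(\<Sum>x=1..B. real (gcd x N)) \<le> real B * real (card {d. d dvd N})"
proof -
  have fin: "finite {d. d dvd N}" using assms by (intro finite_divisors_nat) auto
  have "(\<Sum>x=1..B. real (gcd x N)) \<le> (\<Sum>x=1..B. \<Sum>g | g dvd N. if g dvd x then real g else 0)"
  proof (rule sum_mono)
    fix x assume "x \<in> {1..B}"
    have "(if gcd x N dvd x then real (gcd x N) else 0) \<le> (\<Sum>g | g dvd N. if g dvd x then real g else 0)"
      by (rule member_le_sum) (use fin in auto)
    then show "real (gcd x N) \<le> (\<Sum>g | g dvd N. if g dvd x then real g else 0)" by simp
  qed
  also have "\<dots> = (\<Sum>g | g dvd N. \<Sum>x=1..B. if g dvd x then real g else 0)" by (rule sum.swap)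
  also have "\<dots> \<le> (\<Sum>g | g dvd N. real B)"
  proof (rule sum_mono)
    fix g assume "g \<in> {g. g dvd N}"
    then have g: "g \<ge> 1" using assms by (auto simp: Suc_le_eq intro: gr0I)
    have "{x\<in>{1..B}. g dvd x} \<subseteq> (\<lambda>j. g * j) ` {1..B div g}"
    proof
      fix x assume "x \<in> {x\<in>{1..B}. g dvd x}"
      then obtain j where j: "x = g * j" "1 \<le> x" "x \<le> B" by auto
      then have "j \<ge> 1" "j \<le> B div g" using g by (auto simp: less_eq_div_iff_mult_less_eq mult.commute Suc_le_eq intro: gr0I)
      then show "x \<in> (\<lambda>j. g * j) ` {1..B div g}" using j by auto
    qed
    then have "card {x\<in>{1..B}. g dvd x} \<le> card {1..B div g}"
      by (meson card_image_le card_mono finite_atLeastAtMost finite_imageI order.trans)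
    then have "card {x\<in>{1..B}. g dvd x} * g \<le> B"
      using g by (simp add: less_eq_div_iff_mult_less_eq)
    then have "real (card {x\<in>{1..B}. g dvd x} * g) \<le> real B" by (simp only: of_nat_le_iff)
    then show "(\<Sum>x=1..B. if g dvd x then real g else 0) \<le> real B" by (simp add: sum.If_cases Int_def)
  qed
  finally show ?thesis by (simp add: mult.commute)
qed

section \<open>The number of divisors of \<open>N\<close>\<close>

lemma card_divisors_mult:
  fixes a b :: nat
  assumes "a > 0" "b > 0"
  shows "card {d. d dvd a * b} \<le> card {d. d dvd a} * card {d. d dvd b}"
proof -
  have "{d. d dvd a * b} \<subseteq> (\<lambda>(x, y). x * y) ` ({d. d dvd a} \<times> {d. d dvd b})"
    by (auto simp: image_iff dest!: division_decomp)
  then have "card {d. d dvd a * b} \<le> card ({d. d dvd a} \<times> {d. d dvd b})"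
    using assms by (intro surj_card_le) auto
  then show ?thesis by (simp add: card_cartesian_product)
qed

lemma card_divisors_prime_power: "prime (p::nat) \<Longrightarrow> card {d. d dvd p ^ a} = a + 1"
proof -
  assume p: "prime p"
  then have "{d. d dvd p ^ a} = (\<lambda>i. p ^ i) ` {..a}" by (auto simp: divides_primepow_nat)
  moreover have "inj_on (\<lambda>i. p ^ i) {..a}" using prime_gt_1_nat[OF p] by (auto simp: inj_on_def)
  ultimately show ?thesis by (simp add: card_image)
qed

text \<open>A further prime factor \<open>p >= 5\<close> at most doubles the number of divisors, and
  \<open>2 ^ 9 = 512 <= 625 = 5 ^ 4\<close>. The primes \<open>2\<close> and \<open>3\<close> fail
  \<open>2 ^ 9 <= p ^ 4\<close>.\<close>

lemma card_divisors_rough: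
  fixes n :: nat
  assumes "n > 0" "\<And>p. prime p \<Longrightarrow> p dvd n \<Longrightarrow> p \<ge> 5"
  shows "card {d. d dvd n} ^ 9 \<le> n ^ 4"
  using assms
proof (induction n rule: less_induct)
  case (less n)
  show ?case
  proof (cases "n = 1")
    case False
    then obtain p where p: "prime p" "p dvd n" using prime_factor_nat by blast
    then obtain m where m: "n = p * m" by auto
    have m0: "m > 0" "m < n" using less.prems(1) p(1) m prime_gt_1_nat[OF p(1)] by (auto intro: gr0I)
    have IH: "card {d. d dvd m} ^ 9 \<le> m ^ 4"
      by (rule less.IH) (use m0 less.prems m in auto)
    have "card {d. d dvd n} \<le> 2 * card {d. d dvd m}"
      using card_divisors_mult[of p m] card_divisors_prime_power[OF p(1), of 1] m m0 prime_gt_0_nat[OF p(1)] by simp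
    then have "card {d. d dvd n} ^ 9 \<le> (2 * card {d. d dvd m}) ^ 9" by (rule power_mono) simp
    also have "\<dots> = 512 * card {d. d dvd m} ^ 9" by (simp add: power_mult_distrib)
    also have "\<dots> \<le> 5 ^ 4 * m ^ 4" using IH by (intro mult_mono) auto
    also have "\<dots> \<le> p ^ 4 * m ^ 4" using less.prems(2)[OF p] by (intro mult_right_mono power_mono) auto
    finally show ?thesis by (simp add: m power_mult_distrib)
  qed simp
qed

text \<open>The parts \<open>2 ^ a\<close> and \<open>3 ^ b\<close> have only \<open>a + 1\<close>
  and \<open>b + 1\<close> divisors, each number at most \<open>1 + log 2 N\<close>; the remaining
  factor falls under \<open>card_divisors_rough\<close>. The aim is an exponent below
  \<open>1/2\<close>, since the count has to be small against \<open>Q\<close>.\<close>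

lemma card_divisors_le:
  fixes N :: nat
  assumes "N \<ge> 1"
  shows "real (card {d. d dvd N}) \<le> (1 + log 2 (real N))\<^sup>2 * real N powr (4/9)"
proof -
  have "\<not> is_unit (2::nat)" "\<not> is_unit (3::nat)" by auto
  then obtain N' where N': "N = 2 ^ multiplicity 2 N * N'" "\<not> 2 dvd N'"
    using assms multiplicity_decompose'[of N 2] by (metis not_one_le_zero)
  have "N' \<noteq> 0" using N'(1) assms by (cases "N' = 0") auto
  then obtain M where M: "N' = 3 ^ multiplicity 3 N' * M" "\<not> 3 dvd M"
    using multiplicity_decompose'[of N' 3] \<open>\<not> is_unit (3::nat)\<close> by metis
  have M0: "M > 0" using M(1) \<open>N' \<noteq> 0\<close> by (cases "M = 0") auto
  define a where "a = multiplicity 2 N"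
  define b where "b = multiplicity 3 N'"
  have Neq: "N = 2 ^ a * (3 ^ b * M)" using N' M by (simp add: a_def b_def)
  have pow: "2 ^ a \<le> N" "2 ^ b \<le> N" "M \<le> N"
  proof -
    show "2 ^ a \<le> N" using M0 unfolding Neq by simp
    have "(2::nat) ^ b \<le> 3 ^ b" by (rule power_mono) auto
    also have "\<dots> \<le> N" using M0 unfolding Neq by simp
    finally show "2 ^ b \<le> N" .
    show "M \<le> N" unfolding Neq by simp
  qed
  have lg: "real j \<le> log 2 (real N)" if "2 ^ j \<le> N" for j
  proof -
    have "real (2 ^ j) \<le> real N" using that by (simp only: of_nat_le_iff)
    then have "log 2 (2 ^ j) \<le> log 2 (real N)" using assms by (intro log_mono) auto
    then show ?thesis by (simp add: log_nat_power)
  qed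
  have "p \<ge> 5" if p: "prime p" "p dvd M" for p
  proof (rule ccontr)
    assume "\<not> p \<ge> 5"
    then have "p = 2 \<or> p = 3 \<or> p = 4" using prime_ge_2_nat[OF p(1)] by linarith
    moreover have "\<not> 2 dvd M" using N'(2) M(1) by (metis dvd_mult)
    moreover have "\<not> prime (4::nat)" by (simp add: prime_nat_iff) (auto intro: exI[of _ 2])
    ultimately show False using p M(2) by auto
  qed
  then have "card {d. d dvd M} ^ 9 \<le> M ^ 4" by (intro card_divisors_rough M0)
  also have "\<dots> \<le> N ^ 4" using pow by (intro power_mono) auto
  finally have "real (card {d. d dvd M} ^ 9) \<le> real (N ^ 4)" by (simp only: of_nat_le_iff)
  moreover have "real (N ^ 4) = (real N powr (4/9)) ^ 9"
    using assms by (simp add: powr_power)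
  ultimately have "real (card {d. d dvd M}) ^ 9 \<le> (real N powr (4/9)) ^ 9" by simp
  then have dM: "real (card {d. d dvd M}) \<le> real N powr (4/9)" by (subst (asm) power_mono_iff) auto
  have "card {d. d dvd N} \<le> card {d. d dvd (2::nat) ^ a} * (card {d. d dvd (3::nat) ^ b} * card {d. d dvd M})"
    unfolding Neq using card_divisors_mult[of "2 ^ a" "3 ^ b * M"] card_divisors_mult[of "3 ^ b" M] M0
    by (meson le_trans mult_le_mono2 zero_less_power zero_less_numeral nat_0_less_mult_iff)
  also have "\<dots> = (a + 1) * ((b + 1) * card {d. d dvd M})" by (simp add: card_divisors_prime_power)
  finally have "real (card {d. d dvd N}) \<le> real ((a + 1) * ((b + 1) * card {d. d dvd M}))" by (simp only: of_nat_le_iff)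
  also have "\<dots> = (1 + real a) * ((1 + real b) * real (card {d. d dvd M}))" by (simp add: algebra_simps)
  also have "\<dots> \<le> (1 + log 2 (real N)) * ((1 + log 2 (real N)) * real N powr (4/9))"
    using lg[OF pow(1)] lg[OF pow(2)] dM by (intro mult_mono) auto
  finally show ?thesis by (simp add: power2_eq_square)
qed

text \<open>Cutting a word of denominator \<open>N\<close> at a digit \<open>m\<close> leaves \<open>x, x'\<close> (last two denominators of the
  prefix) and \<open>z, z'\<close> (denominator and numerator of the suffix).\<close>

definition quads :: "nat \<Rightarrow> nat \<Rightarrow> real \<Rightarrow> ((nat \<times> nat) \<times> (nat \<times> nat)) set" where
  "quads N m Q = {((x, x'), (z, z')). N = x * (m * z + z') + x' * z \<and> x' \<le> x \<and> z' \<le> z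
     \<and> coprime x x' \<and> coprime z z' \<and> Q < real (m * x + x') \<and> Q < real (m * z + z') \<and> x \<ge> 1 \<and> z \<ge> 1}"

lemma finite_quads: "m \<ge> 1 \<Longrightarrow> finite (quads N m Q)"
proof (rule finite_subset)
  assume m: "m \<ge> 1"
  show "quads N m Q \<subseteq> ({..N} \<times> {..N}) \<times> ({..N} \<times> {..N})"
  proof
    fix y assume "y \<in> quads N m Q"
    then obtain x x' z z' where y: "y = ((x, x'), (z, z'))" "N = x * (m * z + z') + x' * z" "x' \<le> x" "z' \<le> z"
      "x \<ge> 1" "z \<ge> 1" by (auto simp: quads_def)
    have mz: "1 \<le> m * z" "z \<le> m * z" using m y mult_le_mono[of 1 m 1 z] by auto
    have "x * 1 \<le> x * (m * z + z')" by (rule mult_le_mono2) (use mz in linarith)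
    moreover have "1 * z \<le> x * (m * z + z')" by (rule mult_le_mono) (use y mz in linarith)+
    ultimately have "x \<le> N" "z \<le> N" using y(2) by linarith+
    then show "y \<in> ({..N} \<times> {..N}) \<times> ({..N} \<times> {..N})" using y by auto
  qed
qed simp

text \<open>A quadruple determines the prefix and the suffix once the parities of their lengths are
  known, which leaves four choices.\<close>

lemma card_mid_pairs_le_quads:
  assumes m: "m \<ge> 1"
  shows "card {(w, k). w \<in> words N \<and> k \<in> middle Q w \<and> w ! k = m} \<le> 4 * card (quads N m Q)"
proof -
  define S where "S = {(w, k). w \<in> words N \<and> k \<in> middle Q w \<and> w ! k = m}"
  define h where "h = (\<lambda>(w, k). ((cf_pair (rev (take k w)), cf_pair (drop (Suc k) w)), (even k, even (length w - Suc k)) :: bool \<times> bool))"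
  have inj: "inj_on h S"
  proof (rule inj_onI)
    fix y y' assume y: "y \<in> S" "y' \<in> S" "h y = h y'"
    obtain w k w' k' where wk: "y = (w, k)" "y' = (w', k')" by (cases y, cases y')
    have w: "valid w" "k < length w" "w ! k = m" and w': "valid w'" "k' < length w'" "w' ! k' = m"
      using y wk by (auto simp: S_def words_def middle_def)
    have "rev (take k w) = rev (take k' w')"
      by (rule cf_pair_inj_parity) (use y wk w w' in \<open>auto simp: h_def valid_take\<close>)
    moreover have "drop (Suc k) w = drop (Suc k') w'"
      by (rule cf_pair_inj_parity) (use y wk w w' in \<open>auto simp: h_def valid_drop\<close>)
    ultimately have t: "take k w = take k' w'" and d: "drop (Suc k) w = drop (Suc k') w'" by auto
    have "k = length (take k w)" "k' = length (take k' w')" using w w' by auto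
    then have "k = k'" using t by simp
    moreover have "w = take k w @ w ! k # drop (Suc k) w" "w' = take k' w' @ w' ! k' # drop (Suc k') w'"
      by (rule id_take_nth_drop, rule w w')+
    then have "w = w'" using t d w(3) w'(3) by metis
    ultimately show "y = y'" by (simp add: wk)
  qed
  have "h ` S \<subseteq> quads N m Q \<times> UNIV"
  proof (rule image_subsetI)
    fix y assume "y \<in> S"
    then obtain w k where y: "y = (w, k)" and w: "valid w" "den w = N" "k < length w" "w ! k = m"
        "Q < real (den (take (Suc k) w))" "Q < real (den (drop k w))"
      by (auto simp: S_def words_def middle_def)
    note sp = den_split[OF w(3)]
    have v1: "valid (rev (take k w))" "valid (drop (Suc k) w)" using w by (auto simp: valid_take valid_drop)
    have "((den (rev (take k w)), num (rev (take k w))), (den (drop (Suc k) w), num (drop (Suc k) w))) \<in> quads N m Q"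
      unfolding quads_def using num_le_den[OF v1(1)] num_le_den[OF v1(2)] den_pos[OF v1(1)] den_pos[OF v1(2)]
        coprime_cf_pair[of "rev (take k w)"] coprime_cf_pair[of "drop (Suc k) w"] sp w(2,4,5,6) by (simp add: den_rev case_prod_beta)
    then show "h y \<in> quads N m Q \<times> UNIV" by (simp add: h_def y)
  qed
  then have "card S \<le> card (quads N m Q \<times> (UNIV :: (bool \<times> bool) set))"
    using finite_quads[OF m] by (intro card_inj_on_le[OF inj]) auto
  also have "\<dots> = card (quads N m Q) * 4"
    by (simp add: card_cartesian_product UNIV_Times_UNIV[symmetric] del: UNIV_Times_UNIV)
  finally show ?thesis by (simp add: S_def)
qed

lemma card_multiples_between:
  assumes g: "g \<ge> 1" and ab: "\<alpha> \<le> \<beta>"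
  shows "real (card {z::nat. g dvd z \<and> \<alpha> \<le> real z \<and> real z \<le> \<beta>}) \<le> (\<beta> - \<alpha>) / real g + 1"
proof -
  have inj: "inj_on int {z::nat. g dvd z \<and> \<alpha> \<le> real z \<and> real z \<le> \<beta>}" by auto
  have "{a::int. \<alpha> \<le> a \<and> a \<le> \<alpha> + (\<beta> - \<alpha>) \<and> int g dvd a} \<subseteq> {\<lceil>\<alpha>\<rceil>..\<lfloor>\<beta>\<rfloor>}"
    by (auto simp: ceiling_le_iff le_floor_iff)
  then have fin: "finite {a::int. \<alpha> \<le> a \<and> a \<le> \<alpha> + (\<beta> - \<alpha>) \<and> int g dvd a}" by (rule finite_subset) simp
  have "card {z::nat. g dvd z \<and> \<alpha> \<le> real z \<and> real z \<le> \<beta>}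
      \<le> card {a::int. \<alpha> \<le> a \<and> a \<le> \<alpha> + (\<beta> - \<alpha>) \<and> int g dvd a}"
    by (rule card_inj_on_le[OF inj _ fin]) auto
  then show ?thesis using card_multiples_interval[OF _ g, of "\<beta> - \<alpha>" \<alpha>] ab by linarith
qed

text \<open>Given \<open>x\<close>, the coprimality conditions force \<open>gcd x z = gcd x N\<close>; this is what keeps the
  count free of arithmetic factors of \<open>N\<close> in the main term.\<close>

lemma card_quads_le:
  assumes m: "m \<ge> 1" and Q: "Q > 0" and N: "N \<ge> 1"
  shows "real (card (quads N m Q)) \<le>
    (\<Sum>x | x \<ge> 1 \<and> Q < real ((m + 1) * x) \<and> real x \<le> 2 * real N / Q.
        4 * real N / ((real m)\<^sup>2 * real x) + 2 * real (gcd x N))"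
proof -
  define X where "X = {x::nat. x \<ge> 1 \<and> Q < real ((m + 1) * x) \<and> real x \<le> 2 * real N / Q}"
  define Z where "Z = (\<lambda>x. {z::nat. gcd x N dvd z \<and> real N / (real (m + 2) * real x) \<le> real z
      \<and> real z \<le> real N / (real m * real x)})"
  define Y where "Y = (\<lambda>x z. {x'. \<exists>z'. ((x, x'), (z, z')) \<in> quads N m Q})"
  have finX: "finite X"
  proof (rule finite_subset)
    show "X \<subseteq> {..nat \<lfloor>2 * real N / Q\<rfloor>}" by (auto simp: X_def le_nat_floor)
  qed simp
  have finZ: "finite (Z x)" for x
  proof (rule finite_subset)
    show "Z x \<subseteq> {..nat \<lfloor>real N / (real m * real x)\<rfloor>}" by (auto simp: Z_def le_nat_floor)
  qed simp
  have finY: "finite (Y x z)" for x z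
  proof (rule finite_subset)
    show "Y x z \<subseteq> {..x}" by (auto simp: Y_def quads_def)
  qed simp
  \<comment> \<open>For fixed \<open>x\<close> and \<open>z\<close> the number \<open>x'\<close> is
    determined modulo \<open>x div gcd x z\<close> and lies in \<open>{0..x}\<close>, so there are
    at most \<open>gcd x z + 1\<close> choices.\<close>
  have cardY: "card (Y x z) \<le> 2 * gcd x N" for x z
  proof (cases "Y x z = {}")
    case False
    then obtain x0 z0 where q0: "((x, x0), (z, z0)) \<in> quads N m Q" by (auto simp: Y_def)
    define g where "g = gcd x z"
    have xz: "x \<ge> 1" "z \<ge> 1" "coprime x x0" and Neq: "N = x * (m * z + z0) + x0 * z"
      using q0 by (auto simp: quads_def)
    have g: "g \<ge> 1" using xz by (simp add: g_def Suc_le_eq)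
    have "g dvd N" unfolding Neq g_def by simp
    then have "g dvd gcd x N" by (simp add: g_def)
    then have gle: "g \<le> gcd x N" using N by (intro dvd_imp_le) auto
    define d where "d = x div g"
    have x: "x = d * g" by (simp add: d_def g_def)
    then have d: "d \<ge> 1" using xz by (cases "d = 0") auto
    have "card (Y x z) \<le> g + 1"
    proof (rule card_residue_class[OF d])
      show "Y x z \<subseteq> {..d * g}" unfolding x[symmetric] by (auto simp: Y_def quads_def)
      have Y: "\<exists>z'. N = x * (m * z + z') + a * z" if "a \<in> Y x z" for a
        using that by (auto simp: Y_def quads_def)
      fix a b assume "a \<in> Y x z" "b \<in> Y x z"
      with Y obtain za zb where e: "N = x * (m * z + za) + a * z" "N = x * (m * z + zb) + b * z"
        by meson
      have "int (x * (m * z + za) + a * z) = int (x * (m * z + zb) + b * z)" using e by simp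
      then have "(int a - int b) * int z = int x * (int zb - int za)" by (simp add: algebra_simps)
      then have "int x dvd (int a - int b) * int z" by simp
      then have "int d * int g dvd (int a - int b) * (int (z div g) * int g)"
        using x by (metis dvd_div_mult_self g_def gcd_dvd2 of_nat_mult)
      then have "int d dvd (int a - int b) * int (z div g)"
        using g by (simp add: mult.assoc[symmetric])
      moreover have "coprime d (z div g)"
        unfolding d_def g_def by (rule div_gcd_coprime) (use xz in auto)
      then have "coprime (int d) (int (z div g))" by simp
      ultimately show "int d dvd int a - int b" by (simp add: coprime_dvd_mult_left_iff)
    qed
    then show ?thesis using g gle by linarith
  qed simp
  \<comment> \<open>The interval for \<open>z\<close> expresses
    \<open>m * x * z <= N <= (m + 2) * x * z\<close>. The divisor \<open>gcd x N\<close> gained here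
    cancels the factor \<open>gcd x N\<close> of \<open>cardY\<close> in the main term.\<close>
  have cardZ: "real (card (Z x)) \<le> 2 * real N / ((real m)\<^sup>2 * real x * real (gcd x N)) + 1" if "x \<in> X" for x
  proof -
    have x: "real x > 0" "real m > 0" using that m by (auto simp: X_def)
    have g: "gcd x N \<ge> 1" using N by (simp add: Suc_le_eq)
    have mm: "real m * real x \<le> real (m + 2) * real x" by (intro mult_right_mono) auto
    have "real N / (real (m + 2) * real x) \<le> real N / (real m * real x)"
      using x mm by (intro divide_left_mono) auto
    from card_multiples_between[OF g this]
    have "real (card (Z x)) \<le> (real N / (real m * real x) - real N / (real (m + 2) * real x)) / real (gcd x N) + 1"
      by (simp add: Z_def)
    also have "real N / (real m * real x) - real N / (real (m + 2) * real x) = 2 * real N / (real m * real (m + 2) * real x)"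
    proof -
      have "n / (a * x) - n / (b * x) = (b - a) * n / (a * b * x)" if "a > 0" "b > 0" "x > 0" for n a b x :: real
        using that by (simp add: field_simps)
      from this[of "real m" "real (m + 2)" "real x" "real N"] show ?thesis using x by simp
    qed
    also have "\<dots> \<le> 2 * real N / ((real m)\<^sup>2 * real x)"
      using x unfolding power2_eq_square by (intro divide_left_mono mult_right_mono mult_left_mono) auto
    finally show ?thesis by (simp add: divide_right_mono)
  qed
  define R where "R = Sigma X (\<lambda>x. Sigma (Z x) (\<lambda>z. Y x z))"
  have finR: "finite R" unfolding R_def using finX finZ finY by (intro finite_SigmaI) auto
  define pr where "pr = (\<lambda>((x::nat, x'::nat), (z::nat, z'::nat)). (x, (z, x')))"
  have inj: "inj_on pr (quads N m Q)"
  proof (rule inj_onI)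
    fix y y' assume y: "y \<in> quads N m Q" "y' \<in> quads N m Q" "pr y = pr y'"
    obtain x x' z z' where 1: "y = ((x, x'), (z, z'))" by (metis prod.exhaust)
    obtain u u' v v' where 2: "y' = ((u, u'), (v, v'))" by (metis prod.exhaust)
    have eq: "u = x" "v = z" "u' = x'" using y(3) by (auto simp: 1 2 pr_def)
    have "N = x * (m * z + z') + x' * z" "N = x * (m * z + v') + x' * z" "x \<ge> 1"
      using y 1 2 eq by (auto simp: quads_def)
    then have "z' = v'" by simp
    then show "y = y'" using 1 2 eq by simp
  qed
  have "pr ` quads N m Q \<subseteq> R"
  proof (rule image_subsetI)
    fix y assume yq: "y \<in> quads N m Q"
    then obtain x x' z z' where y: "y = ((x, x'), (z, z'))" "N = x * (m * z + z') + x' * z" "x' \<le> x" "z' \<le> z"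
      "coprime x x'" "Q < real (m * x + x')" "Q < real (m * z + z')" "x \<ge> 1" "z \<ge> 1"
      by (auto simp: quads_def)
    have Nr: "real N = real m * real x * real z + real x * real z' + real x' * real z"
      unfolding y(2) by (simp add: algebra_simps)
    have r: "real x \<ge> 1" "real z \<ge> 1" "real m \<ge> 1" "real x' \<le> real x" "real z' \<le> real z" using y m by auto
    have lo: "real m * real x * real z \<le> real N" using Nr by simp
    have "real x * real z' \<le> real x * real z" "real x' * real z \<le> real x * real z"
      using r by (auto intro: mult_mono)
    then have hi: "real N \<le> real (m + 2) * real x * real z" using Nr by (simp add: algebra_simps)
    have "m * x + x' \<le> (m + 1) * x" using y(3) by (simp add: algebra_simps)
    then have Qx: "Q < real ((m + 1) * x)" using y(6) by linarith
    have "m * z + z' \<le> 2 * m * z" using y(4) m mult_le_mono1[OF m, of z] by linarith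
    then have "Q < real (2 * m * z)" using y(7) by linarith
    then have "Q * real x \<le> real (2 * m * z) * real x" using r by (intro mult_right_mono) auto
    also have "\<dots> \<le> 2 * real N" using lo by (simp add: mult_ac)
    finally have xN: "real x \<le> 2 * real N / Q" using Q by (simp add: field_simps)
    have xX: "x \<in> X" using y(8) Qx xN by (simp add: X_def)
    have zZ: "z \<in> Z x"
    proof -
      define g where "g = gcd x N"
      have "g dvd x * (m * z + z') + x' * z" "g dvd x * (m * z + z')" unfolding y(2)[symmetric] by (auto simp: g_def)
      then have "g dvd x' * z" by (simp add: dvd_add_right_iff)
      moreover have "coprime g x'" unfolding g_def using y(5) by (meson coprime_divisors dvd_refl gcd_dvd1)
      ultimately have "g dvd z" by (simp add: coprime_dvd_mult_right_iff)
      moreover have "real N / (real (m + 2) * real x) \<le> real z"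
      proof (subst pos_divide_le_eq)
        show "0 < real (m + 2) * real x" using r by simp
        show "real N \<le> real z * (real (m + 2) * real x)" using hi by (simp only: mult_ac)
      qed
      moreover have "real z \<le> real N / (real m * real x)" using lo r by (simp add: field_simps)
      ultimately show ?thesis by (simp add: Z_def g_def)
    qed
    have "x' \<in> Y x z" using yq unfolding y(1) Y_def by blast
    then show "pr y \<in> R" using xX zZ by (simp add: pr_def y(1) R_def)
  qed
  then have "card (quads N m Q) \<le> card R" by (rule card_inj_on_le[OF inj _ finR])
  also have "card R = (\<Sum>x\<in>X. \<Sum>z\<in>Z x. card (Y x z))"
    unfolding R_def using finX finZ finY by (simp add: card_SigmaI finite_SigmaI)
  also have "\<dots> \<le> (\<Sum>x\<in>X. \<Sum>z\<in>Z x. 2 * gcd x N)" by (intro sum_mono cardY)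
  finally have "real (card (quads N m Q)) \<le> real (\<Sum>x\<in>X. \<Sum>z\<in>Z x. 2 * gcd x N)" by (simp only: of_nat_le_iff)
  also have "\<dots> = (\<Sum>x\<in>X. real (card (Z x)) * (2 * real (gcd x N)))" by simp
  also have "\<dots> \<le> (\<Sum>x\<in>X. 4 * real N / ((real m)\<^sup>2 * real x) + 2 * real (gcd x N))"
  proof (rule sum_mono)
    fix x assume x: "x \<in> X"
    have g: "real (gcd x N) > 0" using N by simp
    have "real (card (Z x)) * (2 * real (gcd x N))
      \<le> (2 * real N / ((real m)\<^sup>2 * real x * real (gcd x N)) + 1) * (2 * real (gcd x N))"
      using cardZ[OF x] by (rule mult_right_mono) simp
    also have "\<dots> = 4 * real N / ((real m)\<^sup>2 * real x) + 2 * real (gcd x N)"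
      using g by (simp add: algebra_simps)
    finally show "real (card (Z x)) * (2 * real (gcd x N)) \<le> 4 * real N / ((real m)\<^sup>2 * real x) + 2 * real (gcd x N)" .
  qed
  finally show ?thesis by (simp add: X_def)
qed

text \<open>The two conditions involving \<open>Q\<close> confine \<open>x\<close> between
  \<open>Q / (m + 1)\<close> and \<open>2 * N / Q\<close>. So the harmonic sum produces the
  logarithm of \<open>2 * N * (m + 1) / Q^2\<close>, which is small for \<open>Q\<close> near the
  square root of \<open>N\<close>. The divisor hypothesis absorbs the sum of \<open>gcd x N\<close>
  into the main term.\<close>

lemma card_quads_bound:
  assumes m: "m \<ge> 1" and Q: "Q > 0" "Q\<^sup>2 \<le> real N" and N: "N \<ge> 1"
    and dN: "(real m)\<^sup>2 * real (card {d. d dvd N}) \<le> Q"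
  shows "real (card (quads N m Q)) \<le> real N / (real m)\<^sup>2 * (8 + 4 * ln (2 * real N * (real m + 1) / Q\<^sup>2))"
proof -
  define X where "X = {x::nat. x \<ge> 1 \<and> Q < real ((m + 1) * x) \<and> real x \<le> 2 * real N / Q}"
  define B where "B = nat \<lfloor>2 * real N / Q\<rfloor>"
  have XB: "X \<subseteq> {1..B}" by (auto simp: X_def B_def le_nat_floor)
  then have finX: "finite X" by (rule finite_subset) simp
  have B: "real B \<le> 2 * real N / Q" using Q N by (simp add: B_def)
  have m0: "real m > 0" using m by simp
  have "1 \<le> 2 * real N * (real m + 1) / Q\<^sup>2"
  proof -
    have "Q\<^sup>2 \<le> real N * 1" using Q by simp
    also have "\<dots> \<le> real N * (2 * (real m + 1))" by (intro mult_left_mono) auto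
    finally show ?thesis using Q by (simp add: mult_ac)
  qed
  then have ln0: "ln (2 * real N * (real m + 1) / Q\<^sup>2) \<ge> 0" by (rule ln_ge_zero)
  have s1: "(\<Sum>x\<in>X. 1 / real x) \<le> 1 + ln (2 * real N * (real m + 1) / Q\<^sup>2)"
  proof (cases "X = {}")
    case False
    define n where "n = Min X"
    have n: "n \<in> X" using finX False by (simp add: n_def)
    then have nB: "1 \<le> n" "n \<le> B" using XB by auto
    have "X \<subseteq> {n..B}" using finX XB by (auto simp: n_def)
    then have "(\<Sum>x\<in>X. 1 / real x) \<le> (\<Sum>x=n..B. 1 / real x)" by (intro sum_mono2) auto
    also have "\<dots> \<le> 1 + ln (real B / real n)" by (rule sum_recip_interval[OF nB])
    also have "ln (real B / real n) \<le> ln (2 * real N * (real m + 1) / Q\<^sup>2)"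
    proof (rule ln_mono)
      have "Q \<le> (real m + 1) * real n" using n by (simp add: X_def algebra_simps)
      then have "1 / real n \<le> (real m + 1) / Q" using nB Q by (simp add: field_simps)
      then have "real B * (1 / real n) \<le> 2 * real N / Q * ((real m + 1) / Q)"
        using B Q by (intro mult_mono) auto
      then show "real B / real n \<le> 2 * real N * (real m + 1) / Q\<^sup>2" by (simp add: power2_eq_square)
    qed (use nB in auto)
    finally show ?thesis by simp
  qed (use ln0 in simp)
  have s2: "(\<Sum>x\<in>X. real (gcd x N)) \<le> 2 * real N / (real m)\<^sup>2"
  proof -
    have "(\<Sum>x\<in>X. real (gcd x N)) \<le> (\<Sum>x=1..B. real (gcd x N))" using XB by (intro sum_mono2) auto
    also have "\<dots> \<le> real B * real (card {d. d dvd N})" by (rule sum_gcd_le[OF N])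
    also have "\<dots> \<le> 2 * real N / Q * (Q / (real m)\<^sup>2)"
      using B dN m0 Q by (intro mult_mono) (auto simp: field_simps)
    also have "\<dots> = 2 * real N / (real m)\<^sup>2" using Q by simp
    finally show ?thesis .
  qed
  have "real (card (quads N m Q)) \<le> (\<Sum>x\<in>X. 4 * real N / ((real m)\<^sup>2 * real x) + 2 * real (gcd x N))"
    unfolding X_def by (rule card_quads_le[OF m Q(1) N])
  also have "\<dots> = 4 * real N / (real m)\<^sup>2 * (\<Sum>x\<in>X. 1 / real x) + 2 * (\<Sum>x\<in>X. real (gcd x N))"
    by (simp add: sum.distrib sum_distrib_left)
  also have "\<dots> \<le> 4 * real N / (real m)\<^sup>2 * (1 + ln (2 * real N * (real m + 1) / Q\<^sup>2)) + 2 * (2 * real N / (real m)\<^sup>2)"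
    using s1 s2 by (intro add_mono mult_left_mono) auto
  also have "\<dots> = real N / (real m)\<^sup>2 * (8 + 4 * ln (2 * real N * (real m + 1) / Q\<^sup>2))"
    using m0 by (simp add: field_simps)
  finally show ?thesis .
qed

section \<open>The variance\<close>

text \<open>Cauchy-Schwarz over the few middle positions costs the factor of
  \<open>card_middle\<close>. The remaining squares are sorted by the value \<open>m\<close> of the
  digit, and \<open>card_quads_bound\<close> supplies the weight \<open>1 / m^2\<close> that turns
  them into \<open>sqsum f n\<close>.\<close>

lemma mid_second_moment:
  fixes f :: "nat \<Rightarrow> real"
  assumes Q: "Q > 0" "Q\<^sup>2 \<le> real N" and N: "N \<ge> 1"
    and f: "\<And>b. b > n \<Longrightarrow> f b = 0"
    and dN: "(real n)\<^sup>2 * real (card {d. d dvd N}) \<le> Q"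
  shows "(\<Sum>w\<in>words N. (\<Sum>k\<in>middle Q w. f (w ! k))\<^sup>2)
    \<le> (2 * log 2 (real N / Q\<^sup>2) + 3) * (4 * real N * (8 + 4 * ln (2 * real N * (real n + 1) / Q\<^sup>2)))
        * sqsum f n"
proof -
  define c where "c = 2 * log 2 (real N / Q\<^sup>2) + 3"
  have c0: "c \<ge> 0" using log2_nonneg[of "real N / Q\<^sup>2"] Q by (simp add: c_def)
  define P where "P = (\<lambda>m. {(w, k). w \<in> words N \<and> k \<in> middle Q w \<and> w ! k = m})"
  have finK: "finite (middle Q w)" for w by (simp add: middle_def)
  have cs: "(\<Sum>k\<in>middle Q w. f (w ! k))\<^sup>2 \<le> c * (\<Sum>k\<in>middle Q w. (f (w ! k))\<^sup>2)" if w: "w \<in> words N" for w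
  proof -
    have "(\<Sum>k\<in>middle Q w. 1 * f (w ! k))\<^sup>2 \<le> (\<Sum>k\<in>middle Q w. 1\<^sup>2) * (\<Sum>k\<in>middle Q w. (f (w ! k))\<^sup>2)"
      by (rule Cauchy_Schwarz_ineq_sum)
    also have "\<dots> \<le> c * (\<Sum>k\<in>middle Q w. (f (w ! k))\<^sup>2)"
      using card_middle[OF w Q] by (intro mult_right_mono sum_nonneg) (auto simp: c_def)
    finally show ?thesis by simp
  qed
  have expand: "(f (w ! k))\<^sup>2 = (\<Sum>m=1..n. if w ! k = m then (f m)\<^sup>2 else 0)"
    if "w \<in> words N" "k \<in> middle Q w" for w k
  proof -
    have "w ! k \<in> set w" using that by (auto simp: middle_def)
    then have "w ! k \<ge> 1" using that by (auto simp: words_def valid_def)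
    then show ?thesis using f[of "w ! k"] by (simp add: sum.delta)
  qed
  have PS: "P m = Sigma (words N) (\<lambda>w. {k \<in> middle Q w. w ! k = m})" for m by (auto simp: P_def)
  have "(\<Sum>w\<in>words N. \<Sum>k\<in>middle Q w. (f (w ! k))\<^sup>2)
      = (\<Sum>w\<in>words N. \<Sum>k\<in>middle Q w. \<Sum>m=1..n. if w ! k = m then (f m)\<^sup>2 else 0)"
    using expand by (intro sum.cong refl) auto
  also have "\<dots> = (\<Sum>w\<in>words N. \<Sum>m=1..n. \<Sum>k\<in>middle Q w. if w ! k = m then (f m)\<^sup>2 else 0)"
    by (intro sum.cong refl sum.swap)
  also have "\<dots> = (\<Sum>m=1..n. \<Sum>w\<in>words N. \<Sum>k\<in>middle Q w. if w ! k = m then (f m)\<^sup>2 else 0)"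
    by (rule sum.swap)
  also have "\<dots> = (\<Sum>m=1..n. (f m)\<^sup>2 * real (card (P m)))"
    unfolding PS using finK
    by (intro sum.cong refl) (simp add: card_SigmaI sum.If_cases Int_def sum_distrib_left mult.commute)
  also have "\<dots> \<le> (\<Sum>m=1..n. (f m)\<^sup>2 * (4 * (real N / (real m)\<^sup>2 * (8 + 4 * ln (2 * real N * (real n + 1) / Q\<^sup>2)))))"
  proof (rule sum_mono, rule mult_left_mono)
    fix m assume m: "m \<in> {1..n}"
    have "(real m)\<^sup>2 * real (card {d. d dvd N}) \<le> (real n)\<^sup>2 * real (card {d. d dvd N})"
      using m by (intro mult_right_mono power_mono) auto
    with dN have "(real m)\<^sup>2 * real (card {d. d dvd N}) \<le> Q" by linarith
    then have "real (card (quads N m Q)) \<le> real N / (real m)\<^sup>2 * (8 + 4 * ln (2 * real N * (real m + 1) / Q\<^sup>2))"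
      using m by (intro card_quads_bound Q N) auto
    also have "\<dots> \<le> real N / (real m)\<^sup>2 * (8 + 4 * ln (2 * real N * (real n + 1) / Q\<^sup>2))"
      using m N Q by (intro mult_left_mono add_left_mono ln_mono divide_right_mono mult_pos_pos divide_pos_pos) auto
    finally have "real (card (quads N m Q)) \<le> real N / (real m)\<^sup>2 * (8 + 4 * ln (2 * real N * (real n + 1) / Q\<^sup>2))" .
    moreover have "real (card (P m)) \<le> 4 * real (card (quads N m Q))"
      using card_mid_pairs_le_quads[of m N Q] m unfolding P_def by simp
    ultimately show "real (card (P m)) \<le> 4 * (real N / (real m)\<^sup>2 * (8 + 4 * ln (2 * real N * (real n + 1) / Q\<^sup>2)))"
      by linarith
  qed auto
  also have "\<dots> = (4 * real N * (8 + 4 * ln (2 * real N * (real n + 1) / Q\<^sup>2))) * sqsum f n"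
  proof -
    have "(f m)\<^sup>2 * (4 * (real N / (real m)\<^sup>2 * G)) = 4 * real N * G * ((f m)\<^sup>2 / (real m)\<^sup>2)" for m G
      by simp
    then show ?thesis by (simp only: sum_distrib_left)
  qed
  finally have main: "(\<Sum>w\<in>words N. \<Sum>k\<in>middle Q w. (f (w ! k))\<^sup>2)
     \<le> (4 * real N * (8 + 4 * ln (2 * real N * (real n + 1) / Q\<^sup>2))) * sqsum f n" .
  have "(\<Sum>w\<in>words N. (\<Sum>k\<in>middle Q w. f (w ! k))\<^sup>2) \<le> (\<Sum>w\<in>words N. c * (\<Sum>k\<in>middle Q w. (f (w ! k))\<^sup>2))"
    by (intro sum_mono cs)
  also have "\<dots> = c * (\<Sum>w\<in>words N. \<Sum>k\<in>middle Q w. (f (w ! k))\<^sup>2)" by (simp add: sum_distrib_left)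
  also have "\<dots> \<le> c * ((4 * real N * (8 + 4 * ln (2 * real N * (real n + 1) / Q\<^sup>2))) * sqsum f n)"
    by (rule mult_left_mono[OF main c0])
  finally show ?thesis by (simp only: c_def mult.assoc)
qed

text \<open>No digit is counted from both ends: the denominators of the prefix and the suffix that
  share it have a product of at least \<open>N\<close>, which exceeds \<open>Q^2\<close>.\<close>

lemma digit_sum_split:
  fixes f :: "nat \<Rightarrow> real"
  assumes w: "w \<in> words N" and Q: "Q > 0" "Q\<^sup>2 < real N"
  shows "(\<Sum>k<length w. f (w ! k)) = initial_sum Q f 1 0 w + initial_sum Q f 1 0 (rev w) + (\<Sum>k\<in>middle Q w. f (w ! k))"
proof -
  have val: "valid w" and N: "den w = N" using w by (auto simp: words_def)
  let ?a = "\<lambda>k. if real (den (take (Suc k) w)) \<le> Q then f (w ! k) else 0"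
  let ?b = "\<lambda>k. if real (den (drop k w)) \<le> Q then f (w ! k) else 0"
  let ?m = "\<lambda>k. if Q < real (den (take (Suc k) w)) \<and> Q < real (den (drop k w)) then f (w ! k) else 0"
  have 1: "initial_sum Q f 1 0 w = (\<Sum>k<length w. ?a k)"
    using initial_sum_eq[of "[]" w Q f] val by simp
  have "initial_sum Q f 1 0 (rev w) = (\<Sum>k<length w. if real (den (take (Suc k) (rev w))) \<le> Q then f (rev w ! k) else 0)"
    using initial_sum_eq[of "[]" "rev w" Q f] val by simp
  also have "\<dots> = (\<Sum>k<length w. ?b k)"
  proof (rule sum.reindex_bij_witness[of _ "\<lambda>k. length w - Suc k" "\<lambda>k. length w - Suc k"])
    fix k assume k: "k \<in> {..<length w}"
    then have t: "take (Suc k) (rev w) = rev (drop (length w - Suc k) w)" by (simp add: take_rev)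
    show "?b (length w - Suc k) = (if real (den (take (Suc k) (rev w))) \<le> Q then f (rev w ! k) else 0)"
      using k unfolding t den_rev by (simp add: rev_nth)
  qed auto
  finally have 2: "initial_sum Q f 1 0 (rev w) = (\<Sum>k<length w. ?b k)" .
  have 3: "(\<Sum>k\<in>middle Q w. f (w ! k)) = (\<Sum>k<length w. ?m k)"
    unfolding middle_def by (simp add: sum.If_cases Int_def lessThan_def)
  have "f (w ! k) = ?a k + ?b k + ?m k" if k: "k < length w" for k
  proof -
    have "\<not> (real (den (take (Suc k) w)) \<le> Q \<and> real (den (drop k w)) \<le> Q)"
    proof
      assume le: "real (den (take (Suc k) w)) \<le> Q \<and> real (den (drop k w)) \<le> Q"
      have "w ! k \<ge> 1" using val k by (auto simp: valid_def)
      note sp = den_split[OF k]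
      define x where "x = den (take k w)"
      define x' where "x' = num (rev (take k w))"
      define z where "z = den (drop (Suc k) w)"
      define y where "y = den (drop k w)"
      note sp = sp[folded x_def x'_def z_def y_def]
      have "1 * z \<le> w ! k * z" using \<open>w ! k \<ge> 1\<close> by (intro mult_right_mono) auto
      then have zy: "z \<le> y" using sp(2) by linarith
      have "N = x * y + x' * z" using sp N by simp
      also have "\<dots> \<le> (w ! k * x) * y + x' * y"
        using \<open>w ! k \<ge> 1\<close> zy by (intro add_mono mult_mono) auto
      also have "\<dots> = den (take (Suc k) w) * y" using sp(1) by (simp add: algebra_simps)
      finally have "real N \<le> real (den (take (Suc k) w) * y)" by (simp only: of_nat_le_iff)
      also have "\<dots> \<le> Q * Q" using le Q unfolding of_nat_mult y_def by (intro mult_mono) auto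
      finally show False using Q by (simp add: power2_eq_square)
    qed
    then show ?thesis by auto
  qed
  then have "(\<Sum>k<length w. f (w ! k)) = (\<Sum>k<length w. ?a k + ?b k + ?m k)" by (intro sum.cong) auto
  then show ?thesis by (simp only: 1 2 3 sum.distrib)
qed

section \<open>From the variance over reduced fractions to a second moment over words\<close>

lemma canonical_cf_words:
  assumes N: "N \<ge> 2" and a: "a \<in> totatives N"
  shows "canonical_cf (real a / real N) \<in> words N" "num (canonical_cf (real a / real N)) = a"
proof -
  define w where "w = canonical_cf (real a / real N)"
  have a': "0 < a" "a < N" "coprime a N" using a N totatives_less[OF a] by (auto simp: totatives_def)
  have "is_canonical_cf w (real a / real N)"
    unfolding w_def canonical_cf_def by (rule theI'[OF canonical_cf_ex1[OF a'(1,2)]])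
  then have val: "valid w" and cf: "cf_value w = real a / real N"
    by (auto simp: is_canonical_cf_def valid_def)
  have "real (num w) / real (den w) = real a / real N" using cf_value_cf_pair[OF val] cf by simp
  then have "real (num w) * real N = real a * real (den w)" using den_pos[OF val] N by (simp add: field_simps)
  then have eq: "num w * N = a * den w" by (metis of_nat_eq_iff of_nat_mult)
  have "N dvd den w" using eq a'(3) by (metis coprime_commute coprime_dvd_mult_right_iff dvd_triv_right)
  moreover have "den w dvd N" using eq coprime_cf_pair[of w] by (metis coprime_dvd_mult_right_iff dvd_triv_right)
  ultimately have d: "den w = N" by (rule dvd_antisym[rotated])
  then show "canonical_cf (real a / real N) \<in> words N" using val by (simp add: words_def w_def)
  show "num (canonical_cf (real a / real N)) = a" using eq d N by (simp add: w_def)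
qed

text \<open>\<open>dev\<close> splits the mean square deviation into the variance and the squared
  distance of \<open>c\<close> from the mean. Taken at \<open>c = \<mu>\<close> it also shows that
  the variance is nonnegative, which disposes of the absolute value.\<close>

lemma variance_le_deviation:
  fixes g :: "'a \<Rightarrow> real" and c :: real
  assumes "finite T" "T \<noteq> {}"
  shows "\<bar>1 / real (card T) * (\<Sum>a\<in>T. (g a)\<^sup>2) - (1 / real (card T) * (\<Sum>a\<in>T. g a))\<^sup>2\<bar>
    \<le> 1 / real (card T) * (\<Sum>a\<in>T. (g a - c)\<^sup>2)"
proof -
  define M where "M = real (card T)"
  have M: "M > 0" using assms by (simp add: M_def card_gt_0_iff)
  define V where "V = 1 / M * (\<Sum>a\<in>T. (g a)\<^sup>2)"
  define \<mu> where "\<mu> = 1 / M * (\<Sum>a\<in>T. g a)"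
  have dev: "1 / M * (\<Sum>a\<in>T. (g a - c)\<^sup>2) = V - \<mu>\<^sup>2 + (\<mu> - c)\<^sup>2" for c
  proof -
    have "(\<Sum>a\<in>T. (g a - c)\<^sup>2) = (\<Sum>a\<in>T. (g a)\<^sup>2 - 2 * c * g a + c\<^sup>2)"
      by (intro sum.cong refl) (simp add: power2_eq_square algebra_simps)
    also have "\<dots> = (\<Sum>a\<in>T. (g a)\<^sup>2) - 2 * c * (\<Sum>a\<in>T. g a) + M * c\<^sup>2"
      by (simp add: sum.distrib sum_subtractf sum_distrib_left M_def)
    also have "(\<Sum>a\<in>T. (g a)\<^sup>2) = M * V" using M by (simp add: V_def)
    also have "(\<Sum>a\<in>T. g a) = M * \<mu>" using M by (simp add: \<mu>_def)
    finally have "(\<Sum>a\<in>T. (g a - c)\<^sup>2) = M * (V - 2 * c * \<mu> + c\<^sup>2)" by (simp add: algebra_simps)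
    then have "1 / M * (\<Sum>a\<in>T. (g a - c)\<^sup>2) = V - 2 * c * \<mu> + c\<^sup>2" using M by simp
    then show ?thesis by (simp add: power2_eq_square algebra_simps)
  qed
  have "0 \<le> 1 / M * (\<Sum>a\<in>T. (g a - \<mu>)\<^sup>2)" using M by (simp add: sum_nonneg)
  then have "V - \<mu>\<^sup>2 \<ge> 0" unfolding dev by simp
  then have "\<bar>V - \<mu>\<^sup>2\<bar> \<le> 1 / M * (\<Sum>a\<in>T. (g a - c)\<^sup>2)" unfolding dev by simp
  then show ?thesis by (simp only: V_def \<mu>_def M_def)
qed

abbreviation (input) S_variance :: "nat \<Rightarrow> (nat \<Rightarrow> real) \<Rightarrow> nat \<Rightarrow> nat \<Rightarrow> real" where
  "S_variance N f \<eta> \<theta> \<equiv> \<bar>mean_totatives N (\<lambda>x. (S_restr f \<eta> \<theta> x)\<^sup>2) - (mean_totatives N (S_restr f \<eta> \<theta>))\<^sup>2\<bar>"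

text \<open>Distinct fractions have distinct canonical words, since \<open>num\<close> recovers the
  numerator; passing on to all of \<open>words N\<close> only adds squares.\<close>

lemma variance_le_words:
  assumes N: "N \<ge> 2" and ft: "\<And>b. ft b = (if \<eta> \<le> b \<and> b \<le> \<theta> then f b else 0)"
  shows "S_variance N f \<eta> \<theta>
    \<le> 1 / real (totient N) * (\<Sum>w\<in>words N. ((\<Sum>k<length w. ft (w ! k)) - c)\<^sup>2)"
proof -
  define cw where "cw = (\<lambda>a. canonical_cf (real a / real N))"
  have S: "S_restr f \<eta> \<theta> (real a / real N) = (\<Sum>k<length (cw a). ft (cw a ! k))" for a
    by (simp only: S_restr_def Let_def cw_def ft)
  have inj: "inj_on cw (totatives N)"
  proof (rule inj_onI)
    fix a b assume ab: "a \<in> totatives N" "b \<in> totatives N" "cw a = cw b"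
    have "a = num (cw a)" using canonical_cf_words(2)[OF N ab(1)] by (simp only: cw_def)
    also have "\<dots> = num (cw b)" by (simp only: ab(3))
    also have "\<dots> = b" using canonical_cf_words(2)[OF N ab(2)] by (simp only: cw_def)
    finally show "a = b" .
  qed
  have ne: "totatives N \<noteq> {}" using N by simp
  have tc: "card (totatives N) = totient N" by (simp add: totient_def)
  have "S_variance N f \<eta> \<theta>
    \<le> 1 / real (totient N) * (\<Sum>a\<in>totatives N. (S_restr f \<eta> \<theta> (real a / real N) - c)\<^sup>2)"
    unfolding mean_totatives_def tc[symmetric] by (rule variance_le_deviation[OF _ ne]) simp
  also have "(\<Sum>a\<in>totatives N. (S_restr f \<eta> \<theta> (real a / real N) - c)\<^sup>2)
      = (\<Sum>w\<in>cw ` totatives N. ((\<Sum>k<length w. ft (w ! k)) - c)\<^sup>2)"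
    by (subst sum.reindex[OF inj]) (simp add: S)
  also have "\<dots> \<le> (\<Sum>w\<in>words N. ((\<Sum>k<length w. ft (w ! k)) - c)\<^sup>2)"
    using canonical_cf_words(1)[OF N] by (intro sum_mono2) (auto simp: cw_def)
  finally show ?thesis by (simp add: divide_right_mono)
qed

text \<open>The centre is \<open>2 * (A * ln Q)\<close>: the growth rate \<open>A\<close> predicts
  \<open>A * ln Q\<close> for the digits read from either end until the denominator exceeds
  \<open>Q\<close>, and the middle part is estimated without centring.\<close>

lemma words_second_moment:
  "\<exists>c\<ge>0. \<forall>(f :: nat \<Rightarrow> real) n N Q k. (\<forall>b\<ge>1. f b \<ge> 0) \<longrightarrow> (\<forall>b>n. f b = 0) \<longrightarrow>
     1 \<le> Q \<longrightarrow> 2 * recip_sum N \<le> real k \<longrightarrow>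
     exp (recip_sum N + 2) * (1 + real (card (prime_factors N))) ^ (2 * k) \<le> real N / (2 * Q\<^sup>2) \<longrightarrow>
     (real n)\<^sup>2 * real (card {d. d dvd N}) \<le> Q \<longrightarrow>
     (\<exists>c0. (\<Sum>w\<in>words N. ((\<Sum>j<length w. f (w ! j)) - c0)\<^sup>2) \<le>
       c * sqsum f n * (real (totient N) * (3 + log 2 (real N))
         + real N * ((2 * log 2 (real N / Q\<^sup>2) + 3) * (8 + 4 * ln (2 * real N * (real n + 1) / Q\<^sup>2)))))"
proof -
  from one_step_inequality obtain c where c0: "c \<ge> 0" and c: "\<forall>f n. (\<forall>b\<ge>1. f b \<ge> 0) \<longrightarrow> (\<forall>b>n. f b = 0) \<longrightarrow>
      (\<exists>A g. (\<forall>t\<in>{0..1}. (g t)\<^sup>2 \<le> c * sqsum f n) \<and>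
        (\<forall>t\<in>{0..1}. \<forall>\<sigma> b0 r. 0 \<le> r \<longrightarrow> r \<le> ln (real b0 + 1 + t) \<longrightarrow>
           (\<Sum>b=1..b0. dprob t b * (2 * (\<sigma> + (f b - A * ln (real b + t)) + g (1 / (real b + t)))\<^sup>2))
             + (1 + t) / (real b0 + 1 + t) * (\<sigma> - A * r)\<^sup>2
           \<le> 2 * (\<sigma> + g t)\<^sup>2 + c * sqsum f n))" by blast
  \<comment> \<open>\<open>3\<close> comes from the square of a sum of three terms. The two ends
    give \<open>3 * 2\<close> times the constant \<open>22 * c\<close> of the tree, and the middle
    gives \<open>3 * 4\<close>.\<close>
  define c' where "c' = 6 * (22 * c) + 12"
  show ?thesis
  proof (rule exI[of _ c'], intro conjI allI impI)
    show "c' \<ge> 0" using c0 by (simp add: c'_def)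
    fix f :: "nat \<Rightarrow> real" and n N :: nat and Q :: real and k :: nat
    assume f: "\<forall>b\<ge>1. f b \<ge> 0" "\<forall>b>n. f b = 0" and Q1: "1 \<le> Q" and k: "2 * recip_sum N \<le> real k"
      and H: "exp (recip_sum N + 2) * (1 + real (card (prime_factors N))) ^ (2 * k) \<le> real N / (2 * Q\<^sup>2)"
      and dN: "(real n)\<^sup>2 * real (card {d. d dvd N}) \<le> Q"
    define F2 where "F2 = sqsum f n"
    have F20: "F2 \<ge> 0" unfolding F2_def by (intro sum_nonneg) auto
    obtain A g where g: "\<And>t. t \<in> {0..1} \<Longrightarrow> (g t)\<^sup>2 \<le> c * F2" and
      step: "\<And>t \<sigma> b0 r. t \<in> {0..1} \<Longrightarrow> 0 \<le> r \<Longrightarrow> r \<le> ln (real b0 + 1 + t) \<Longrightarrow>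
           (\<Sum>b=1..b0. dprob t b * (2 * (\<sigma> + (f b - A * ln (real b + t)) + g (1 / (real b + t)))\<^sup>2))
             + (1 + t) / (real b0 + 1 + t) * (\<sigma> - A * r)\<^sup>2 \<le> 2 * (\<sigma> + g t)\<^sup>2 + c * F2"
      using c[THEN spec[of _ f], THEN spec[of _ n], THEN mp, THEN mp, OF f] unfolding F2_def by blast
    have "recip_sum N \<ge> 0" unfolding recip_sum_def by (intro sum_nonneg) auto
    then have "1 * 1 \<le> exp (recip_sum N + 2) * (1 + real (card (prime_factors N))) ^ (2 * k)"
      by (intro mult_mono one_le_power) auto
    with H have "1 \<le> real N / (2 * Q\<^sup>2)" by linarith
    then have QN: "2 * Q\<^sup>2 \<le> real N" using Q1 by (simp add: field_simps)
    have QQ: "Q \<le> Q\<^sup>2" using mult_left_mono[OF Q1, of Q] Q1 by (simp add: power2_eq_square)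
    have Q2: "1 \<le> Q\<^sup>2" using QQ Q1 by linarith
    have N: "N \<ge> 1" and QltN: "Q < real N" and Q2N: "Q\<^sup>2 \<le> real N" "Q\<^sup>2 < real N"
      using QN Q2 QQ by linarith+
    define \<kappa> where "\<kappa> = 22 * real (totient N)"
    have leaf: "real (card {u. v @ u \<in> words N \<and> (u = [] \<or> hd u > b0)})
         \<le> \<kappa> / (real (den v) * real ((b0 + 1) * den v + num (rev v)))"
      if v: "valid v" "real (den v) \<le> Q" "real (b0 * den v + num (rev v)) \<le> Q" for v b0
      unfolding \<kappa>_def
    proof (rule leaf_card[OF v(1) _ N k])
      show "den v < N" using v QltN by linarith
      have d: "real (den v) \<ge> 1" using den_pos[OF v(1)] by simp
      have "real ((b0 + 1) * den v + num (rev v)) = real (b0 * den v + num (rev v)) + real (den v)" by simp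
      \<comment> \<open>The first excluded denominator exceeds an admissible one by
        \<open>den v\<close> only, so it is at most \<open>2 * Q\<close>. This is the origin of
        \<open>2 * Q^2\<close> in the hypothesis on the sieve length.\<close>
      then have "real ((b0 + 1) * den v + num (rev v)) \<le> 2 * Q" using v by linarith
      then have "real (den v) * real ((b0 + 1) * den v + num (rev v)) \<le> Q * (2 * Q)"
        using v(2) Q1 by (intro mult_mono) auto
      moreover have "0 < real (den v) * real ((b0 + 1) * den v + num (rev v))"
      proof (rule mult_pos_pos)
        have "0 < (b0 + 1) * den v + num (rev v)" using den_pos[OF v(1)] by simp
        then show "0 < real ((b0 + 1) * den v + num (rev v))" by (simp only: of_nat_0_less_iff)
      qed (use d in linarith)
      ultimately have "real N / (2 * Q\<^sup>2) \<le> real N / (real (den v) * real ((b0 + 1) * den v + num (rev v)))"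
        by (intro divide_left_mono) (auto simp: power2_eq_square)
      with H show "exp (recip_sum N + 2) * (1 + real (card (prime_factors N))) ^ (2 * k)
        \<le> real N / (real (den v) * real ((b0 + 1) * den v + num (rev v)))" by linarith
    qed
    \<comment> \<open>Starting from \<open>- (A * ln Q)\<close> cancels the prediction at the root,
      and the squared term of the potential reduces to \<open>2 * (g 0)^2\<close>.\<close>
    have "(\<Sum>u | [] @ u \<in> words N. (- (A * ln Q) + initial_sum Q f (den []) (num (rev [])) u)\<^sup>2)
     \<le> \<kappa> / (real (den []) * real (den [] + num (rev []))) *
       (2 * (- (A * ln Q) + A * ln (Q / real (den [])) + g (real (num (rev [])) / real (den [])))\<^sup>2
         + c * F2 * (1 + log 2 (2 * Q\<^sup>2 / (real (den []) * real (den [] + num (rev []))))))"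
    proof (rule tree_second_moment[where m = "nat \<lceil>2 * Q\<rceil> + 1", OF QltN _ c0 F20 leaf step])
      show "2 * Q < real (den [] + num (rev []) + (nat \<lceil>2 * Q\<rceil> + 1))" by (simp, linarith)
    qed (use Q1 in \<open>auto simp: \<kappa>_def\<close>)
    then have "(\<Sum>w\<in>words N. (initial_sum Q f 1 0 w - A * ln Q)\<^sup>2) \<le> \<kappa> * (2 * (g 0)\<^sup>2 + c * F2 * (1 + log 2 (2 * Q\<^sup>2)))"
      by (simp add: algebra_simps)
    also have "\<dots> \<le> \<kappa> * (2 * (c * F2) + c * F2 * (1 + log 2 (real N)))"
    proof -
      have "log 2 (2 * Q\<^sup>2) \<le> log 2 (real N)" using QN Q2 by (intro log_mono) auto
      then have "c * F2 * (1 + log 2 (2 * Q\<^sup>2)) \<le> c * F2 * (1 + log 2 (real N))"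
        using c0 F20 by (intro mult_left_mono) auto
      moreover have "(g 0)\<^sup>2 \<le> c * F2" by (rule g) simp
      ultimately show ?thesis by (intro mult_left_mono) (auto simp: \<kappa>_def)
    qed
    also have "\<dots> = 22 * c * F2 * (real (totient N) * (3 + log 2 (real N)))" by (simp add: \<kappa>_def algebra_simps)
    finally have S1: "(\<Sum>w\<in>words N. (initial_sum Q f 1 0 w - A * ln Q)\<^sup>2)
        \<le> 22 * c * F2 * (real (totient N) * (3 + log 2 (real N)))" .
    have S2: "(\<Sum>w\<in>words N. (initial_sum Q f 1 0 (rev w) - A * ln Q)\<^sup>2) = (\<Sum>w\<in>words N. (initial_sum Q f 1 0 w - A * ln Q)\<^sup>2)"
      by (subst (2) rev_words[symmetric], subst sum.reindex) (auto simp: inj_on_def)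
    have S3: "(\<Sum>w\<in>words N. (\<Sum>k\<in>middle Q w. f (w ! k))\<^sup>2)
      \<le> (2 * log 2 (real N / Q\<^sup>2) + 3) * (4 * real N * (8 + 4 * ln (2 * real N * (real n + 1) / Q\<^sup>2))) * F2"
      unfolding F2_def using Q1 f(2) by (intro mid_second_moment Q2N N dN) auto
    define E where "E = real N * ((2 * log 2 (real N / Q\<^sup>2) + 3) * (8 + 4 * ln (2 * real N * (real n + 1) / Q\<^sup>2)))"
    have E0: "E \<ge> 0"
    proof -
      have "1 \<le> real N / Q\<^sup>2" using Q2N Q2 by (subst le_divide_eq_1_pos) linarith+
      moreover have "1 * 1 \<le> (2 * (real N / Q\<^sup>2)) * (real n + 1)" using \<open>1 \<le> real N / Q\<^sup>2\<close> by (intro mult_mono) auto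
      then have "1 \<le> 2 * real N * (real n + 1) / Q\<^sup>2" by simp
      ultimately show ?thesis unfolding E_def
        using log2_nonneg[of "real N / Q\<^sup>2"] ln_ge_zero[of "2 * real N * (real n + 1) / Q\<^sup>2"]
        by (intro mult_nonneg_nonneg add_nonneg_nonneg) auto
    qed
    have T0: "real (totient N) * (3 + log 2 (real N)) \<ge> 0"
      using log2_nonneg[of "real N"] N by (intro mult_nonneg_nonneg add_nonneg_nonneg) auto
    have "(\<Sum>w\<in>words N. ((\<Sum>j<length w. f (w ! j)) - 2 * (A * ln Q))\<^sup>2)
      \<le> (\<Sum>w\<in>words N. 3 * (initial_sum Q f 1 0 w - A * ln Q)\<^sup>2 + 3 * (initial_sum Q f 1 0 (rev w) - A * ln Q)\<^sup>2
           + 3 * (\<Sum>k\<in>middle Q w. f (w ! k))\<^sup>2)"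
    proof (rule sum_mono)
      fix w assume w: "w \<in> words N"
      have "(\<Sum>j<length w. f (w ! j)) - 2 * (A * ln Q)
        = (initial_sum Q f 1 0 w - A * ln Q) + (initial_sum Q f 1 0 (rev w) - A * ln Q) + (\<Sum>k\<in>middle Q w. f (w ! k))"
        using digit_sum_split[OF w _ Q2N(2), of f] Q1 by simp
      then show "((\<Sum>j<length w. f (w ! j)) - 2 * (A * ln Q))\<^sup>2 \<le> 3 * (initial_sum Q f 1 0 w - A * ln Q)\<^sup>2
          + 3 * (initial_sum Q f 1 0 (rev w) - A * ln Q)\<^sup>2 + 3 * (\<Sum>k\<in>middle Q w. f (w ! k))\<^sup>2"
        using sum_three_squared_le by metis
    qed
    also have "\<dots> = 6 * (\<Sum>w\<in>words N. (initial_sum Q f 1 0 w - A * ln Q)\<^sup>2) + 3 * (\<Sum>w\<in>words N. (\<Sum>k\<in>middle Q w. f (w ! k))\<^sup>2)"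
      using S2 by (simp add: sum.distrib sum_distrib_left[symmetric])
    also have "\<dots> \<le> 6 * (22 * c * F2 * (real (totient N) * (3 + log 2 (real N))))
        + 3 * ((2 * log 2 (real N / Q\<^sup>2) + 3) * (4 * real N * (8 + 4 * ln (2 * real N * (real n + 1) / Q\<^sup>2))) * F2)"
      by (intro add_mono mult_left_mono S1 S3) auto
    also have "\<dots> = 6 * (22 * c) * (F2 * (real (totient N) * (3 + log 2 (real N)))) + 12 * (F2 * E)"
      by (simp add: E_def)
    also have "\<dots> \<le> c' * (F2 * (real (totient N) * (3 + log 2 (real N)))) + c' * (F2 * E)"
    proof -
      have "6 * (22 * c) \<le> c'" "12 \<le> c'" using c0 by (simp_all add: c'_def)
      then show ?thesis
        by (intro add_mono mult_right_mono mult_nonneg_nonneg[OF F20 T0] mult_nonneg_nonneg[OF F20 E0])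
    qed
    also have "\<dots> = c' * F2 * (real (totient N) * (3 + log 2 (real N)) + E)" by (simp add: algebra_simps)
    finally have fin: "(\<Sum>w\<in>words N. ((\<Sum>j<length w. f (w ! j)) - 2 * (A * ln Q))\<^sup>2)
        \<le> c' * F2 * (real (totient N) * (3 + log 2 (real N)) + E)" .
    show "\<exists>c0. (\<Sum>w\<in>words N. ((\<Sum>j<length w. f (w ! j)) - c0)\<^sup>2) \<le>
       c' * sqsum f n * (real (totient N) * (3 + log 2 (real N))
         + real N * ((2 * log 2 (real N / Q\<^sup>2) + 3) * (8 + 4 * ln (2 * real N * (real n + 1) / Q\<^sup>2))))"
      unfolding F2_def[symmetric] E_def[symmetric] by (rule exI[of _ "2 * (A * ln Q)"]) (rule fin)
  qed
qed

text \<open>A bound for the shortest interval length admitted by \<open>sieve_interval\<close>, in terms of \<open>L = ln N\<close>.\<close>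

definition sieve_loss :: "real \<Rightarrow> real" where
  "sieve_loss L = exp (3 + ln (2 * L) / 2) * (1 + 2 * L) powr (6 + 2 * ln (2 * L))"

text \<open>\<open>sieve_loss L\<close> is \<open>exp\<close> of O((ln L)^2), negligible against any
  power of \<open>exp L\<close>. The second conjunct yields \<open>Q >= 1\<close>. The third is the
  divisor condition and holds because \<open>4/9 < 1/2\<close>. The last absorbs the middle part:
  its left side is the square root of \<open>L\<close> times O((ln L)^4).\<close>

lemma sieve_loss_asymptotics:
  assumes "C > 0"
  shows "eventually (\<lambda>L. 1 \<le> L \<and> 2 * sieve_loss L \<le> exp L
    \<and> (L powr C)\<^sup>2 * ((1 + 2 * L)\<^sup>2 * exp (4/9 * L)) \<le> sqrt (exp L / (2 * sieve_loss L))
    \<and> exp (3 + ln (2 * L) / 2) *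
        ((4 * ln (2 * sieve_loss L) + 3) * (8 + 4 * ln (4 * sieve_loss L * (L powr C + 1)))) \<le> L) at_top"
proof (intro eventually_conj)
  show "eventually (\<lambda>L::real. 1 \<le> L) at_top" by (rule eventually_ge_at_top)
  show "eventually (\<lambda>L. 2 * sieve_loss L \<le> exp L) at_top"
    unfolding sieve_loss_def by real_asymp
  show "eventually (\<lambda>L. (L powr C)\<^sup>2 * ((1 + 2 * L)\<^sup>2 * exp (4/9 * L)) \<le> sqrt (exp L / (2 * sieve_loss L))) at_top"
    using assms unfolding sieve_loss_def by real_asymp
  show "eventually (\<lambda>L. exp (3 + ln (2 * L) / 2) *
        ((4 * ln (2 * sieve_loss L) + 3) * (8 + 4 * ln (4 * sieve_loss L * (L powr C + 1)))) \<le> L) at_top"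
    using assms unfolding sieve_loss_def by real_asymp
qed

text \<open>\<open>N\<close> has at most \<open>log 2 N <= 2 * L\<close> distinct prime factors,
  hence \<open>recip_sum N <= 1 + ln (2 * L) / 2\<close>. Rounding \<open>2 * recip_sum N\<close> up
  to \<open>k\<close> gives \<open>2 * k <= 6 + 2 * ln (2 * L)\<close>, the exponent in
  \<open>sieve_loss\<close>.\<close>

lemma sieve_parameters:
  assumes N: "N \<ge> 2" and L1: "1 \<le> ln (real N)"
  defines "L \<equiv> ln (real N)"
  obtains k where "2 * recip_sum N \<le> real k"
    "exp (recip_sum N + 2) * (1 + real (card (prime_factors N))) ^ (2 * k) \<le> sieve_loss L"
    "real N \<le> real (totient N) * exp (3 + ln (2 * L) / 2)" "log 2 (real N) \<le> 2 * L" "1 \<le> sieve_loss L"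
proof -
  have L: "L \<ge> 1" using L1 by (simp add: L_def)
  have ln2: "ln 2 \<ge> (1/2 :: real)" using ln2_ge_two_thirds by linarith
  have log2: "log 2 (real N) \<le> 2 * L"
  proof -
    have "L / ln 2 \<le> L / (1/2)" using ln2 L by (intro divide_left_mono) auto
    then show ?thesis by (simp add: log_def L_def)
  qed
  define n where "n = card (prime_factors N)"
  have "prime_factors N \<noteq> {}" using N prime_factor_nat[of N] by (auto simp: prime_factors_dvd)
  then have n1: "n \<ge> 1" by (simp add: n_def Suc_le_eq card_gt_0_iff)
  have "(2::nat) ^ n \<le> N" using card_prime_factors_le[of N] N by (simp add: n_def)
  then have "real (2 ^ n) \<le> real N" by (simp only: of_nat_le_iff)
  then have "log 2 (2 ^ n) \<le> log 2 (real N)" using N by (intro log_mono) auto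
  then have "real n \<le> log 2 (real N)" by (simp add: log_nat_power)
  then have n: "real n \<le> 2 * L" using log2 by linarith
  define s where "s = recip_sum N"
  have s0: "s \<ge> 0" unfolding s_def recip_sum_def by (intro sum_nonneg) auto
  have "s \<le> 1 + ln (real n) / 2" using recip_sum_le[of N] n1 by (simp add: s_def n_def)
  also have "ln (real n) \<le> ln (2 * L)" using n n1 by (intro ln_mono) auto
  finally have s: "s \<le> 1 + ln (2 * L) / 2" by simp
  define k where "k = nat \<lceil>2 * s\<rceil>"
  have k: "2 * s \<le> real k" "real k \<le> 2 * s + 1" using s0 unfolding k_def by linarith+
  have ln2L: "ln (2 * L) \<ge> 0" using L by simp
  show ?thesis
  proof (rule that[of k])
    show "2 * recip_sum N \<le> real k" using k(1) by (simp add: s_def)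
    show "log 2 (real N) \<le> 2 * L" by (rule log2)
    have "(1 + real n) ^ (2 * k) = (1 + real n) powr real (2 * k)" by (subst powr_realpow) auto
    also have "\<dots> \<le> (1 + real n) powr (6 + 2 * ln (2 * L))" using k s by (intro powr_mono) auto
    also have "\<dots> \<le> (1 + 2 * L) powr (6 + 2 * ln (2 * L))" using n ln2L by (intro powr_mono2) auto
    finally have "(1 + real n) ^ (2 * k) \<le> (1 + 2 * L) powr (6 + 2 * ln (2 * L))" .
    then show "exp (recip_sum N + 2) * (1 + real (card (prime_factors N))) ^ (2 * k) \<le> sieve_loss L"
      unfolding sieve_loss_def using s by (intro mult_mono) (auto simp: s_def n_def)
    have "exp (- s - 2) \<le> real (totient N) / real N" using totient_ratio_ge[of N] N by (simp add: s_def)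
    then have "exp (s + 2) * (exp (- s - 2) * real N) \<le> exp (s + 2) * real (totient N)"
      using N by (intro mult_left_mono) (auto simp: field_simps)
    then have "real N \<le> exp (s + 2) * real (totient N)" by (simp add: mult.assoc[symmetric] exp_add[symmetric])
    also have "\<dots> \<le> exp (3 + ln (2 * L) / 2) * real (totient N)" using s by (intro mult_right_mono) auto
    finally show "real N \<le> real (totient N) * exp (3 + ln (2 * L) / 2)" by (simp add: mult.commute)
    have "1 * 1 \<le> sieve_loss L" unfolding sieve_loss_def
      using ln2L L by (intro mult_mono ge_one_powr_ge_zero) auto
    then show "1 \<le> sieve_loss L" by simp
  qed
qed

lemma variance_large_N:
  fixes C :: real
  assumes C: "C > 0"
  shows "\<exists>K\<ge>0. \<exists>N0. \<forall>N\<ge>N0. \<forall>\<eta> \<theta>. \<forall>f :: nat \<Rightarrow> real. 1 \<le> \<eta> \<longrightarrow> (\<forall>b\<ge>1. f b \<ge> 0) \<longrightarrow>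
    real \<theta> \<le> ln (real N) powr C \<longrightarrow>
    S_variance N f \<eta> \<theta>
    \<le> K * (\<Sum>b=\<eta>..\<theta>. (f b)\<^sup>2 / (real b)\<^sup>2) * ln (real N)"
proof -
  obtain c where c0: "c \<ge> 0" and c: "\<forall>(f :: nat \<Rightarrow> real) n N Q k. (\<forall>b\<ge>1. f b \<ge> 0) \<longrightarrow> (\<forall>b>n. f b = 0) \<longrightarrow>
     1 \<le> Q \<longrightarrow> 2 * recip_sum N \<le> real k \<longrightarrow>
     exp (recip_sum N + 2) * (1 + real (card (prime_factors N))) ^ (2 * k) \<le> real N / (2 * Q\<^sup>2) \<longrightarrow>
     (real n)\<^sup>2 * real (card {d. d dvd N}) \<le> Q \<longrightarrow>
     (\<exists>c0. (\<Sum>w\<in>words N. ((\<Sum>j<length w. f (w ! j)) - c0)\<^sup>2) \<le>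
       c * sqsum f n * (real (totient N) * (3 + log 2 (real N))
         + real N * ((2 * log 2 (real N / Q\<^sup>2) + 3) * (8 + 4 * ln (2 * real N * (real n + 1) / Q\<^sup>2)))))"
    using words_second_moment by blast
  obtain L0 where L0: "\<And>L. L \<ge> L0 \<Longrightarrow> 1 \<le> L \<and> 2 * sieve_loss L \<le> exp L
    \<and> (L powr C)\<^sup>2 * ((1 + 2 * L)\<^sup>2 * exp (4/9 * L)) \<le> sqrt (exp L / (2 * sieve_loss L))
    \<and> exp (3 + ln (2 * L) / 2) *
        ((4 * ln (2 * sieve_loss L) + 3) * (8 + 4 * ln (4 * sieve_loss L * (L powr C + 1)))) \<le> L"
    using sieve_loss_asymptotics[OF C] unfolding eventually_at_top_linorder by blast
  define N0 where "N0 = nat \<lceil>exp L0\<rceil> + 2"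
  show ?thesis
  proof (rule exI[of _ "6 * c"], rule conjI, use c0 in simp, rule exI[of _ N0], intro allI impI)
    fix N \<eta> \<theta> :: nat and f :: "nat \<Rightarrow> real"
    assume N: "N \<ge> N0" and \<eta>: "1 \<le> \<eta>" and f: "\<forall>b\<ge>1. f b \<ge> 0" and \<theta>: "real \<theta> \<le> ln (real N) powr C"
    define L where "L = ln (real N)"
    have N2: "N \<ge> 2" using N by (simp add: N0_def)
    have "exp L0 \<le> real N" using N unfolding N0_def by linarith
    then have "L0 \<le> L" using N2 by (simp add: L_def ln_ge_iff)
    note asy = L0[OF this]
    have L1: "1 \<le> L" using asy by simp
    have eL: "exp L = real N" using N2 by (simp add: L_def)
    define h where "h = sieve_loss L"
    obtain k where k: "2 * recip_sum N \<le> real k"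
      "exp (recip_sum N + 2) * (1 + real (card (prime_factors N))) ^ (2 * k) \<le> h"
      "real N \<le> real (totient N) * exp (3 + ln (2 * L) / 2)" "log 2 (real N) \<le> 2 * L" "1 \<le> h"
      unfolding h_def L_def by (rule sieve_parameters[OF N2 L1[unfolded L_def]])
    \<comment> \<open>The largest \<open>Q\<close> for which \<open>N / (2 * Q^2)\<close> is still
      at least the length \<open>h\<close> that suffices for the sieve.\<close>
    define Q where "Q = sqrt (real N / (2 * h))"
    have Q2: "Q\<^sup>2 = real N / (2 * h)" using k(5) by (simp add: Q_def)
    have "2 * h \<le> real N" using asy eL by (simp add: h_def)
    then have Q1: "1 \<le> Q" using k(5) by (simp add: Q_def)
    have NQ: "real N / Q\<^sup>2 = 2 * h" "real N / (2 * Q\<^sup>2) = h" using N2 k(5) by (simp_all add: Q2)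
    define ft where "ft = (\<lambda>b. if \<eta> \<le> b \<and> b \<le> \<theta> then f b else 0)"
    have ft: "\<forall>b\<ge>1. ft b \<ge> 0" "\<forall>b>\<theta>. ft b = 0" using f by (auto simp: ft_def)
    define F2 where "F2 = (\<Sum>b=1..\<theta>. (ft b)\<^sup>2 / (real b)\<^sup>2)"
    have F20: "F2 \<ge> 0" unfolding F2_def by (intro sum_nonneg) auto
    have F2: "F2 = (\<Sum>b=\<eta>..\<theta>. (f b)\<^sup>2 / (real b)\<^sup>2)"
      unfolding F2_def ft_def using \<eta> by (intro sum.mono_neutral_cong_right) auto
    have dN: "(real \<theta>)\<^sup>2 * real (card {d. d dvd N}) \<le> Q"
    proof -
      have "real (card {d. d dvd N}) \<le> (1 + log 2 (real N))\<^sup>2 * real N powr (4/9)"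
        using N2 by (intro card_divisors_le) simp
      also have "\<dots> \<le> (1 + 2 * L)\<^sup>2 * exp (4/9 * L)"
      proof (intro mult_mono power_mono)
        show "real N powr (4/9) \<le> exp (4/9 * L)" using N2 by (simp add: powr_def L_def)
        show "0 \<le> 1 + log 2 (real N)" using log2_nonneg[of "real N"] N2 by simp
      qed (use k(4) in auto)
      finally have "(real \<theta>)\<^sup>2 * real (card {d. d dvd N}) \<le> (L powr C)\<^sup>2 * ((1 + 2 * L)\<^sup>2 * exp (4/9 * L))"
        using \<theta> by (intro mult_mono power_mono) (auto simp: L_def)
      also have "\<dots> \<le> Q" using asy eL by (simp add: Q_def h_def)
      finally show ?thesis .
    qed
    have H: "exp (recip_sum N + 2) * (1 + real (card (prime_factors N))) ^ (2 * k) \<le> real N / (2 * Q\<^sup>2)"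
      using k(2) by (simp add: NQ(2))
    obtain c1 where c1: "(\<Sum>w\<in>words N. ((\<Sum>j<length w. ft (w ! j)) - c1)\<^sup>2) \<le>
       c * F2 * (real (totient N) * (3 + log 2 (real N))
         + real N * ((2 * log 2 (real N / Q\<^sup>2) + 3) * (8 + 4 * ln (2 * real N * (real \<theta> + 1) / Q\<^sup>2))))"
      using c[THEN spec[of _ ft], THEN spec[of _ \<theta>], THEN spec[of _ N], THEN spec[of _ Q], THEN spec[of _ k],
        THEN mp, THEN mp, THEN mp, THEN mp, THEN mp, THEN mp, OF ft Q1 k(1) H dN] unfolding F2_def by blast
    have t: "totient N > 0" using N2 by simp
    \<comment> \<open>The middle part is measured by \<open>N\<close>. The third fact of
      \<open>k\<close> converts this to \<open>totient N\<close>, and the last conjunct of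
      \<open>asy\<close> absorbs the loss.\<close>
    have mid: "real N * ((2 * log 2 (real N / Q\<^sup>2) + 3) * (8 + 4 * ln (2 * real N * (real \<theta> + 1) / Q\<^sup>2)))
        \<le> real (totient N) * L"
    proof -
      have l0: "0 \<le> ln (2 * h)" using k(5) by simp
      have lg0: "0 \<le> log 2 (2 * h)" using k(5) by (intro log2_nonneg) simp
      have "ln (2 * h) / ln 2 \<le> ln (2 * h) / (1/2)"
        using l0 ln2_ge_two_thirds by (intro divide_left_mono) auto
      then have 1: "2 * log 2 (real N / Q\<^sup>2) + 3 \<le> 4 * ln (2 * h) + 3" unfolding NQ by (simp add: log_def)
      have "2 * real N * (real \<theta> + 1) / Q\<^sup>2 = 2 * (real N / Q\<^sup>2) * (real \<theta> + 1)" by simp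
      also have "\<dots> = 4 * h * (real \<theta> + 1)" by (simp add: NQ)
      finally have e: "2 * real N * (real \<theta> + 1) / Q\<^sup>2 = 4 * h * (real \<theta> + 1)" .
      have th: "1 * 1 \<le> 4 * h * (real \<theta> + 1)" using k(5) by (intro mult_mono) auto
      then have th0: "0 \<le> ln (4 * h * (real \<theta> + 1))" by simp
      have "ln (4 * h * (real \<theta> + 1)) \<le> ln (4 * h * (L powr C + 1))"
        using th \<theta> k(5) by (intro ln_mono mult_left_mono) (auto simp: L_def)
      then have 2: "8 + 4 * ln (2 * real N * (real \<theta> + 1) / Q\<^sup>2) \<le> 8 + 4 * ln (4 * h * (L powr C + 1))"
        unfolding e by simp
      have "real N * ((2 * log 2 (real N / Q\<^sup>2) + 3) * (8 + 4 * ln (2 * real N * (real \<theta> + 1) / Q\<^sup>2)))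
        \<le> (real (totient N) * exp (3 + ln (2 * L) / 2)) * ((4 * ln (2 * h) + 3) * (8 + 4 * ln (4 * h * (L powr C + 1))))"
      proof (rule mult_mono[OF k(3) mult_mono[OF 1 2]])
        show p: "0 \<le> 8 + 4 * ln (2 * real N * (real \<theta> + 1) / Q\<^sup>2)" unfolding e using th0 by linarith
        show "0 \<le> 4 * ln (2 * h) + 3" using l0 by linarith
        have "0 \<le> 2 * log 2 (real N / Q\<^sup>2) + 3" unfolding NQ using lg0 by linarith
        then show "0 \<le> (2 * log 2 (real N / Q\<^sup>2) + 3) * (8 + 4 * ln (2 * real N * (real \<theta> + 1) / Q\<^sup>2))"
          using p by (rule mult_nonneg_nonneg)
      qed simp
      also have "\<dots> \<le> real (totient N) * L"
        using asy unfolding mult.assoc h_def by (intro mult_left_mono) auto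
      finally show ?thesis .
    qed
    have "(\<Sum>w\<in>words N. ((\<Sum>j<length w. ft (w ! j)) - c1)\<^sup>2) \<le> c * F2 * (real (totient N) * (5 * L) + real (totient N) * L)"
    proof (rule order.trans[OF c1 mult_left_mono[OF add_mono[OF mult_left_mono mid]]])
      show "3 + log 2 (real N) \<le> 5 * L" using k(4) L1 by linarith
    qed (use c0 F20 in auto)
    also have "\<dots> = real (totient N) * (6 * c * F2 * L)" by (simp add: algebra_simps)
    finally have W: "(\<Sum>w\<in>words N. ((\<Sum>j<length w. ft (w ! j)) - c1)\<^sup>2) \<le> real (totient N) * (6 * c * F2 * L)" .
    have "S_variance N f \<eta> \<theta>
      \<le> 1 / real (totient N) * (\<Sum>w\<in>words N. ((\<Sum>j<length w. ft (w ! j)) - c1)\<^sup>2)"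
      by (rule variance_le_words[OF N2]) (simp add: ft_def)
    also have "\<dots> \<le> 1 / real (totient N) * (real (totient N) * (6 * c * F2 * L))"
      by (rule mult_left_mono[OF W]) simp
    also have "\<dots> = 6 * c * F2 * L" using t by simp
    finally show "S_variance N f \<eta> \<theta>
      \<le> 6 * c * (\<Sum>b=\<eta>..\<theta>. (f b)\<^sup>2 / (real b)\<^sup>2) * ln (real N)" by (simp add: F2 L_def)
  qed
qed

section \<open>Small \<open>N\<close>, and comparison with the constants of the theorem\<close>

lemma variance_trivial:
  assumes N: "N \<ge> 2" and f: "\<And>b. \<eta> \<le> b \<Longrightarrow> b \<le> \<theta> \<Longrightarrow> 0 \<le> f b \<and> f b \<le> M" and M: "M \<ge> 0"
  shows "S_variance N f \<eta> \<theta>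
    \<le> 2 * (real N + 1) * (real N * M)\<^sup>2"
proof -
  define ft where "ft = (\<lambda>b. if \<eta> \<le> b \<and> b \<le> \<theta> then f b else 0)"
  have ft: "0 \<le> ft b" "ft b \<le> M" for b using f[of b] M by (auto simp: ft_def)
  have t: "real (totient N) \<ge> 1" using N by (simp add: Suc_le_eq)
  have cw: "card (words N) \<le> 2 * card ({N} \<times> {..N})"
    by (rule card_words_le) (use num_le_den in \<open>auto simp: words_def prod_eq_iff image_iff mem_Times_iff\<close>)
  then have cw: "real (card (words N)) \<le> 2 * (real N + 1)" by (simp add: card_cartesian_product)
  have "(\<Sum>w\<in>words N. ((\<Sum>k<length w. ft (w ! k)) - 0)\<^sup>2) \<le> (\<Sum>w\<in>words N. (real N * M)\<^sup>2)"
  proof (rule sum_mono)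
    fix w assume w: "w \<in> words N"
    have "(\<Sum>k<length w. ft (w ! k)) \<le> (\<Sum>k<length w. M)" by (intro sum_mono ft)
    also have "\<dots> \<le> real N * M" using w length_le_den[of w] M by (auto simp: words_def intro: mult_right_mono)
    finally show "((\<Sum>k<length w. ft (w ! k)) - 0)\<^sup>2 \<le> (real N * M)\<^sup>2"
      by (intro power_mono) (auto intro!: sum_nonneg ft)
  qed
  also have "\<dots> \<le> 2 * (real N + 1) * (real N * M)\<^sup>2" using cw by (simp add: mult_right_mono)
  finally have W: "(\<Sum>w\<in>words N. ((\<Sum>k<length w. ft (w ! k)) - 0)\<^sup>2) \<le> 2 * (real N + 1) * (real N * M)\<^sup>2" .
  have "S_variance N f \<eta> \<theta>
      \<le> 1 / real (totient N) * (\<Sum>w\<in>words N. ((\<Sum>k<length w. ft (w ! k)) - 0)\<^sup>2)"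
    by (rule variance_le_words[OF N]) (simp add: ft_def)
  also have "\<dots> \<le> 1 * (\<Sum>w\<in>words N. ((\<Sum>k<length w. ft (w ! k)) - 0)\<^sup>2)"
  proof (rule mult_right_mono)
    show "1 / real (totient N) \<le> 1" using t by (subst divide_le_eq_1_pos) linarith+
  qed (simp add: sum_nonneg)
  finally show ?thesis using W by linarith
qed

lemma A_const_nonneg: "\<eta> \<ge> 1 \<Longrightarrow> (\<And>b. b \<ge> 1 \<Longrightarrow> f b \<ge> 0) \<Longrightarrow> A_const f \<eta> \<theta> \<ge> 0"
  unfolding A_const_def by (intro mult_nonneg_nonneg sum_nonneg ln_ge_zero) auto

text \<open>\<open>ln (1 + x) >= x / (1 + x)\<close> bounds the logarithm below by
  \<open>1 / (b + 1)^2\<close>, which is at least \<open>1 / (4 * b^2)\<close>. By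
  \<open>pi < 4\<close> the prefactor \<open>12 / pi^2\<close> is at least \<open>3/4\<close>, and
  \<open>4 / (3/4) <= 6\<close>.\<close>

lemma sum_squares_le_A_const:
  assumes "\<eta> \<ge> 1"
  shows "(\<Sum>b=\<eta>..\<theta>. (f b)\<^sup>2 / (real b)\<^sup>2) \<le> 6 * A_const (\<lambda>n. (f n)\<^sup>2) \<eta> \<theta>"
proof -
  define S where "S = (\<Sum>b=\<eta>..\<theta>. (f b)\<^sup>2 * ln (1 + 1 / (real b * (real b + 2))))"
  have ln_ge: "x / (1 + x) \<le> ln (1 + x)" if "x > 0" for x :: real
  proof -
    have "ln (1 / (1 + x)) \<le> 1 / (1 + x) - 1" using that by (intro ln_le_minus_one) auto
    moreover have "ln (1 / (1 + x)) = - ln (1 + x)" using that by (simp add: ln_div)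
    moreover have "1 / (1 + x) - 1 = - (x / (1 + x))" using that by (simp add: field_simps)
    ultimately show ?thesis by linarith
  qed
  have "(\<Sum>b=\<eta>..\<theta>. (f b)\<^sup>2 / (real b)\<^sup>2) \<le> (\<Sum>b=\<eta>..\<theta>. 4 * ((f b)\<^sup>2 * ln (1 + 1 / (real b * (real b + 2)))))"
  proof (rule sum_mono)
    fix b assume "b \<in> {\<eta>..\<theta>}"
    then have b: "real b \<ge> 1" using assms by auto
    define x where "x = 1 / (real b * (real b + 2))"
    have x: "x > 0" using b by (simp add: x_def)
    have "real b * (real b + 2) > 0" using b by simp
    moreover have "(1 / y) / (1 + 1 / y) = 1 / (y + 1)" if "y > 0" for y :: real
      using that by (simp add: field_simps)
    ultimately have "x / (1 + x) = 1 / (real b * (real b + 2) + 1)" unfolding x_def by blast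
    also have "real b * (real b + 2) + 1 = (real b + 1)\<^sup>2" by (simp add: power2_eq_square algebra_simps)
    finally have e: "x / (1 + x) = 1 / (real b + 1)\<^sup>2" .
    have "(real b + 1)\<^sup>2 \<le> (2 * real b)\<^sup>2" using b by (intro power_mono) auto
    then have "1 / (2 * real b)\<^sup>2 \<le> 1 / (real b + 1)\<^sup>2" using b by (intro divide_left_mono) auto
    then have "1 / (real b)\<^sup>2 \<le> 4 * ln (1 + x)" using ln_ge[OF x] unfolding e by (simp add: power_mult_distrib)
    then have "(f b)\<^sup>2 * (1 / (real b)\<^sup>2) \<le> (f b)\<^sup>2 * (4 * ln (1 + x))" by (rule mult_left_mono) simp
    then show "(f b)\<^sup>2 / (real b)\<^sup>2 \<le> 4 * ((f b)\<^sup>2 * ln (1 + 1 / (real b * (real b + 2))))" by (simp add: x_def)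
  qed
  then have 1: "(\<Sum>b=\<eta>..\<theta>. (f b)\<^sup>2 / (real b)\<^sup>2) \<le> 4 * S" by (simp add: S_def sum_distrib_left)
  have S0: "S \<ge> 0" unfolding S_def using assms by (intro sum_nonneg mult_nonneg_nonneg ln_ge_zero) auto
  have "pi\<^sup>2 \<le> 4\<^sup>2" using pi_less_4 pi_ge_zero by (intro power_mono) auto
  then have "12 / 4\<^sup>2 \<le> 12 / pi\<^sup>2" by (intro divide_left_mono) auto
  then have "3/4 * S \<le> 12 / pi\<^sup>2 * S" using S0 by (intro mult_right_mono) auto
  then show ?thesis using 1 S0 unfolding A_const_def S_def[symmetric] by linarith
qed

theorem theorem6:
  fixes C :: real
  assumes "C > 0"
  shows "\<exists>K>0. \<forall>(N::nat) (\<eta>::nat) (\<theta>::nat) (f::nat \<Rightarrow> real).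
    N \<ge> 3 \<longrightarrow> 1 \<le> \<eta> \<longrightarrow> \<eta> \<le> \<theta> \<longrightarrow>
    (\<forall>n\<ge>1. f n \<ge> 0) \<longrightarrow> mono_on {1..} f \<longrightarrow>
    real \<theta> \<le> min (sqrt (real N) - 2) (ln (real N) powr C) \<longrightarrow>
    \<bar>mean_totatives N (\<lambda>x. (S_restr f \<eta> \<theta> x)\<^sup>2) - (mean_totatives N (S_restr f \<eta> \<theta>))\<^sup>2\<bar>
    \<le> K * (D_const f \<eta> \<theta> * (ln (real N))\<^sup>2
         + B_const (\<lambda>n. (f n)\<^sup>2) \<eta> \<theta> * ln (real N)
         + (B_const f \<eta> \<theta>)\<^sup>2 * ln (real N) * (ln (ln (real N))) ^ 3
         + B_const f \<eta> \<theta>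
             * (sqrt (B_const (\<lambda>n. (f n)\<^sup>2) \<eta> \<theta>) + f (nat \<lceil>sqrt (C_const f \<eta> \<theta>)\<rceil>))
             * ln (real N) * ln (ln (real N)))"
proof -
  obtain K1 N0 where K1: "K1 \<ge> 0" and large: "\<forall>N\<ge>N0. \<forall>\<eta> \<theta>. \<forall>f :: nat \<Rightarrow> real. 1 \<le> \<eta> \<longrightarrow> (\<forall>b\<ge>1. f b \<ge> 0) \<longrightarrow>
    real \<theta> \<le> ln (real N) powr C \<longrightarrow>
    S_variance N f \<eta> \<theta>
    \<le> K1 * (\<Sum>b=\<eta>..\<theta>. (f b)\<^sup>2 / (real b)\<^sup>2) * ln (real N)"
    using variance_large_N[OF assms] by blast
  define K2 where "K2 = 2 * (real N0 + 1) * (real N0)\<^sup>2 * real N0"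
  define K where "K = 6 * K1 + K2 + 1"
  have K2: "K2 \<ge> 0" by (simp add: K2_def)
  show ?thesis
  proof (rule exI[of _ K], rule conjI, use K1 K2 in \<open>simp add: K_def\<close>, intro allI impI)
    fix N \<eta> \<theta> :: nat and f :: "nat \<Rightarrow> real"
    assume N: "N \<ge> 3" and \<eta>: "1 \<le> \<eta>" and \<eta>\<theta>: "\<eta> \<le> \<theta>" and f: "\<forall>n\<ge>1. f n \<ge> 0" and mono: "mono_on {1..} f"
      and \<theta>: "real \<theta> \<le> min (sqrt (real N) - 2) (ln (real N) powr C)"
    define L where "L = ln (real N)"
    define B2 where "B2 = B_const (\<lambda>n. (f n)\<^sup>2) \<eta> \<theta>"
    let ?V = "S_variance N f \<eta> \<theta>"
    have fmono: "f a \<le> f b" if "1 \<le> a" "a \<le> b" for a b using mono that by (auto simp: mono_on_def)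
    \<comment> \<open>\<open>N >= 3 > exp 1\<close>, so that \<open>ln (ln N)\<close> is nonnegative
      as well.\<close>
    have L1: "1 \<le> L" using N e_less_272 by (simp add: L_def ln_ge_iff)
    have lL: "0 \<le> ln L" using L1 by simp
    have f\<theta>: "f \<theta> \<ge> 0" using f \<eta> \<eta>\<theta> by auto
    have A2: "A_const (\<lambda>n. (f n)\<^sup>2) \<eta> \<theta> \<ge> 0" using \<eta> by (intro A_const_nonneg) auto
    have B2A: "B2 \<ge> A_const (\<lambda>n. (f n)\<^sup>2) \<eta> \<theta>" "B2 \<ge> (f \<theta>)\<^sup>2 / real \<theta>"
      using A2 by (simp_all add: B2_def B_const_def)
    then have B20: "B2 \<ge> 0" using A2 by linarith
    have V: "?V \<le> K * (B2 * L)"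
    proof (cases "N \<ge> N0")
      case True
      have "?V \<le> K1 * (\<Sum>b=\<eta>..\<theta>. (f b)\<^sup>2 / (real b)\<^sup>2) * L"
        unfolding L_def using \<theta> True \<eta> f
        by (intro large[THEN spec, THEN mp, THEN spec, THEN spec, THEN spec, THEN mp, THEN mp, THEN mp]) simp_all
      also have "\<dots> \<le> K1 * (6 * B2) * L"
        using sum_squares_le_A_const[OF \<eta>, of f \<theta>] B2A(1) K1 L1 by (intro mult_right_mono mult_left_mono) auto
      also have "\<dots> = (6 * K1) * (B2 * L)" by simp
      also have "\<dots> \<le> K * (B2 * L)" using K2 B20 L1 by (intro mult_right_mono) (auto simp: K_def)
      finally show ?thesis .
    next
      \<comment> \<open>Only finitely many \<open>N\<close> remain. Monotonicity bounds every
        summand by \<open>f \<theta>\<close>, and the square of \<open>f \<theta>\<close> is at most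
        \<open>\<theta> * B2\<close>, because \<open>B2\<close> contains
        \<open>(f \<theta>)^2 / \<theta>\<close>. With \<open>\<theta> <= N0\<close> this gives the
        constant \<open>K2\<close>.\<close>
      case False
      then have NN: "real N \<le> real N0" by simp
      have \<theta>0: "real \<theta> \<ge> 1" using \<eta> \<eta>\<theta> by simp
      have "sqrt (real N) \<le> real N" using N by (intro real_le_lsqrt) (auto simp: power2_eq_square)
      then have \<theta>N: "real \<theta> \<le> real N0" using \<theta> NN by linarith
      have "?V \<le> 2 * (real N + 1) * (real N * f \<theta>)\<^sup>2"
        using N f \<eta> fmono f\<theta> by (intro variance_trivial) auto
      also have "\<dots> \<le> 2 * (real N0 + 1) * (real N0 * f \<theta>)\<^sup>2"
        using NN f\<theta> by (intro mult_mono power_mono) auto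
      also have "\<dots> = 2 * (real N0 + 1) * (real N0)\<^sup>2 * (real \<theta> * ((f \<theta>)\<^sup>2 / real \<theta>))"
        using \<theta>0 by (simp add: power_mult_distrib)
      also have "\<dots> \<le> 2 * (real N0 + 1) * (real N0)\<^sup>2 * (real N0 * B2)"
        using \<theta>N B2A(2) \<theta>0 by (intro mult_left_mono mult_mono) auto
      also have "\<dots> = K2 * (B2 * 1)" by (simp add: K2_def)
      also have "\<dots> \<le> K * (B2 * L)" using K1 K2 B20 L1 by (intro mult_mono) (auto simp: K_def)
      finally show ?thesis .
    qed
    define B where "B = B_const f \<eta> \<theta>"
    have A0: "A_const f \<eta> \<theta> \<ge> 0" using \<eta> f by (intro A_const_nonneg) auto
    have B0: "B \<ge> 0" using A0 f\<theta> by (simp add: B_def B_const_def)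
    have T1: "D_const f \<eta> \<theta> * L\<^sup>2 \<ge> 0"
      unfolding D_const_def B_def[symmetric] using B0 f \<eta> by (intro mult_nonneg_nonneg sum_nonneg divide_nonneg_nonneg) auto
    have T3: "B\<^sup>2 * L * ln L ^ 3 \<ge> 0" using L1 lL by (intro mult_nonneg_nonneg) auto
    have T4: "B * (sqrt B2 + f (nat \<lceil>sqrt (C_const f \<eta> \<theta>)\<rceil>)) * L * ln L \<ge> 0"
    proof (cases "f \<theta> = 0")
      \<comment> \<open>Here \<open>C_const\<close> is \<open>0\<close>, so \<open>f\<close> is
        evaluated at \<open>0\<close>, where its sign is not known; but \<open>B\<close> vanishes
        and the product is \<open>0\<close>. In the other case \<open>C_const\<close> is positive
        and the argument is at least \<open>1\<close>.\<close>
      case True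
      have "f b = 0" if "b \<in> {\<eta>..\<theta>}" for b
      proof -
        have "f b \<le> 0" using fmono[of b \<theta>] that \<eta> True by auto
        moreover have "f b \<ge> 0" using f that \<eta> by auto
        ultimately show ?thesis by linarith
      qed
      then have "B = 0" using True by (simp add: B_def B_const_def A_const_def)
      then show ?thesis by simp
    next
      case False
      then have "f \<theta> > 0" using f\<theta> by simp
      moreover have "real \<theta> > 0" using \<eta> \<eta>\<theta> by simp
      ultimately have "B > 0" using A0 unfolding B_def B_const_def by (intro add_nonneg_pos) auto
      then have "C_const f \<eta> \<theta> > 0" using \<open>f \<theta> > 0\<close> by (simp add: C_const_def B_def)
      then have "nat \<lceil>sqrt (C_const f \<eta> \<theta>)\<rceil> \<ge> 1" by (simp add: Suc_le_eq)
      then have "f (nat \<lceil>sqrt (C_const f \<eta> \<theta>)\<rceil>) \<ge> 0" using f by blast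
      then show ?thesis using B0 B20 L1 lL by (intro mult_nonneg_nonneg add_nonneg_nonneg) auto
    qed
    have "?V \<le> K * (B2 * L)" by (rule V)
    also have "\<dots> \<le> K * (D_const f \<eta> \<theta> * L\<^sup>2 + B2 * L + B\<^sup>2 * L * ln L ^ 3
       + B * (sqrt B2 + f (nat \<lceil>sqrt (C_const f \<eta> \<theta>)\<rceil>)) * L * ln L)"
      using T1 T3 T4 K1 K2 by (intro mult_left_mono) (auto simp: K_def)
    finally show "?V \<le> K * (D_const f \<eta> \<theta> * (ln (real N))\<^sup>2
         + B_const (\<lambda>n. (f n)\<^sup>2) \<eta> \<theta> * ln (real N)
         + (B_const f \<eta> \<theta>)\<^sup>2 * ln (real N) * (ln (ln (real N))) ^ 3
         + B_const f \<eta> \<theta>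
             * (sqrt (B_const (\<lambda>n. (f n)\<^sup>2) \<eta> \<theta>) + f (nat \<lceil>sqrt (C_const f \<eta> \<theta>)\<rceil>))
             * ln (real N) * ln (ln (real N)))"
      unfolding L_def B_def B2_def .
  qed
qed

end
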